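(* Let $M$ be a complete $n$-dimensional smooth orientable Riemannian manifold that is locally Euclidean. Let $\{R_t\}_{t=1}^N$ be an iterated relation system (IRS) on a nonempty compact subset of $M$, and let $K$ be its attractor. Assume that there exists a graph-directed iterated function system (GIFS) $G=(V,E)$ associated to $\{R_t\}_{t=1}^N$ and that $G$ consists of contractive similitudes. Let $\widehat G=(\widehat V,\widehat E)$ be a minimal simplified GIFS associated to $G$. Assume that $\widehat G$ satisfies the graph open set condition (GOSC). For $\alpha\ge 0$ let $\widehat\lambda_\alpha$ be the spectral radius of the incidence matrix $\widehat A_\alpha$ associated to $\widehat G$. (a) $\dim_H(K)=\alpha$, where $\alpha$ is the unique real number such that $\widehat\lambda_\alpha=1$. (b) In particular, let $\widehat G=(\widehat V,\widehat E)$ be a minimal simplified GIFS associated to $G$ and assume that $\widehat G$ consists of contractive similitudes $\{f_t\}_{t=1}^m$. Suppose that $\#\widehat V=1$. If $\{f_t\}_{t=1}^m$ satisfies the open set condition (OSC), then $\dim_H(K)$ is the unique number $\alpha$ satisfying $$\sum_{t=1}^m\rho_t^\alpha=1,$$ where $\rho_t$ is the contraction ratio of $f_t$.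
   Context: Locally Euclidean means locally isometric to $\mathbb R^n$ (flat). Distances on $M$ are Riemannian distances; $\dim_H$ is Hausdorff dimension. A contractive similitude $f$ with contraction ratio $\rho\in(0,1)$ satisfies $d(f(x),f(y))=\rho\, d(x,y)$ on its domain. IRS. A relation $R$ on $E_0$ assigns to each $x\in E_0$ a set $R(x)$; $R(F):=\bigcup_{x\in F}R(x)$. Let $E_0\subseteq M$ be nonempty compact. A family $\{R_t\}_{t=1}^N$ of relations on $E_0$ is an IRS if (1) $R_t(F)$ is nonempty compact for every nonempty compact $F\subseteq E_0$ and every $t$; (2) $R_t(E_0)\subseteq E_0$ for every $t$. Put $E_{k+1}:=\bigcup_{t=1}^NR_t(E_k)$ for $k\ge0$. The attractor is $K:=\bigcap_{k=0}^\infty E_k$. Put $\Sigma=\{1,\dots,N\}$; for $t=(t_1,\dots,t_q)\in\Sigma^q$ let $R_t:=R_{t_1}\circ\cdots\circ R_{t_q}$. GIFS. A GIFS of contractions on $M$ is a directed graph $G=(V,E)$ with $V=\{1,\dots,p\}$, finite edge set $E$ (multiple edges allowed), with domains $X_j\subseteq M$ ($j\in V$) and contractions $f_e:X_j\to X_i$ for each $e\in E^{i,j}$, the set of edges from $i$ to $j$. $E_q^{i,j}$ is the set of directed paths $\mathbf e=(e_1,\dots,e_q)$ from $i$ to $j$, and $f_{\mathbf e}=f_{e_1}\circ\cdots\circ f_{e_q}$. A family $\{U_j\}_{j=1}^p$ of sets ($U_j\subseteq X_j$) is an invariant family under $G$ if $\bigcup_{e\in E^{i,j}}f_e(U_j)\subseteq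 U_i$ for all $i,j$. Associated GIFS. $G$ is associated to $\{R_t\}_{t=1}^N$ (on $E_{k_0}$) if for some integer $k_0\ge0$ one has $E_{k_0}=\bigcup_{j=1}^pW_j$ with each $W_j\subseteq E_{k_0}$ compact (and $W_j\subseteq X_j$), and for every $q\ge1$ $$\bigcup_{t\in\Sigma^q}R_t(E_{k_0})=\bigcup_{i,j=1}^p\bigcup_{\mathbf e\in E_q^{i,j}}f_{\mathbf e}(W_j).$$ Simplified GIFS. Let $\{W_j\}_{j=1}^p$ (the sets above) be an invariant family under $G$. A GIFS $\widetilde G=(\widetilde V,\widetilde E)$, $\widetilde V=\{1,\dots,\widetilde p\}$, is a simplified GIFS associated to $G$ if: (a) $\widetilde E\subseteq E$ and $\{\widetilde W_j\}_{j=1}^{\widetilde p}\subseteq\{W_j\}_{j=1}^p$, $\widetilde p\le p$ (vertices of $\widetilde G$ correspond to the sets $\widetilde W_j$, and the contractions of $\widetilde G$ are $\{f_e\}_{e\in\widetilde E}$); (b) $\{\widetilde W_j\}_{j=1}^{\widetilde p}$ is an invariant family under $\widetilde G$ and for every $q\ge1$ $$\bigcup_{i,j=1}^p\bigcup_{\mathbf e\in E_q^{i,j}}f_{\mathbf e}(W_j)=\bigcup_{i,j=1}^{\widetilde p}\bigcup_{\mathbf e\in\widetilde E_q^{i,j}}f_{\mathbf e}(\widetilde W_j).$$ A simplified GIFS $\widehat G$ given by $(\{\widehat W_j\}_{j=1}^{\widehat p},\{f_e\}_{e\in\widehat E})$ is minimal if $\widehat p\le\widetilde p$ for all simplified GIFSs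 $\widetilde G$ associated to $G$, and among all simplified GIFSs with $\widetilde p=\widehat p$ one has $\#\{f_e\}_{e\in\widehat E}\le\#\{f_e\}_{e\in\widetilde E}$. GOSC. A GIFS $G$ with vertex set $\{1,\dots,m\}$ satisfies (GOSC) if there are nonempty bounded open sets $U_1,\dots,U_m$ of $M$ (with $U_j\subseteq X_j$) such that for all $i$: (a) $\bigcup_{e\in E^{i,j}}f_e(U_j)\subseteq U_i$ for all $j$; (b) $f_e(U_{j_1})\cap f_{e'}(U_{j_2})=\emptyset$ for all distinct $e\in E^{i,j_1}$, $e'\in E^{i,j_2}$. OSC. $\{f_t\}_{t=1}^m$ satisfies (OSC) if there is a nonempty bounded open set $U$ (in the domain of the $f_t$) with $\bigcup_{t=1}^mf_t(U)\subseteq U$ and $f_{t_1}(U)\cap f_{t_2}(U)=\emptyset$ for $t_1\ne t_2$. Incidence matrix. Let $\rho_e$ be the contraction ratio of $f_e$. The incidence matrix of a GIFS has $(i,j)$ entry $\sum_{e\in E^{i,j}}\rho_e^\alpha$ (equal to $0$ if $E^{i,j}=\emptyset$). *)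

theory Defs
  imports
    "HOL-Analysis.Analysis"
    "Graph_Theory.Arc_Walk"
    "Jordan_Normal_Form.Spectral_Radius"
begin

section \<open>Smooth maps between Euclidean spaces\<close>

text \<open>Meant for open \<open>S\<close>: all iterated partial derivatives up to order \<open>k\<close> exist and are
  continuous.\<close>

primrec Ck_on :: "nat \<Rightarrow> ('a::euclidean_space \<Rightarrow> 'b::real_normed_vector) \<Rightarrow> 'a set \<Rightarrow> bool" where
  "Ck_on 0 f S \<longleftrightarrow> continuous_on S f"
| "Ck_on (Suc k) f S \<longleftrightarrow>
     f differentiable_on S \<and> (\<forall>v\<in>Basis. Ck_on k (\<lambda>x. frechet_derivative f (at x) v) S)"

definition smooth_map_on :: "('a::euclidean_space \<Rightarrow> 'b::real_normed_vector) \<Rightarrow> 'a set \<Rightarrow> bool" where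
  "smooth_map_on f S \<longleftrightarrow> (\<forall>k. Ck_on k f S)"


section \<open>Smooth manifolds\<close>

text \<open>The manifold \<open>M\<close> is a type \<open>'a\<close> with its Hausdorff, second countable topology; its dimension
  is \<open>n = CARD('n)\<close>. The smooth structure is given by an atlas, which need not be maximal.\<close>

type_synonym ('a, 'n) chart = "'a set \<times> ('a \<Rightarrow> real ^ 'n)"

definition is_chart :: "('a::topological_space, 'n::finite) chart \<Rightarrow> bool" where
  "is_chart c \<longleftrightarrow> open (fst c) \<and> open (snd c ` fst c) \<and>
     homeomorphism (fst c) (snd c ` fst c) (snd c) (inv_into (fst c) (snd c))"

definition transition ::
    "('a, 'n::finite) chart \<Rightarrow> ('a, 'n) chart \<Rightarrow> real ^ 'n \<Rightarrow> real ^ 'n" where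
  "transition c c' = snd c' \<circ> inv_into (fst c) (snd c)"

definition smoothly_compatible :: "('a, 'n::finite) chart \<Rightarrow> ('a, 'n) chart \<Rightarrow> bool" where
  "smoothly_compatible c c' \<longleftrightarrow>
     smooth_map_on (transition c c') (snd c ` (fst c \<inter> fst c')) \<and>
     smooth_map_on (transition c' c) (snd c' ` (fst c \<inter> fst c'))"

definition smooth_atlas :: "('a::topological_space, 'n::finite) chart set \<Rightarrow> bool" where
  "smooth_atlas A \<longleftrightarrow> (\<forall>c\<in>A. is_chart c) \<and> (\<Union>c\<in>A. fst c) = UNIV \<and>
     (\<forall>c\<in>A. \<forall>c'\<in>A. smoothly_compatible c c')"

definition orientable :: "('a::topological_space, 'n::finite) chart set \<Rightarrow> bool" where
  "orientable A \<longleftrightarrow>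
     (\<exists>B. smooth_atlas B \<and> smooth_atlas (A \<union> B) \<and>
        (\<forall>c\<in>B. \<forall>c'\<in>B. \<forall>x\<in>fst c \<inter> fst c'.
           Determinants.det (jacobian (transition c c') (at (snd c x))) > 0))"


section \<open>Riemannian metrics and distances\<close>

text \<open>A Riemannian metric is given by its Gram matrices \<open>g c x\<close> in the coordinates of each chart
  \<open>c\<close> around \<open>x\<close>; the last clause is the transformation law of a covariant 2-tensor.\<close>

definition riemannian_metric ::
    "('a::topological_space, 'n::finite) chart set \<Rightarrow>
     (('a, 'n) chart \<Rightarrow> 'a \<Rightarrow> real ^ 'n ^ 'n) \<Rightarrow> bool" where
  "riemannian_metric A g \<longleftrightarrow>
     (\<forall>c\<in>A. smooth_map_on (\<lambda>y. g c (inv_into (fst c) (snd c) y)) (snd c ` fst c) \<and>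
        (\<forall>x\<in>fst c. transpose (g c x) = g c x \<and>
           (\<forall>v. v \<noteq> 0 \<longrightarrow> inner v (g c x *v v) > 0))) \<and>
     (\<forall>c\<in>A. \<forall>c'\<in>A. \<forall>x\<in>fst c \<inter> fst c'.
        let J = jacobian (transition c c') (at (snd c x))
        in g c x = transpose J ** g c' x ** J)"

definition C1_curve_on ::
    "('a::topological_space, 'n::finite) chart set \<Rightarrow> (real \<Rightarrow> 'a) \<Rightarrow> real \<Rightarrow> real \<Rightarrow> bool" where
  "C1_curve_on A \<gamma> a b \<longleftrightarrow> continuous_on {a..b} \<gamma> \<and>
     (\<forall>c\<in>A. \<exists>D. continuous_on {t\<in>{a..b}. \<gamma> t \<in> fst c} D \<and>
        (\<forall>t\<in>{a..b}. \<gamma> t \<in> fst c \<longrightarrow>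
           ((snd c \<circ> \<gamma>) has_vector_derivative D t) (at t within {a..b})))"

definition piecewise_C1_curve ::
    "('a::topological_space, 'n::finite) chart set \<Rightarrow> (real \<Rightarrow> 'a) \<Rightarrow> bool" where
  "piecewise_C1_curve A \<gamma> \<longleftrightarrow>
     (\<exists>k \<tau>. \<tau> 0 = 0 \<and> \<tau> k = 1 \<and>
        (\<forall>i<k. \<tau> i < \<tau> (Suc i) \<and> C1_curve_on A \<gamma> (\<tau> i) (\<tau> (Suc i))))"

text \<open>By the transformation law the speed does not depend on the chart chosen. At the finitely many
  break points of a piecewise \<open>C1\<close> curve its value is irrelevant for the length.\<close>

definition curve_speed ::
    "('a, 'n::finite) chart set \<Rightarrow> (('a, 'n) chart \<Rightarrow> 'a \<Rightarrow> real ^ 'n ^ 'n) \<Rightarrow>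
     (real \<Rightarrow> 'a) \<Rightarrow> real \<Rightarrow> real" where
  "curve_speed A g \<gamma> t =
     (let c = (SOME c. c \<in> A \<and> \<gamma> t \<in> fst c);
          v = vector_derivative (snd c \<circ> \<gamma>) (at t)
      in sqrt (inner v (g c (\<gamma> t) *v v)))"

definition curve_length ::
    "('a, 'n::finite) chart set \<Rightarrow> (('a, 'n) chart \<Rightarrow> 'a \<Rightarrow> real ^ 'n ^ 'n) \<Rightarrow>
     (real \<Rightarrow> 'a) \<Rightarrow> real" where
  "curve_length A g \<gamma> = integral {0..1} (curve_speed A g \<gamma>)"

definition riem_dist ::
    "('a::topological_space, 'n::finite) chart set \<Rightarrow>
     (('a, 'n) chart \<Rightarrow> 'a \<Rightarrow> real ^ 'n ^ 'n) \<Rightarrow> 'a \<Rightarrow> 'a \<Rightarrow> real" where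
  "riem_dist A g x y =
     (INF \<gamma> \<in> {\<gamma>. piecewise_C1_curve A \<gamma> \<and> \<gamma> 0 = x \<and> \<gamma> 1 = y}. curve_length A g \<gamma>)"

text \<open>Every point has a coordinate neighbourhood (in the smooth structure of \<open>A\<close>) on which the
  chart map is a Riemannian isometry onto an open subset of \<open>\<real>\<^sup>n\<close>, i.e. \<open>g\<close> is the pull-back of
  the Euclidean metric.\<close>

definition locally_euclidean_metric ::
    "('a::topological_space, 'n::finite) chart set \<Rightarrow>
     (('a, 'n) chart \<Rightarrow> 'a \<Rightarrow> real ^ 'n ^ 'n) \<Rightarrow> bool" where
  "locally_euclidean_metric A g \<longleftrightarrow>
     (\<forall>x. \<exists>c. x \<in> fst c \<and> is_chart c \<and>
        (\<forall>c'\<in>A. smoothly_compatible c c' \<and>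
           (\<forall>y\<in>fst c \<inter> fst c'.
              let J = jacobian (transition c' c) (at (snd c' y))
              in g c' y = transpose J ** J)))"

text \<open>Connectedness is part of the notion of manifold here: it makes the Riemannian distance finite.\<close>

definition complete_flat_orientable_manifold ::
    "('a::{t2_space, second_countable_topology}, 'n::finite) chart set \<Rightarrow>
     (('a, 'n) chart \<Rightarrow> 'a \<Rightarrow> real ^ 'n ^ 'n) \<Rightarrow> bool" where
  "complete_flat_orientable_manifold A g \<longleftrightarrow>
     connected (UNIV :: 'a set) \<and> smooth_atlas A \<and> orientable A \<and>
     riemannian_metric A g \<and> locally_euclidean_metric A g \<and>
     Metric_space.mcomplete UNIV (riem_dist A g)"


section \<open>Hausdorff dimension\<close>

text \<open>All notions are relative to a distance function \<open>d\<close>. The convention is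
  \<open>0\<^sup>0 = 1\<close> for nonempty sets (whereas \<open>0 powr 0 = 0\<close>), and the empty set contributes \<open>0\<close>.\<close>

definition diam_powr :: "('a \<Rightarrow> 'a \<Rightarrow> real) \<Rightarrow> real \<Rightarrow> 'a set \<Rightarrow> real" where
  "diam_powr d s C =
     (if C = {} then 0 else if s = 0 then 1 else (SUP (x, y)\<in>C \<times> C. d x y) powr s)"

definition hausdorff_premeasure ::
    "('a \<Rightarrow> 'a \<Rightarrow> real) \<Rightarrow> real \<Rightarrow> real \<Rightarrow> 'a set \<Rightarrow> ennreal" where
  "hausdorff_premeasure d s \<delta> F =
     (INF C \<in> {C :: nat \<Rightarrow> 'a set. F \<subseteq> (\<Union>i. C i) \<and> (\<forall>i. \<forall>x\<in>C i. \<forall>y\<in>C i. d x y \<le> \<delta>)}.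
        \<Sum>i. ennreal (diam_powr d s (C i)))"

definition hausdorff_measure :: "('a \<Rightarrow> 'a \<Rightarrow> real) \<Rightarrow> real \<Rightarrow> 'a set \<Rightarrow> ennreal" where
  "hausdorff_measure d s F = (SUP \<delta> \<in> {0<..}. hausdorff_premeasure d s \<delta> F)"

definition hausdorff_dim :: "('a \<Rightarrow> 'a \<Rightarrow> real) \<Rightarrow> 'a set \<Rightarrow> ereal" where
  "hausdorff_dim d F = (INF s \<in> {s. s \<ge> 0 \<and> hausdorff_measure d s F = 0}. ereal s)"


section \<open>Iterated relation systems\<close>

definition rel_image :: "('a \<Rightarrow> 'a set) \<Rightarrow> 'a set \<Rightarrow> 'a set" where
  "rel_image R F = (\<Union>x\<in>F. R x)"

definition is_IRS :: "'a::topological_space set \<Rightarrow> nat \<Rightarrow> (nat \<Rightarrow> 'a \<Rightarrow> 'a set) \<Rightarrow> bool" where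
  "is_IRS E0 N R \<longleftrightarrow> compact E0 \<and> E0 \<noteq> {} \<and> N \<ge> 1 \<and>
     (\<forall>t\<in>{1..N}. (\<forall>F. compact F \<and> F \<noteq> {} \<and> F \<subseteq> E0 \<longrightarrow>
                      compact (rel_image (R t) F) \<and> rel_image (R t) F \<noteq> {}) \<and>
                 rel_image (R t) E0 \<subseteq> E0)"

primrec irs_level :: "'a set \<Rightarrow> nat \<Rightarrow> (nat \<Rightarrow> 'a \<Rightarrow> 'a set) \<Rightarrow> nat \<Rightarrow> 'a set" where
  "irs_level E0 N R 0 = E0"
| "irs_level E0 N R (Suc k) = (\<Union>t\<in>{1..N}. rel_image (R t) (irs_level E0 N R k))"

definition irs_attractor :: "'a set \<Rightarrow> nat \<Rightarrow> (nat \<Rightarrow> 'a \<Rightarrow> 'a set) \<Rightarrow> 'a set" where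
  "irs_attractor E0 N R = (\<Inter>k. irs_level E0 N R k)"

text \<open>The image \<open>(R\<^sub>t\<^sub>1 \<circ> \<dots> \<circ> R\<^sub>t\<^sub>q)(F)\<close> for the word \<open>ts = [t1, \<dots>, tq]\<close>.\<close>

definition word_image :: "(nat \<Rightarrow> 'a \<Rightarrow> 'a set) \<Rightarrow> nat list \<Rightarrow> 'a set \<Rightarrow> 'a set" where
  "word_image R ts F = foldr (\<lambda>t. rel_image (R t)) ts F"


section \<open>Graph-directed iterated function systems\<close>

text \<open>An edge \<open>e\<close> from \<open>i = tail e\<close> to \<open>j = head e\<close> carries a map \<open>f\<^sub>e : X\<^sub>j \<rightarrow> X\<^sub>i\<close>.\<close>

record ('a, 'e) gifs =
  graph :: "(nat, 'e) pre_digraph"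
  domain_of :: "nat \<Rightarrow> 'a set"
  map_of_edge :: "'e \<Rightarrow> 'a \<Rightarrow> 'a"

abbreviation gifs_order :: "('a, 'e) gifs \<Rightarrow> nat" where
  "gifs_order G \<equiv> card (verts (graph G))"

abbreviation edges :: "('a, 'e) gifs \<Rightarrow> 'e set" where
  "edges G \<equiv> arcs (graph G)"

definition edges_between :: "('a, 'e) gifs \<Rightarrow> nat \<Rightarrow> nat \<Rightarrow> 'e set" where
  "edges_between G i j = {e \<in> edges G. tail (graph G) e = i \<and> head (graph G) e = j}"

definition paths :: "('a, 'e) gifs \<Rightarrow> nat \<Rightarrow> nat \<Rightarrow> nat \<Rightarrow> 'e list set" where
  "paths G q i j = {es. pre_digraph.awalk (graph G) i es j \<and> length es = q}"

definition path_map :: "('a, 'e) gifs \<Rightarrow> 'e list \<Rightarrow> 'a \<Rightarrow> 'a" where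
  "path_map G es = foldr (\<circ>) (map (map_of_edge G) es) id"

definition contraction_on :: "('a \<Rightarrow> 'a \<Rightarrow> real) \<Rightarrow> 'a set \<Rightarrow> ('a \<Rightarrow> 'a) \<Rightarrow> bool" where
  "contraction_on d X f \<longleftrightarrow>
     (\<exists>c. 0 \<le> c \<and> c < 1 \<and> (\<forall>x\<in>X. \<forall>y\<in>X. d (f x) (f y) \<le> c * d x y))"

definition is_GIFS :: "('a \<Rightarrow> 'a \<Rightarrow> real) \<Rightarrow> ('a, 'e) gifs \<Rightarrow> bool" where
  "is_GIFS d G \<longleftrightarrow> fin_digraph (graph G) \<and> (\<exists>p. verts (graph G) = {1..p}) \<and>
     (\<forall>i\<in>verts (graph G). \<forall>j\<in>verts (graph G). \<forall>e\<in>edges_between G i j.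
        map_of_edge G e ` domain_of G j \<subseteq> domain_of G i \<and>
        contraction_on d (domain_of G j) (map_of_edge G e))"

definition contractive_similitudes ::
    "('a \<Rightarrow> 'a \<Rightarrow> real) \<Rightarrow> ('a, 'e) gifs \<Rightarrow> ('e \<Rightarrow> real) \<Rightarrow> bool" where
  "contractive_similitudes d G \<rho> \<longleftrightarrow>
     (\<forall>e\<in>edges G. 0 < \<rho> e \<and> \<rho> e < 1 \<and>
        (\<forall>x\<in>domain_of G (head (graph G) e). \<forall>y\<in>domain_of G (head (graph G) e).
           d (map_of_edge G e x) (map_of_edge G e y) = \<rho> e * d x y))"

definition invariant_family :: "('a, 'e) gifs \<Rightarrow> (nat \<Rightarrow> 'a set) \<Rightarrow> bool" where
  "invariant_family G U \<longleftrightarrow>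
     (\<forall>j\<in>verts (graph G). U j \<subseteq> domain_of G j) \<and>
     (\<forall>i\<in>verts (graph G). \<forall>j\<in>verts (graph G).
        (\<Union>e\<in>edges_between G i j. map_of_edge G e ` U j) \<subseteq> U i)"

definition gifs_level :: "('a, 'e) gifs \<Rightarrow> (nat \<Rightarrow> 'a set) \<Rightarrow> nat \<Rightarrow> 'a set" where
  "gifs_level G W q =
     (\<Union>i\<in>verts (graph G). \<Union>j\<in>verts (graph G). \<Union>es\<in>paths G q i j. path_map G es ` W j)"

definition associated_GIFS ::
    "'a::topological_space set \<Rightarrow> nat \<Rightarrow> (nat \<Rightarrow> 'a \<Rightarrow> 'a set) \<Rightarrow> nat \<Rightarrow>
     ('a, 'e) gifs \<Rightarrow> (nat \<Rightarrow> 'a set) \<Rightarrow> bool" where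
  "associated_GIFS E0 N R k0 G W \<longleftrightarrow>
     irs_level E0 N R k0 = (\<Union>j\<in>verts (graph G). W j) \<and>
     (\<forall>j\<in>verts (graph G). compact (W j) \<and> W j \<subseteq> irs_level E0 N R k0 \<and> W j \<subseteq> domain_of G j) \<and>
     (\<forall>q\<ge>1. (\<Union>ts\<in>{ts. set ts \<subseteq> {1..N} \<and> length ts = q}.
                word_image R ts (irs_level E0 N R k0)) = gifs_level G W q)"

text \<open>Vertices correspond one to one to members of the family \<open>W\<close>: the vertex \<open>j\<close> of \<open>G'\<close>, which stands for the set \<open>W' j\<close>, is identified with the vertex
  \<open>\<sigma> j\<close> of \<open>G\<close>; up to this relabelling \<open>G'\<close> is a subgraph of \<open>G\<close> with the same maps.\<close>

definition simplified_GIFS ::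
    "('a \<Rightarrow> 'a \<Rightarrow> real) \<Rightarrow> ('a, 'e) gifs \<Rightarrow> (nat \<Rightarrow> 'a set) \<Rightarrow>
     ('a, 'e) gifs \<Rightarrow> (nat \<Rightarrow> 'a set) \<Rightarrow> bool" where
  "simplified_GIFS d G W G' W' \<longleftrightarrow>
     invariant_family G W \<and>
     is_GIFS d G' \<and> edges G' \<subseteq> edges G \<and> gifs_order G' \<le> gifs_order G \<and>
     (\<exists>\<sigma>. inj_on \<sigma> (verts (graph G')) \<and> \<sigma> ` verts (graph G') \<subseteq> verts (graph G) \<and>
        (\<forall>j\<in>verts (graph G'). W' j = W (\<sigma> j) \<and> domain_of G' j = domain_of G (\<sigma> j)) \<and>
        (\<forall>e\<in>edges G'. tail (graph G) e = \<sigma> (tail (graph G') e) \<and>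
                       head (graph G) e = \<sigma> (head (graph G') e) \<and>
                       map_of_edge G' e = map_of_edge G e)) \<and>
     invariant_family G' W' \<and>
     (\<forall>q\<ge>1. gifs_level G W q = gifs_level G' W' q)"

text \<open>The contractions are counted as members of a family indexed by the edges.\<close>

definition minimal_simplified_GIFS ::
    "('a \<Rightarrow> 'a \<Rightarrow> real) \<Rightarrow> ('a, 'e) gifs \<Rightarrow> (nat \<Rightarrow> 'a set) \<Rightarrow>
     ('a, 'e) gifs \<Rightarrow> (nat \<Rightarrow> 'a set) \<Rightarrow> bool" where
  "minimal_simplified_GIFS d G W G' W' \<longleftrightarrow>
     simplified_GIFS d G W G' W' \<and>
     (\<forall>G'' W''. simplified_GIFS d G W G'' W'' \<longrightarrow>
        gifs_order G' \<le> gifs_order G'' \<and>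
        (gifs_order G'' = gifs_order G' \<longrightarrow> card (edges G') \<le> card (edges G'')))"

definition GOSC :: "('a::topological_space \<Rightarrow> 'a \<Rightarrow> real) \<Rightarrow> ('a, 'e) gifs \<Rightarrow> bool" where
  "GOSC d G \<longleftrightarrow>
     (\<exists>U. (\<forall>j\<in>verts (graph G). U j \<noteq> {} \<and> open (U j) \<and> Metric_space.mbounded UNIV d (U j) \<and>
             U j \<subseteq> domain_of G j) \<and>
        (\<forall>i\<in>verts (graph G).
           (\<forall>j\<in>verts (graph G). (\<Union>e\<in>edges_between G i j. map_of_edge G e ` U j) \<subseteq> U i) \<and>
           (\<forall>j1\<in>verts (graph G). \<forall>j2\<in>verts (graph G).
              \<forall>e\<in>edges_between G i j1. \<forall>e'\<in>edges_between G i j2. e \<noteq> e' \<longrightarrow>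
                map_of_edge G e ` U j1 \<inter> map_of_edge G e' ` U j2 = {})))"

definition OSC ::
    "('a::topological_space \<Rightarrow> 'a \<Rightarrow> real) \<Rightarrow> 'a set \<Rightarrow> nat \<Rightarrow> (nat \<Rightarrow> 'a \<Rightarrow> 'a) \<Rightarrow> bool" where
  "OSC d X m f \<longleftrightarrow>
     (\<exists>U. U \<noteq> {} \<and> open U \<and> Metric_space.mbounded UNIV d U \<and> U \<subseteq> X \<and>
        (\<Union>t\<in>{1..m}. f t ` U) \<subseteq> U \<and>
        (\<forall>t1\<in>{1..m}. \<forall>t2\<in>{1..m}. t1 \<noteq> t2 \<longrightarrow> f t1 ` U \<inter> f t2 ` U = {}))"

text \<open>Vertices are numbered from 1, matrix indices from 0.\<close>

definition incidence_matrix :: "('a, 'e) gifs \<Rightarrow> ('e \<Rightarrow> real) \<Rightarrow> real \<Rightarrow> complex Matrix.mat" where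
  "incidence_matrix G \<rho> \<alpha> =
     Matrix.mat (gifs_order G) (gifs_order G)
       (\<lambda>(i, j). complex_of_real (\<Sum>e\<in>edges_between G (Suc i) (Suc j). \<rho> e powr \<alpha>))"

end

theory Submission
  imports Defs
begin

text \<open>In a flat chart the speed of a curve is the Euclidean speed of its image, so near every point the
  Riemannian distance is the Euclidean one. Everything about the attractor then only uses that \<open>d\<close> is a
  metric inducing the topology and locally isometric to \<open>\<real>\<^sup>n\<close>.

  Let \<open>A\<^sub>s\<close> be the incidence matrix, so that the entries of \<open>A\<^sub>s\<^sup>q\<close> sum \<open>\<rho>\<^sup>s\<close> over the paths of length
  \<open>q\<close>. If \<open>s > \<alpha>\<close>, its spectral radius is below 1, the powers tend to 0 and the covers by the sets
  \<open>f\<^sub>e(W\<^sub>j)\<close>, \<open>e\<close> a path of length \<open>q\<close>, show that the \<open>s\<close>-dimensional measure vanishes. If \<open>s < \<alpha>\<close>,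
  the spectral radius exceeds 1, so that some diagonal entry of some power exceeds 1: the loops at one vertex form an ordinary
  iterated function system with open set condition and \<open>\<Sum>\<rho>\<^sup>s > 1\<close>. Passing to an iterate
  one may even take all contraction ratios equal, and a mass distribution argument gives positive
  \<open>s\<close>-dimensional measure; no Perron-Frobenius eigenvector and no strong connectedness is needed.
  Minimality of the simplified system is used only to exclude vertices with \<open>W\<^sub>j = \<emptyset>\<close>,
  whose loops would contribute to the spectral radius but not to the attractor.\<close>

section \<open>Curves in flat charts\<close>

text \<open>In the lower bound, Euclidean geometry is available only in small balls, and the open
  set condition gives disjoint images of \<open>U\<close> without saying how large they are. A
  similitude of a flat space maps a small ball onto a full ball, by invariance of domain and
  completeness. Disjoint images therefore have separated base points, and separated points of a
  small ball can be counted after rescaling. This works once words are long enough for their cells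
  to fit into balls isometric to Euclidean ones. Equal ratios give all words of one length the same
  scale, so that no stopping-time families of words arise. The sets \<open>U\<close> and
  \<open>W\<close> of a vertex need not meet; their distance enters as a constant that shrinks with
  the cells. Lower bounds for the Riemannian distance meet another obstacle: a curve between nearby
  points may leave the chart. They come from functions on the whole manifold that are locally
  1-Lipschitz in flat coordinates. At the critical exponent, continuity of the path sums in
  \<open>s\<close> stands in for continuity of the spectral radius.\<close>

lemma continuous_on_locally:
  fixes f :: "'a::topological_space \<Rightarrow> 'b::topological_space"
  assumes "\<And>t. t \<in> S \<Longrightarrow> \<exists>O'. open O' \<and> t \<in> O' \<and> continuous_on (S \<inter> O') f"
  shows "continuous_on S f"
  unfolding continuous_on_def
proof (rule ballI)
  fix t assume t: "t \<in> S"
  obtain V where V: "open V" "t \<in> V" "continuous_on (S \<inter> V) f" using assms[OF t] by auto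
  have "(f \<longlongrightarrow> f t) (at t within S \<inter> V)"
    using V t by (simp add: continuous_on_def)
  moreover have "at t within S \<inter> V = at t within S"
    by (rule at_within_nhd[of t V]) (use V in auto)
  ultimately show "(f \<longlongrightarrow> f t) (at t within S)" by simp
qed

lemma smooth_map_on_derivative:
  fixes f :: "'a::euclidean_space \<Rightarrow> 'b::real_normed_vector"
  assumes f: "smooth_map_on f S" and S: "open S" and x: "x \<in> S"
  shows "(f has_derivative frechet_derivative f (at x)) (at x)"
proof -
  have "Ck_on (Suc 0) f S" using f unfolding smooth_map_on_def by (rule spec)
  hence "f differentiable_on S" by simp
  hence "f differentiable (at x within S)" using x by (simp add: differentiable_on_def)
  hence "f differentiable (at x)" by (simp add: at_within_open[OF x S])
  thus ?thesis by (simp add: frechet_derivative_works)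
qed

lemma smooth_map_on_continuous_derivative:
  fixes f :: "'a::euclidean_space \<Rightarrow> 'b::real_normed_vector"
  assumes f: "smooth_map_on f S" and S: "open S"
    and p: "continuous_on T p" "p ` T \<subseteq> S" and w: "continuous_on T w"
  shows "continuous_on T (\<lambda>t. frechet_derivative f (at (p t)) (w t))"
proof -
  have C: "Ck_on (Suc 0) f S" using f unfolding smooth_map_on_def by blast
  have c: "continuous_on T (\<lambda>t. frechet_derivative f (at (p t)) b)" if "b \<in> Basis" for b
  proof -
    have "continuous_on S (\<lambda>x. frechet_derivative f (at x) b)" using C that by simp
    from continuous_on_compose2[OF this p] show ?thesis .
  qed
  \<comment> \<open>\<open>Ck_on\<close> gives continuity of the partial derivatives only; linearity
    extends it to the direction \<open>w t\<close>, which varies with \<open>t\<close>.\<close>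
  have "frechet_derivative f (at (p t)) (w t) =
      (\<Sum>b\<in>Basis. (w t \<bullet> b) *\<^sub>R frechet_derivative f (at (p t)) b)" if "t \<in> T" for t
  proof -
    have l: "linear (frechet_derivative f (at (p t)))"
      using smooth_map_on_derivative[OF f S, of "p t"] p that has_derivative_linear by blast
    have "frechet_derivative f (at (p t)) (w t) =
        frechet_derivative f (at (p t)) (\<Sum>b\<in>Basis. (w t \<bullet> b) *\<^sub>R b)"
      by (simp add: euclidean_representation)
    thus ?thesis using l by (simp add: linear_sum linear_cmul o_def)
  qed
  moreover have "continuous_on T (\<lambda>t. \<Sum>b\<in>Basis. (w t \<bullet> b) *\<^sub>R frechet_derivative f (at (p t)) b)"
    using c w by (intro continuous_intros) auto
  ultimately show ?thesis by (simp cong: continuous_on_cong)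
qed

lemma is_chart_facts:
  assumes "is_chart c"
  shows "open (fst c)" "open (snd c ` fst c)" "inj_on (snd c) (fst c)"
    "continuous_on (fst c) (snd c)"
    "continuous_on (snd c ` fst c) (inv_into (fst c) (snd c))"
    "x \<in> fst c \<Longrightarrow> inv_into (fst c) (snd c) (snd c x) = x"
    "U \<subseteq> fst c \<Longrightarrow> open U \<Longrightarrow> open (snd c ` U)"
proof -
  have h: "homeomorphism (fst c) (snd c ` fst c) (snd c) (inv_into (fst c) (snd c))"
    and o: "open (fst c)" "open (snd c ` fst c)" using assms unfolding is_chart_def by auto
  show "open (fst c)" "open (snd c ` fst c)" by (fact o)+
  show i: "inj_on (snd c) (fst c)" using h unfolding homeomorphism_def
    by (intro inj_on_inverseI[of _ "inv_into (fst c) (snd c)"]) auto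
  show "continuous_on (fst c) (snd c)"
    "continuous_on (snd c ` fst c) (inv_into (fst c) (snd c))"
    using h unfolding homeomorphism_def by auto
  show "inv_into (fst c) (snd c) (snd c x) = x" if "x \<in> fst c"
    using i that by (rule inv_into_f_f)
  show "open (snd c ` U)" if "U \<subseteq> fst c" "open U"
  proof -
    have "openin (top_of_set (fst c)) U" using that by (simp add: open_subset)
    from homeomorphism_imp_open_map[OF h this] show ?thesis
      using o openin_open_trans by blast
  qed
qed

text \<open>The chain rule applies to \<open>transition c c'\<close> after
  \<open>snd c o \<gamma>\<close>, which equals \<open>snd c' o \<gamma>\<close> only while \<gamma>
  stays in \<open>fst c\<close>. By continuity of \<gamma> this is so near \<open>t\<close>, and a
  derivative sees no more.\<close>

lemma chart_change_derivative:
  fixes c c' :: "('a::topological_space, 'n::finite) chart"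
  assumes c: "is_chart c" and c': "is_chart c'"
    and s: "smooth_map_on (transition c c') (snd c ` (fst c \<inter> fst c'))"
    and \<gamma>: "continuous_on I \<gamma>" and t: "t \<in> I" "\<gamma> t \<in> fst c" "\<gamma> t \<in> fst c'"
    and w: "((snd c \<circ> \<gamma>) has_vector_derivative w) (at t within I)"
  shows "((snd c' \<circ> \<gamma>) has_vector_derivative
      frechet_derivative (transition c c') (at (snd c (\<gamma> t))) w) (at t within I)"
proof -
  have op: "open (snd c ` (fst c \<inter> fst c'))"
    using is_chart_facts(1)[OF c] is_chart_facts(1)[OF c']
    by (intro is_chart_facts(7)[OF c]) auto
  have d: "(transition c c' has_derivative frechet_derivative (transition c c') (at (snd c (\<gamma> t))))
      (at (snd c (\<gamma> t)))"
    by (rule smooth_map_on_derivative[OF s op]) (use t in auto)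
  have "((transition c c' \<circ> (snd c \<circ> \<gamma>)) has_vector_derivative
      frechet_derivative (transition c c') (at (snd c (\<gamma> t))) w) (at t within I)"
    by (rule vector_derivative_diff_chain_within[OF w])
      (use d in \<open>auto intro: has_derivative_at_withinI\<close>)
  note D = this
  have "openin (top_of_set I) (I \<inter> \<gamma> -` fst c)"
    using \<gamma> is_chart_facts(1)[OF c] by (rule continuous_openin_preimage_gen)
  then obtain e where e: "e > 0" "\<And>s. s \<in> I \<Longrightarrow> dist s t < e \<Longrightarrow> s \<in> I \<inter> \<gamma> -` fst c"
    using t unfolding openin_euclidean_subtopology_iff by (metis (lifting) IntI vimageI)
  have "(transition c c' \<circ> (snd c \<circ> \<gamma>)) s = (snd c' \<circ> \<gamma>) s" if "s \<in> I" "dist s t < e" for s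
    using e(2)[OF that] is_chart_facts(6)[OF c] by (simp add: transition_def)
  with D show ?thesis
    by (rule has_vector_derivative_transform_within[OF _ e(1) t(1)])
qed

lemma continuous_chart_change_derivative:
  fixes c c' :: "('a::topological_space, 'n::finite) chart"
  assumes c: "is_chart c" and c': "is_chart c'"
    and s: "smooth_map_on (transition c c') (snd c ` (fst c \<inter> fst c'))"
    and \<gamma>: "continuous_on T \<gamma>" and T: "\<gamma> ` T \<subseteq> fst c \<inter> fst c'"
    and w: "continuous_on T w"
  shows "continuous_on T (\<lambda>t. frechet_derivative (transition c c') (at (snd c (\<gamma> t))) (w t))"
proof (rule smooth_map_on_continuous_derivative[OF s _ _ _ w])
  show "open (snd c ` (fst c \<inter> fst c'))"
    using is_chart_facts(1)[OF c] is_chart_facts(1)[OF c']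
    by (intro is_chart_facts(7)[OF c]) auto
  show "continuous_on T (\<lambda>t. snd c (\<gamma> t))"
    by (rule continuous_on_compose2[OF is_chart_facts(4)[OF c] \<gamma>]) (use T in auto)
qed (use T in auto)

text \<open>Flatness is stated through Gram matrices. In this form it says that the metric norm of a
  tangent vector is the Euclidean norm of its image in the flat chart.\<close>

lemma inner_jacobian:
  fixes f :: "real ^ 'n::finite \<Rightarrow> real ^ 'n"
  assumes "(f has_derivative f') (at x)"
  shows "inner v ((transpose (jacobian f (at x)) ** jacobian f (at x)) *v v) = (norm (f' v))\<^sup>2"
proof -
  have f': "f' = frechet_derivative f (at x)" using frechet_derivative_at assms by blast
  have "linear f'" using assms has_derivative_linear by blast
  hence J: "jacobian f (at x) *v u = f' u" for u
    unfolding jacobian_def f'[symmetric] by (simp add: matrix_works)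
  have "inner v ((transpose (jacobian f (at x)) ** jacobian f (at x)) *v v)
     = inner v (transpose (jacobian f (at x)) *v f' v)"
    by (simp add: J flip: matrix_vector_mul_assoc)
  also have "\<dots> = inner (f' v) (f' v)"
    by (simp add: transpose_matrix_vector dot_lmul_matrix J inner_commute[of v])
  finally show ?thesis by (simp add: power2_norm_eq_inner)
qed

section \<open>Velocity and speed of a curve in flat coordinates\<close>

locale flat_manifold =
  fixes A :: "('a::{t2_space, second_countable_topology}, 'n::finite) chart set"
    and g :: "('a, 'n) chart \<Rightarrow> 'a \<Rightarrow> real ^ 'n ^ 'n"
  assumes atlas: "smooth_atlas A"
    and metric: "riemannian_metric A g"
    and flat: "locally_euclidean_metric A g"
    and conn: "connected (UNIV :: 'a set)"
begin

text \<open>Such a chart need not belong to \<open>A\<close>; facts about curves reach it from the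
  charts of \<open>A\<close> through the transition maps.\<close>

definition flat_chart :: "('a, 'n) chart \<Rightarrow> bool" where
  "flat_chart c \<longleftrightarrow> is_chart c \<and>
     (\<forall>c'\<in>A. smoothly_compatible c c' \<and>
        (\<forall>y\<in>fst c \<inter> fst c'.
           let J = jacobian (transition c' c) (at (snd c' y)) in g c' y = transpose J ** J))"

lemma flat_chart_exists: "\<exists>c. flat_chart c \<and> x \<in> fst c"
  using flat unfolding locally_euclidean_metric_def flat_chart_def by meson

lemma flat_chart_is_chart: "flat_chart c \<Longrightarrow> is_chart c"
  by (simp add: flat_chart_def)

lemma atlas_is_chart: "c \<in> A \<Longrightarrow> is_chart c"
  using atlas by (simp add: smooth_atlas_def)

lemma atlas_cover: "\<exists>c. c \<in> A \<and> x \<in> fst c"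
  using atlas unfolding smooth_atlas_def by blast

lemma flat_chart_smooth:
  assumes "flat_chart c" "c' \<in> A"
  shows "smooth_map_on (transition c' c) (snd c' ` (fst c' \<inter> fst c))"
    and "smooth_map_on (transition c c') (snd c ` (fst c \<inter> fst c'))"
  using assms by (auto simp: flat_chart_def smoothly_compatible_def Int_commute)

text \<open>The derivative within the interval of one piece: at a break point the one-sided
  derivatives of the whole curve may differ.\<close>

definition velocity :: "real \<Rightarrow> real \<Rightarrow> (real \<Rightarrow> 'a) \<Rightarrow> ('a, 'n) chart \<Rightarrow> real \<Rightarrow> real ^ 'n" where
  "velocity a b \<gamma> c t = vector_derivative (snd c \<circ> \<gamma>) (at t within {a..b})"

lemma velocity_eq:
  assumes "a < b" "t \<in> {a..b}" "((snd c \<circ> \<gamma>) has_vector_derivative w) (at t within {a..b})"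
  shows "velocity a b \<gamma> c t = w"
  unfolding velocity_def using vector_derivative_within_cbox[of a b t] assms by auto

lemma velocity_atlas:
  assumes \<gamma>: "C1_curve_on A \<gamma> a b" and ab: "a < b" and c: "c \<in> A"
  shows "t \<in> {a..b} \<Longrightarrow> \<gamma> t \<in> fst c \<Longrightarrow>
      ((snd c \<circ> \<gamma>) has_vector_derivative velocity a b \<gamma> c t) (at t within {a..b})"
    and "continuous_on {t\<in>{a..b}. \<gamma> t \<in> fst c} (velocity a b \<gamma> c)"
proof -
  obtain D where D: "continuous_on {t\<in>{a..b}. \<gamma> t \<in> fst c} D"
    "\<And>t. t \<in> {a..b} \<Longrightarrow> \<gamma> t \<in> fst c \<Longrightarrow>
       ((snd c \<circ> \<gamma>) has_vector_derivative D t) (at t within {a..b})"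
    using \<gamma> c unfolding C1_curve_on_def by meson
  have v: "velocity a b \<gamma> c t = D t" if "t \<in> {a..b}" "\<gamma> t \<in> fst c" for t
    by (rule velocity_eq[OF ab that(1) D(2)[OF that]])
  show "((snd c \<circ> \<gamma>) has_vector_derivative velocity a b \<gamma> c t) (at t within {a..b})"
    if "t \<in> {a..b}" "\<gamma> t \<in> fst c"
    using D(2)[OF that] v[OF that] by simp
  show "continuous_on {t\<in>{a..b}. \<gamma> t \<in> fst c} (velocity a b \<gamma> c)"
    using D(1) by (rule continuous_on_eq) (simp add: v)
qed

text \<open>Mirrors \<open>curve_speed\<close>, with the derivative taken within
  \<open>{a..b}\<close>. Both agree in the open interval, but this version is continuous up to the
  end points, where \<open>curve_speed\<close> may take any value.\<close>

definition local_speed :: "real \<Rightarrow> real \<Rightarrow> (real \<Rightarrow> 'a) \<Rightarrow> real \<Rightarrow> real" where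
  "local_speed a b \<gamma> t =
     (let c = (SOME c. c \<in> A \<and> \<gamma> t \<in> fst c); v = velocity a b \<gamma> c t
      in sqrt (inner v (g c (\<gamma> t) *v v)))"

text \<open>\<open>C1_curve_on\<close> speaks of the charts of \<open>A\<close> only, so
  differentiability in \<open>c0\<close> comes from a change of chart. The last claim frees the
  speed from the chart that \<open>local_speed\<close> happens to pick.\<close>

lemma velocity_flat:
  assumes \<gamma>: "C1_curve_on A \<gamma> a b" and ab: "a < b" and c0: "flat_chart c0"
    and t: "t \<in> {a..b}" "\<gamma> t \<in> fst c0"
  shows "((snd c0 \<circ> \<gamma>) has_vector_derivative velocity a b \<gamma> c0 t) (at t within {a..b})"
    and "c \<in> A \<Longrightarrow> \<gamma> t \<in> fst c \<Longrightarrow> velocity a b \<gamma> c0 t =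
      frechet_derivative (transition c c0) (at (snd c (\<gamma> t))) (velocity a b \<gamma> c t)"
    and "norm (velocity a b \<gamma> c0 t) = local_speed a b \<gamma> t"
proof -
  have con: "continuous_on {a..b} \<gamma>" using \<gamma> by (simp add: C1_curve_on_def)
  have 1: "((snd c0 \<circ> \<gamma>) has_vector_derivative
      frechet_derivative (transition c c0) (at (snd c (\<gamma> t))) (velocity a b \<gamma> c t)) (at t within {a..b})"
    if "c \<in> A" "\<gamma> t \<in> fst c" for c
    by (rule chart_change_derivative[OF atlas_is_chart[OF that(1)] flat_chart_is_chart[OF c0]
          flat_chart_smooth(1)[OF c0 that(1)] con t(1) that(2) t(2)
          velocity_atlas(1)[OF \<gamma> ab that(1) t(1) that(2)]])
  show 2: "velocity a b \<gamma> c0 t =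
      frechet_derivative (transition c c0) (at (snd c (\<gamma> t))) (velocity a b \<gamma> c t)"
    if "c \<in> A" "\<gamma> t \<in> fst c" for c
    by (rule velocity_eq[OF ab t(1) 1[OF that]])
  obtain c where c: "c \<in> A" "\<gamma> t \<in> fst c" using atlas_cover by blast
  show "((snd c0 \<circ> \<gamma>) has_vector_derivative velocity a b \<gamma> c0 t) (at t within {a..b})"
    using 1[OF c] 2[OF c] by simp
  \<comment> \<open>The chart hidden in the definition of \<open>local_speed\<close>.\<close>
  define c1 where "c1 = (SOME c. c \<in> A \<and> \<gamma> t \<in> fst c)"
  have c1: "c1 \<in> A" "\<gamma> t \<in> fst c1" using someI_ex[OF atlas_cover[of "\<gamma> t"]] by (auto simp: c1_def)
  have op: "open (snd c1 ` (fst c1 \<inter> fst c0))"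
    using is_chart_facts(1)[OF atlas_is_chart[OF c1(1)]] is_chart_facts(1)[OF flat_chart_is_chart[OF c0]]
    by (intro is_chart_facts(7)[OF atlas_is_chart[OF c1(1)]]) auto
  have "(transition c1 c0 has_derivative frechet_derivative (transition c1 c0) (at (snd c1 (\<gamma> t))))
      (at (snd c1 (\<gamma> t)))"
    by (rule smooth_map_on_derivative[OF flat_chart_smooth(1)[OF c0 c1(1)] op]) (use t c1 in auto)
  note J = inner_jacobian[OF this]
  have "g c1 (\<gamma> t) = transpose (jacobian (transition c1 c0) (at (snd c1 (\<gamma> t)))) **
      jacobian (transition c1 c0) (at (snd c1 (\<gamma> t)))"
    using c0 c1 t unfolding flat_chart_def Let_def by blast
  with J have "local_speed a b \<gamma> t = sqrt ((norm (velocity a b \<gamma> c0 t))\<^sup>2)"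
    unfolding local_speed_def Let_def c1_def[symmetric] 2[OF c1] by simp
  thus "norm (velocity a b \<gamma> c0 t) = local_speed a b \<gamma> t" by simp
qed

lemma open_vimage_curve:
  assumes "continuous_on {a..b} \<gamma>" "open V"
  obtains T where "open T" "\<And>t. t \<in> {a..b} \<Longrightarrow> t \<in> T \<longleftrightarrow> \<gamma> t \<in> V"
proof -
  have "openin (top_of_set {a..b}) ({a..b} \<inter> \<gamma> -` V)"
    using assms by (rule continuous_openin_preimage_gen)
  then obtain T where "open T" "{a..b} \<inter> \<gamma> -` V = {a..b} \<inter> T"
    unfolding openin_open by auto
  thus ?thesis using that[of T] by (metis IntD2 IntI vimageD vimageI2)
qed

lemma velocity_flat_continuous:
  assumes \<gamma>: "C1_curve_on A \<gamma> a b" and ab: "a < b" and c0: "flat_chart c0"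
  shows "continuous_on {t\<in>{a..b}. \<gamma> t \<in> fst c0} (velocity a b \<gamma> c0)"
proof (rule continuous_on_locally)
  fix t assume t: "t \<in> {t\<in>{a..b}. \<gamma> t \<in> fst c0}"
  have con: "continuous_on {a..b} \<gamma>" using \<gamma> by (simp add: C1_curve_on_def)
  obtain c where c: "c \<in> A" "\<gamma> t \<in> fst c" using atlas_cover by blast
  obtain T where T: "open T" "\<And>t. t \<in> {a..b} \<Longrightarrow> t \<in> T \<longleftrightarrow> \<gamma> t \<in> fst c"
    using open_vimage_curve[OF con is_chart_facts(1)[OF atlas_is_chart[OF c(1)]]] by metis
  let ?T = "{t\<in>{a..b}. \<gamma> t \<in> fst c0} \<inter> T"
  have sub: "\<gamma> ` ?T \<subseteq> fst c \<inter> fst c0" "?T \<subseteq> {a..b}" "?T \<subseteq> {t\<in>{a..b}. \<gamma> t \<in> fst c}" using T by auto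
  have "continuous_on ?T
     (\<lambda>t. frechet_derivative (transition c c0) (at (snd c (\<gamma> t))) (velocity a b \<gamma> c t))"
    by (rule continuous_chart_change_derivative[OF atlas_is_chart[OF c(1)] flat_chart_is_chart[OF c0]
          flat_chart_smooth(1)[OF c0 c(1)] continuous_on_subset[OF con sub(2)] sub(1)
          continuous_on_subset[OF velocity_atlas(2)[OF \<gamma> ab c(1)] sub(3)]])
  hence "continuous_on ?T (velocity a b \<gamma> c0)"
    by (rule continuous_on_eq) (use velocity_flat(2)[OF \<gamma> ab c0 _ _ c(1)] T in auto)
  thus "\<exists>V. open V \<and> t \<in> V \<and> continuous_on ({t\<in>{a..b}. \<gamma> t \<in> fst c0} \<inter> V) (velocity a b \<gamma> c0)"
    using T c t by (intro exI[of _ T]) auto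
qed

text \<open>The chart picked by \<open>SOME\<close> may jump with \<open>t\<close>. Near each time
  the speed is instead the norm of a continuous velocity in one fixed flat chart.\<close>

lemma local_speed_continuous:
  assumes \<gamma>: "C1_curve_on A \<gamma> a b" and ab: "a < b"
  shows "continuous_on {a..b} (local_speed a b \<gamma>)"
proof (rule continuous_on_locally)
  fix t assume t: "t \<in> {a..b}"
  have con: "continuous_on {a..b} \<gamma>" using \<gamma> by (simp add: C1_curve_on_def)
  obtain c0 where c: "flat_chart c0" "\<gamma> t \<in> fst c0" using flat_chart_exists by blast
  obtain T where T: "open T" "\<And>t. t \<in> {a..b} \<Longrightarrow> t \<in> T \<longleftrightarrow> \<gamma> t \<in> fst c0"
    using open_vimage_curve[OF con is_chart_facts(1)[OF flat_chart_is_chart[OF c(1)]]] by metis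
  have e: "{a..b} \<inter> T = {t\<in>{a..b}. \<gamma> t \<in> fst c0}" using T by auto
  have "continuous_on ({a..b} \<inter> T) (\<lambda>t. norm (velocity a b \<gamma> c0 t))"
    unfolding e by (intro continuous_on_norm velocity_flat_continuous[OF \<gamma> ab c(1)])
  hence "continuous_on ({a..b} \<inter> T) (local_speed a b \<gamma>)"
    by (rule continuous_on_eq) (use velocity_flat(3)[OF \<gamma> ab c(1)] T in auto)
  thus "\<exists>V. open V \<and> t \<in> V \<and> continuous_on ({a..b} \<inter> V) (local_speed a b \<gamma>)"
    using T c t by (intro exI[of _ T]) auto
qed

lemma curve_speed_eq_local_speed:
  assumes "t \<in> {a<..<b}"
  shows "curve_speed A g \<gamma> t = local_speed a b \<gamma> t"
  using assms by (simp add: curve_speed_def local_speed_def velocity_def at_within_Icc_at)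

lemma curve_speed_nonneg: "0 \<le> curve_speed A g \<gamma> t"
proof -
  define c where "c = (SOME c. c \<in> A \<and> \<gamma> t \<in> fst c)"
  have c: "c \<in> A" "\<gamma> t \<in> fst c" using someI_ex[OF atlas_cover[of "\<gamma> t"]] by (auto simp: c_def)
  have "0 \<le> inner v (g c (\<gamma> t) *v v)" for v
    using metric c unfolding riemannian_metric_def by (cases "v = 0") (auto intro: less_imp_le)
  thus ?thesis by (simp add: curve_speed_def Let_def flip: c_def)
qed

lemma curve_speed_integral:
  assumes \<gamma>: "C1_curve_on A \<gamma> a b" and ab: "a < b"
  shows "(curve_speed A g \<gamma> has_integral integral {a..b} (local_speed a b \<gamma>)) {a..b}"
proof (rule has_integral_spike_finite[of "{a, b}"])
  show "(local_speed a b \<gamma> has_integral integral {a..b} (local_speed a b \<gamma>)) {a..b}"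
    using local_speed_continuous[OF \<gamma> ab] integrable_continuous_real by blast
qed (use curve_speed_eq_local_speed in auto)

text \<open>Join trees in place of the subdivisions of \<open>piecewise_C1_curve\<close>: rescaling,
  reversal and concatenation become rule inductions that carry the length along.
  \<open>piecewise_C1_curve_iff\<close> leads back.\<close>

inductive piecewise_length :: "(real \<Rightarrow> 'a) \<Rightarrow> real \<Rightarrow> real \<Rightarrow> real \<Rightarrow> bool" for \<gamma> where
  piece: "C1_curve_on A \<gamma> a b \<Longrightarrow> a < b \<Longrightarrow>
    piecewise_length \<gamma> a b (integral {a..b} (local_speed a b \<gamma>))"
| join: "piecewise_length \<gamma> a b l \<Longrightarrow> piecewise_length \<gamma> b c l' \<Longrightarrow> piecewise_length \<gamma> a c (l + l')"

lemma piecewise_length_has_integral: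
  assumes "piecewise_length \<gamma> a b l"
  shows "a < b \<and> (curve_speed A g \<gamma> has_integral l) {a..b}"
  using assms
proof induction
  case (piece a b)
  thus ?case using curve_speed_integral by blast
next
  case (join a b l c l')
  thus ?case using has_integral_combine[of a b c "curve_speed A g \<gamma>" l l'] by auto
qed

lemma C1_curve_on_cong:
  assumes "C1_curve_on A \<gamma> a b" "\<And>t. t \<in> {a..b} \<Longrightarrow> \<gamma>' t = \<gamma> t"
  shows "C1_curve_on A \<gamma>' a b"
  unfolding C1_curve_on_def
proof (intro conjI ballI)
  show "continuous_on {a..b} \<gamma>'"
    by (rule continuous_on_eq[of _ \<gamma>]) (use assms in \<open>auto simp: C1_curve_on_def\<close>)
  fix c assume "c \<in> A"
  then obtain D where D: "continuous_on {t\<in>{a..b}. \<gamma> t \<in> fst c} D"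
    "\<And>t. t \<in> {a..b} \<Longrightarrow> \<gamma> t \<in> fst c \<Longrightarrow>
       ((snd c \<circ> \<gamma>) has_vector_derivative D t) (at t within {a..b})"
    using assms(1) unfolding C1_curve_on_def by meson
  have "{t\<in>{a..b}. \<gamma>' t \<in> fst c} = {t\<in>{a..b}. \<gamma> t \<in> fst c}" using assms(2) by auto
  moreover have "((snd c \<circ> \<gamma>') has_vector_derivative D t) (at t within {a..b})"
    if "t \<in> {a..b}" "\<gamma>' t \<in> fst c" for t
    by (rule has_vector_derivative_transform[OF that(1) _ D(2)[OF that(1)]]) (use assms(2) that in auto)
  ultimately show "\<exists>D. continuous_on {t\<in>{a..b}. \<gamma>' t \<in> fst c} D \<and>
        (\<forall>t\<in>{a..b}. \<gamma>' t \<in> fst c \<longrightarrow>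
           ((snd c \<circ> \<gamma>') has_vector_derivative D t) (at t within {a..b}))"
    using D(1) by (intro exI[of _ D]) auto
qed

lemma local_speed_cong:
  assumes "\<And>t. t \<in> {a..b} \<Longrightarrow> \<gamma>' t = \<gamma> t" "t \<in> {a..b}"
  shows "local_speed a b \<gamma>' t = local_speed a b \<gamma> t"
proof -
  have "velocity a b \<gamma>' c t = velocity a b \<gamma> c t" for c
    unfolding velocity_def vector_derivative_def
    using has_vector_derivative_transform[OF assms(2), of "snd c \<circ> \<gamma>'" "snd c \<circ> \<gamma>"]
      has_vector_derivative_transform[OF assms(2), of "snd c \<circ> \<gamma>" "snd c \<circ> \<gamma>'"] assms(1)
    by (intro arg_cong[where f=Eps] ext iffI) simp_all
  thus ?thesis using assms by (simp add: local_speed_def)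
qed

lemma piecewise_length_bounds: "piecewise_length \<gamma> a b l \<Longrightarrow> a < b"
  using piecewise_length_has_integral by blast

lemma piecewise_length_cong:
  assumes "piecewise_length \<gamma> a b l" "\<And>t. t \<in> {a..b} \<Longrightarrow> \<gamma>' t = \<gamma> t"
  shows "piecewise_length \<gamma>' a b l"
  using assms
proof induction
  case (piece a b)
  have "integral {a..b} (local_speed a b \<gamma>) = integral {a..b} (local_speed a b \<gamma>')"
    by (rule integral_cong) (use local_speed_cong[of a b \<gamma>' \<gamma>] piece in auto)
  thus ?case using piecewise_length.piece[OF C1_curve_on_cong[OF piece(1)], of \<gamma>'] piece by simp
next
  case (join a b l c l')
  have "a < b" "b < c" using join(1,2) piecewise_length_bounds by auto
  thus ?case using join by (intro piecewise_length.join) auto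
qed

text \<open>The slope may be negative, so that one computation covers both rescaling and
  reversal.\<close>

lemma C1_curve_on_affine:
  fixes m q :: real
  assumes \<gamma>: "C1_curve_on A \<gamma> a b" and im: "(\<lambda>t. m * t + q) ` {a'..b'} = {a..b}"
  shows "C1_curve_on A (\<lambda>t. \<gamma> (m * t + q)) a' b'"
  unfolding C1_curve_on_def
proof (intro conjI ballI)
  have con: "continuous_on {a'..b'} (\<lambda>t. m * t + q)" by (intro continuous_intros)
  have im': "m * t + q \<in> {a..b}" if "t \<in> {a'..b'}" for t using im that by blast
  show "continuous_on {a'..b'} (\<lambda>t. \<gamma> (m * t + q))"
    by (rule continuous_on_compose2[OF _ con]) (use \<gamma> im in \<open>auto simp: C1_curve_on_def\<close>)
  fix c assume "c \<in> A"
  then obtain D where D: "continuous_on {t\<in>{a..b}. \<gamma> t \<in> fst c} D"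
    "\<And>t. t \<in> {a..b} \<Longrightarrow> \<gamma> t \<in> fst c \<Longrightarrow>
       ((snd c \<circ> \<gamma>) has_vector_derivative D t) (at t within {a..b})"
    using \<gamma> unfolding C1_curve_on_def by meson
  have "continuous_on {t \<in> {a'..b'}. \<gamma> (m * t + q) \<in> fst c} (\<lambda>t. m *\<^sub>R D (m * t + q))"
    by (intro continuous_on_scaleR continuous_on_const continuous_on_compose2[OF D(1)]
        continuous_on_subset[OF con]) (use im' in auto)
  moreover have "((snd c \<circ> (\<lambda>t. \<gamma> (m * t + q))) has_vector_derivative m *\<^sub>R D (m * t + q))
      (at t within {a'..b'})"
    if t: "t \<in> {a'..b'}" "\<gamma> (m * t + q) \<in> fst c" for t
  proof -
    have "((\<lambda>t. m * t + q) has_vector_derivative m) (at t within {a'..b'})"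
      by (auto intro!: derivative_eq_intros)
    moreover have "((snd c \<circ> \<gamma>) has_vector_derivative D (m * t + q))
        (at (m * t + q) within (\<lambda>t. m * t + q) ` {a'..b'})"
      unfolding im by (rule D(2)[OF im'[OF t(1)] t(2)])
    ultimately show ?thesis
      using vector_diff_chain_within by (fastforce simp: o_def)
  qed
  ultimately show "\<exists>D. continuous_on {t\<in>{a'..b'}. \<gamma> (m * t + q) \<in> fst c} D \<and>
        (\<forall>t\<in>{a'..b'}. \<gamma> (m * t + q) \<in> fst c \<longrightarrow>
           ((snd c \<circ> (\<lambda>t. \<gamma> (m * t + q))) has_vector_derivative D t) (at t within {a'..b'}))"
    by (intro exI[of _ "\<lambda>t. m *\<^sub>R D (m * t + q)"]) auto
qed

lemma local_speed_affine:
  fixes m q :: real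
  assumes \<gamma>: "C1_curve_on A \<gamma> a b" and ab: "a < b" "a' < b'"
    and im: "(\<lambda>t. m * t + q) ` {a'..b'} = {a..b}" and t: "t \<in> {a'..b'}"
  shows "local_speed a' b' (\<lambda>t. \<gamma> (m * t + q)) t = \<bar>m\<bar> * local_speed a b \<gamma> (m * t + q)"
proof -
  have t': "m * t + q \<in> {a..b}" using im t by blast
  obtain c where c: "flat_chart c" "\<gamma> (m * t + q) \<in> fst c" using flat_chart_exists by blast
  have "((\<lambda>t. m * t + q) has_vector_derivative m) (at t within {a'..b'})"
    by (auto intro!: derivative_eq_intros)
  moreover have "((snd c \<circ> \<gamma>) has_vector_derivative velocity a b \<gamma> c (m * t + q))
        (at (m * t + q) within (\<lambda>t. m * t + q) ` {a'..b'})"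
    unfolding im by (rule velocity_flat(1)[OF \<gamma> ab(1) c(1) t' c(2)])
  ultimately have "((snd c \<circ> (\<lambda>t. \<gamma> (m * t + q))) has_vector_derivative
      m *\<^sub>R velocity a b \<gamma> c (m * t + q)) (at t within {a'..b'})"
    using vector_diff_chain_within by (fastforce simp: o_def)
  hence "velocity a' b' (\<lambda>t. \<gamma> (m * t + q)) c t = m *\<^sub>R velocity a b \<gamma> c (m * t + q)"
    by (rule velocity_eq[OF ab(2) t])
  thus ?thesis
    using velocity_flat(3)[OF C1_curve_on_affine[OF \<gamma> im] ab(2) c(1) t c(2)]
      velocity_flat(3)[OF \<gamma> ab(1) c(1) t' c(2)] by simp
qed

text \<open>The factor gained by the speed, the modulus of \<open>m\<close>, cancels the one from
  the substitution in the integral.\<close>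

lemma piece_affine:
  fixes m q :: real
  assumes \<gamma>: "C1_curve_on A \<gamma> a b" and ab: "a < b" "a' < b'" and m: "m \<noteq> 0"
    and im: "(\<lambda>t. m * t + q) ` {a'..b'} = {a..b}"
  shows "piecewise_length (\<lambda>t. \<gamma> (m * t + q)) a' b' (integral {a..b} (local_speed a b \<gamma>))"
proof -
  have "(local_speed a b \<gamma> has_integral integral {a..b} (local_speed a b \<gamma>)) (cbox a b)"
    using local_speed_continuous[OF \<gamma> ab(1)] integrable_continuous_real by auto
  from has_integral_affinity[OF this m, of q]
  have h: "((\<lambda>t. local_speed a b \<gamma> (m * t + q)) has_integral
      (1 / \<bar>m\<bar>) * integral {a..b} (local_speed a b \<gamma>)) ((\<lambda>x. (1 / m) *\<^sub>R x + - ((1 / m) *\<^sub>R q)) ` {a..b})"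
    by simp
  have "(\<lambda>x. (1 / m) *\<^sub>R x + - ((1 / m) *\<^sub>R q)) ` {a..b} = {a'..b'}"
    unfolding im[symmetric] image_image using m by (simp add: field_simps)
  note h' = h[unfolded this]
  have "((\<lambda>t. \<bar>m\<bar> * local_speed a b \<gamma> (m * t + q)) has_integral
      integral {a..b} (local_speed a b \<gamma>)) {a'..b'}"
    using has_integral_mult_right[OF h', of "\<bar>m\<bar>"] m by simp
  hence "(local_speed a' b' (\<lambda>t. \<gamma> (m * t + q)) has_integral
      integral {a..b} (local_speed a b \<gamma>)) {a'..b'}"
    by (rule has_integral_eq[rotated]) (use local_speed_affine[OF \<gamma> ab im] in auto)
  hence "integral {a'..b'} (local_speed a' b' (\<lambda>t. \<gamma> (m * t + q))) =
      integral {a..b} (local_speed a b \<gamma>)" by (rule integral_unique)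
  thus ?thesis
    using piecewise_length.piece[OF C1_curve_on_affine[OF \<gamma> im] ab(2)] by simp
qed

lemma piecewise_length_affine:
  fixes m q :: real
  assumes "piecewise_length \<gamma> a b l" "m > 0"
  shows "piecewise_length (\<lambda>t. \<gamma> (m * t + q)) ((a - q) / m) ((b - q) / m) l"
  using assms
proof induction
  case (piece a b)
  have "(\<lambda>t. m * t + q) ` {(a - q) / m..(b - q) / m} = {a..b}"
    using image_affinity_atLeastAtMost[of m q "(a - q) / m" "(b - q) / m"] piece
    by (simp add: divide_le_cancel)
  from piece_affine[OF piece(1,2) _ _ this] show ?case using piece by (simp add: divide_strict_right_mono)
qed (blast intro: piecewise_length.join)

lemma piecewise_length_reverse:
  assumes "piecewise_length \<gamma> a b l"
  shows "piecewise_length (\<lambda>t. \<gamma> (1 - t)) (1 - b) (1 - a) l"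
  using assms
proof induction
  case (piece a b)
  have "(\<lambda>t. (-1) * t + 1) ` {1 - b..1 - a} = {a..b}"
    using image_affinity_atLeastAtMost[of "-1" 1 "1 - b" "1 - a"] piece by simp
  from piece_affine[OF piece(1,2) _ _ this] show ?case using piece by simp
next
  case (join a b l c l')
  thus ?case using piecewise_length.join[OF join(4,3)] by (simp add: add.commute)
qed

lemma piecewise_C1_curve_iff:
  "piecewise_C1_curve A \<gamma> \<and> curve_length A g \<gamma> = l \<longleftrightarrow> piecewise_length \<gamma> 0 1 l"
proof safe
  assume "piecewise_C1_curve A \<gamma>"
  then obtain k \<tau> where \<tau>: "\<tau> 0 = 0" "\<tau> k = (1::real)"
    "\<And>i. i < k \<Longrightarrow> \<tau> i < \<tau> (Suc i) \<and> C1_curve_on A \<gamma> (\<tau> i) (\<tau> (Suc i))"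
    unfolding piecewise_C1_curve_def by blast
  have "\<exists>l. piecewise_length \<gamma> 0 (\<tau> (Suc i)) l" if "Suc i \<le> k" for i
    using that
  proof (induction i)
    case 0
    thus ?case using piecewise_length.piece[of \<gamma> "\<tau> 0" "\<tau> (Suc 0)"] \<tau>(1) \<tau>(3)[of 0] by auto
  next
    case (Suc i)
    thus ?case using piecewise_length.join piecewise_length.piece \<tau>(3)[of "Suc i"]
      by (metis Suc_leD Suc_le_lessD)
  qed
  moreover have "k \<noteq> 0" using \<tau> by (metis zero_neq_one)
  ultimately obtain l where l: "piecewise_length \<gamma> 0 1 l"
    using \<tau>(2) by (metis not0_implies_Suc order_refl)
  hence "curve_length A g \<gamma> = l" unfolding curve_length_def
    using piecewise_length_has_integral by blast
  with l show "piecewise_length \<gamma> 0 1 (curve_length A g \<gamma>)" by simp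
next
  assume l: "piecewise_length \<gamma> 0 1 l"
  thus "curve_length A g \<gamma> = l" unfolding curve_length_def
    using piecewise_length_has_integral by blast
  have "\<exists>k \<tau>. \<tau> 0 = a \<and> \<tau> k = b \<and>
        (\<forall>i<k. \<tau> i < \<tau> (Suc i) \<and> C1_curve_on A \<gamma> (\<tau> i) (\<tau> (Suc i)))"
    if "piecewise_length \<gamma> a b l" for a b l
    using that
  proof induction
    case (piece a b)
    show ?case
      by (rule exI[of _ 1], rule exI[of _ "\<lambda>i. if i = 0 then a else b"]) (use piece in auto)
  next
    case (join a b l c l')
    then obtain k1 \<tau>1 k2 \<tau>2 where 1: "\<tau>1 0 = a" "\<tau>1 k1 = b"
      "\<And>i. i < k1 \<Longrightarrow> \<tau>1 i < \<tau>1 (Suc i) \<and> C1_curve_on A \<gamma> (\<tau>1 i) (\<tau>1 (Suc i))"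
      and 2: "\<tau>2 0 = b" "\<tau>2 k2 = c"
      "\<And>i. i < k2 \<Longrightarrow> \<tau>2 i < \<tau>2 (Suc i) \<and> C1_curve_on A \<gamma> (\<tau>2 i) (\<tau>2 (Suc i))"
      by blast
    \<comment> \<open>The two subdivisions share the point \<open>b\<close>, the last of
      \<open>\<tau>1\<close> and the first of \<open>\<tau>2\<close>; at index \<open>k1\<close> it
      is read from \<open>\<tau>1\<close>.\<close>
    define \<tau> where "\<tau> i = (if i \<le> k1 then \<tau>1 i else \<tau>2 (i - k1))" for i
    have "\<tau> i < \<tau> (Suc i) \<and> C1_curve_on A \<gamma> (\<tau> i) (\<tau> (Suc i))" if "i < k1 + k2" for i
    proof (cases "i < k1")
      case True thus ?thesis using 1(3) by (simp add: \<tau>_def)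
    next
      case False
      hence "\<tau> i = \<tau>2 (i - k1)" using 1(2) 2(1) by (auto simp: \<tau>_def)
      moreover have "\<tau> (Suc i) = \<tau>2 (Suc (i - k1))" using False by (simp add: \<tau>_def Suc_diff_le)
      ultimately show ?thesis using 2(3)[of "i - k1"] False that by simp
    qed
    moreover have "\<tau> 0 = a" "\<tau> (k1 + k2) = c" using 1 2 by (auto simp: \<tau>_def)
    ultimately show ?case by blast
  qed
  from this[OF l] show "piecewise_C1_curve A \<gamma>" unfolding piecewise_C1_curve_def by blast
qed

end

section \<open>The Riemannian distance of a flat manifold\<close>

context flat_manifold begin

definition lengths :: "'a \<Rightarrow> 'a \<Rightarrow> real set" where
  "lengths x y = {l. \<exists>\<gamma>. piecewise_length \<gamma> 0 1 l \<and> \<gamma> 0 = x \<and> \<gamma> 1 = y}"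

lemma riem_dist_eq_Inf: "riem_dist A g x y = Inf (lengths x y)"
proof -
  have "curve_length A g ` {\<gamma>. piecewise_C1_curve A \<gamma> \<and> \<gamma> 0 = x \<and> \<gamma> 1 = y} = lengths x y"
  proof (rule Set.set_eqI)
    fix l
    have "l \<in> curve_length A g ` {\<gamma>. piecewise_C1_curve A \<gamma> \<and> \<gamma> 0 = x \<and> \<gamma> 1 = y} \<longleftrightarrow>
      (\<exists>\<gamma>. (piecewise_C1_curve A \<gamma> \<and> curve_length A g \<gamma> = l) \<and> \<gamma> 0 = x \<and> \<gamma> 1 = y)" by blast
    thus "l \<in> curve_length A g ` {\<gamma>. piecewise_C1_curve A \<gamma> \<and> \<gamma> 0 = x \<and> \<gamma> 1 = y} \<longleftrightarrow>
      l \<in> lengths x y"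
      unfolding piecewise_C1_curve_iff lengths_def by simp
  qed
  thus ?thesis by (simp add: riem_dist_def)
qed

lemma lengths_nonneg: "l \<in> lengths x y \<Longrightarrow> 0 \<le> l"
  unfolding lengths_def
  using piecewise_length_has_integral curve_speed_nonneg has_integral_nonneg by blast

lemma lengths_sym: "l \<in> lengths x y \<Longrightarrow> l \<in> lengths y x"
  unfolding lengths_def using piecewise_length_reverse by force

lemma lengths_trans:
  assumes "l \<in> lengths x y" "l' \<in> lengths y z"
  shows "l + l' \<in> lengths x z"
proof -
  obtain \<gamma> \<gamma>' where 1: "piecewise_length \<gamma> 0 1 l" "\<gamma> 0 = x" "\<gamma> 1 = y"
    and 2: "piecewise_length \<gamma>' 0 1 l'" "\<gamma>' 0 = y" "\<gamma>' 1 = z"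
    using assms unfolding lengths_def by blast
  define \<eta> where "\<eta> t = (if t \<le> 1/2 then \<gamma> (2 * t) else \<gamma>' (2 * t - 1))" for t
  have "piecewise_length (\<lambda>t. \<gamma> (2 * t)) 0 (1/2) l"
    using piecewise_length_affine[OF 1(1), of 2 0] by simp
  hence a: "piecewise_length \<eta> 0 (1/2) l"
    by (rule piecewise_length_cong) (simp add: \<eta>_def)
  have "piecewise_length (\<lambda>t. \<gamma>' (2 * t - 1)) (1/2) 1 l'"
    using piecewise_length_affine[OF 2(1), of 2 "-1"] by simp
  hence b: "piecewise_length \<eta> (1/2) 1 l'"
  proof (rule piecewise_length_cong)
    fix t :: real assume "t \<in> {1/2..1}"
    show "\<eta> t = \<gamma>' (2 * t - 1)"
    proof (cases "t = 1/2")
      case True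
      show ?thesis unfolding True using 1 2 by (simp add: \<eta>_def)
    qed (use \<open>t \<in> {1/2..1}\<close> in \<open>simp add: \<eta>_def\<close>)
  qed
  have "\<eta> 0 = x" "\<eta> 1 = z" using 1 2 by (auto simp: \<eta>_def)
  thus ?thesis using piecewise_length.join[OF a b] unfolding lengths_def by blast
qed

text \<open>The local upper bound for the distance: pulling a straight segment back through a flat
  chart gives a C1 curve of constant speed.\<close>

lemma segment_length:
  assumes c0: "flat_chart c0" and x: "x \<in> fst c0" and y: "y \<in> fst c0"
    and seg: "closed_segment (snd c0 x) (snd c0 y) \<subseteq> snd c0 ` fst c0"
  shows "dist (snd c0 x) (snd c0 y) \<in> lengths x y"
proof -
  note ch = flat_chart_is_chart[OF c0]
  define w where "w = snd c0 y - snd c0 x"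
  define p where "p t = snd c0 x + t *\<^sub>R w" for t :: real
  define \<gamma> where "\<gamma> t = inv_into (fst c0) (snd c0) (p t)" for t
  have p: "p t \<in> snd c0 ` fst c0" if "t \<in> {0..1}" for t
  proof -
    have "p t = (1 - t) *\<^sub>R snd c0 x + t *\<^sub>R snd c0 y" by (simp add: p_def w_def algebra_simps)
    hence "p t \<in> closed_segment (snd c0 x) (snd c0 y)" using that by (auto simp: in_segment)
    thus ?thesis using seg by blast
  qed
  have g0: "\<gamma> t \<in> fst c0" "snd c0 (\<gamma> t) = p t" if "t \<in> {0..1}" for t
    using p[OF that] by (auto simp: \<gamma>_def inv_into_into f_inv_into_f)
  have conp: "continuous_on {0..1} p" unfolding p_def by (intro continuous_intros)
  have con: "continuous_on {0..1} \<gamma>" unfolding \<gamma>_def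
    by (rule continuous_on_compose2[OF is_chart_facts(5)[OF ch] conp]) (use p in blast)
  have "(p has_vector_derivative w) (at t within {0..1})" for t
    unfolding p_def by (auto intro!: derivative_eq_intros)
  hence v0: "((snd c0 \<circ> \<gamma>) has_vector_derivative w) (at t within {0..1})" if "t \<in> {0..1}" for t
    by (rule has_vector_derivative_transform[OF that, rotated]) (simp add: g0)
  have C1: "C1_curve_on A \<gamma> 0 1"
    unfolding C1_curve_on_def
  proof (intro conjI ballI)
    fix c assume c: "c \<in> A"
    let ?D = "\<lambda>t. frechet_derivative (transition c0 c) (at (snd c0 (\<gamma> t))) w"
    have "continuous_on {t\<in>{0..1}. \<gamma> t \<in> fst c} ?D"
      by (rule continuous_chart_change_derivative[OF ch atlas_is_chart[OF c]
            flat_chart_smooth(2)[OF c0 c] continuous_on_subset[OF con]]) (use g0 in auto)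
    moreover have "((snd c \<circ> \<gamma>) has_vector_derivative ?D t) (at t within {0..1})"
      if "t \<in> {0..1}" "\<gamma> t \<in> fst c" for t
      by (rule chart_change_derivative[OF ch atlas_is_chart[OF c]
            flat_chart_smooth(2)[OF c0 c] con that(1) g0(1)[OF that(1)] that(2) v0[OF that(1)]])
    ultimately show "\<exists>D. continuous_on {t\<in>{0..1}. \<gamma> t \<in> fst c} D \<and>
        (\<forall>t\<in>{0..1}. \<gamma> t \<in> fst c \<longrightarrow> ((snd c \<circ> \<gamma>) has_vector_derivative D t) (at t within {0..1}))"
      by (intro exI[of _ ?D]) auto
  qed (fact con)
  have "local_speed 0 1 \<gamma> t = norm w" if "t \<in> {0..1}" for t
    using velocity_flat(3)[OF C1 _ c0 that g0(1)[OF that]] velocity_eq[OF _ that v0[OF that]] by simp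
  hence "integral {0..1} (local_speed 0 1 \<gamma>) = integral {0..1::real} (\<lambda>_. norm w)"
    by (intro integral_cong) auto
  also have "\<dots> = dist (snd c0 x) (snd c0 y)" by (simp add: w_def dist_norm norm_minus_commute)
  finally have "piecewise_length \<gamma> 0 1 (dist (snd c0 x) (snd c0 y))"
    using piecewise_length.piece[OF C1] by simp
  moreover have "\<gamma> 0 = x" "\<gamma> 1 = y"
    using is_chart_facts(6)[OF ch] x y by (auto simp: \<gamma>_def p_def w_def)
  ultimately show ?thesis unfolding lengths_def by blast
qed

text \<open>Differences of such functions bound lengths of curves from below, wherever the curves
  run. This is the source of all lower bounds for the distance.\<close>

definition locally_lipschitz :: "('a \<Rightarrow> real) \<Rightarrow> bool" where
  "locally_lipschitz F \<longleftrightarrow> (\<forall>p. \<exists>c V. flat_chart c \<and> open V \<and> p \<in> V \<and> V \<subseteq> fst c \<and>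
     (\<forall>y\<in>V. \<forall>z\<in>V. \<bar>F y - F z\<bar> \<le> dist (snd c y) (snd c z)))"

lemma local_speed_integrable:
  assumes "C1_curve_on A \<gamma> a b" "a < b" "a \<le> s" "t \<le> b"
  shows "local_speed a b \<gamma> integrable_on {s..t}"
  by (rule integrable_continuous_real, rule continuous_on_subset[OF local_speed_continuous])
    (use assms in auto)

lemma flat_chart_displacement:
  assumes \<gamma>: "C1_curve_on A \<gamma> a b" and ab: "a < b" and c0: "flat_chart c0"
    and st: "a \<le> s" "s \<le> t" "t \<le> b" and im: "\<gamma> ` {s..t} \<subseteq> fst c0"
  shows "dist (snd c0 (\<gamma> t)) (snd c0 (\<gamma> s)) \<le> integral {s..t} (local_speed a b \<gamma>)"
proof -
  have "((snd c0 \<circ> \<gamma>) has_vector_derivative velocity a b \<gamma> c0 u) (at u within {s..t})"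
    if u: "u \<in> {s..t}" for u
  proof (rule has_vector_derivative_within_subset[OF velocity_flat(1)[OF \<gamma> ab c0]])
    show "u \<in> {a..b}" "{s..t} \<subseteq> {a..b}" using u st by auto
    show "\<gamma> u \<in> fst c0" using u im by blast
  qed
  hence v: "(velocity a b \<gamma> c0 has_integral (snd c0 \<circ> \<gamma>) t - (snd c0 \<circ> \<gamma>) s) {s..t}"
    by (rule fundamental_theorem_of_calculus[OF st(2)])
  have "local_speed a b \<gamma> integrable_on {s..t}"
    by (rule local_speed_integrable[OF \<gamma> ab]) (use st in auto)
  moreover have "norm (velocity a b \<gamma> c0 u) \<le> local_speed a b \<gamma> u" if "u \<in> {s..t}" for u
  proof -
    have "u \<in> {a..b}" using that st by auto
    moreover have "\<gamma> u \<in> fst c0" using that im by blast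
    ultimately show ?thesis using velocity_flat(3)[OF \<gamma> ab c0, of u] by simp
  qed
  ultimately have "norm (integral {s..t} (velocity a b \<gamma> c0)) \<le> integral {s..t} (local_speed a b \<gamma>)"
    by (intro Henstock_Kurzweil_Integration.integral_norm_bound_integral)
      (simp_all add: has_integral_integrable[OF v])
  thus ?thesis by (simp add: dist_norm integral_unique[OF v])
qed

text \<open>The inequality survives joining adjacent intervals and holds on all short ones, where
  the curve stays in one flat chart; bisection then gives it on \<open>{a..b}\<close>.\<close>

lemma locally_lipschitz_piece:
  assumes F: "locally_lipschitz F" and \<gamma>: "C1_curve_on A \<gamma> a b" and ab: "a < b"
  shows "\<bar>F (\<gamma> b) - F (\<gamma> a)\<bar> \<le> integral {a..b} (local_speed a b \<gamma>)"
proof -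
  let ?P = "\<lambda>s t. a \<le> s \<longrightarrow> s \<le> t \<longrightarrow> t \<le> b \<longrightarrow> \<bar>F (\<gamma> t) - F (\<gamma> s)\<bar> \<le> integral {s..t} (local_speed a b \<gamma>)"
  have con: "continuous_on {a..b} \<gamma>" using \<gamma> by (simp add: C1_curve_on_def)
  have "?P a b"
  proof (rule Bolzano[of a b ?P])
    fix r s t assume P: "?P r s" "?P s t" and "r \<le> s" "s \<le> t"
    have add: "integral {r..s} (local_speed a b \<gamma>) + integral {s..t} (local_speed a b \<gamma>)
        = integral {r..t} (local_speed a b \<gamma>)" if "a \<le> r" "t \<le> b"
      using \<open>r \<le> s\<close> \<open>s \<le> t\<close> local_speed_integrable[OF \<gamma> ab] that
      by (intro Henstock_Kurzweil_Integration.integral_combine) auto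
    show "?P r t"
    proof (intro impI)
      assume rt: "a \<le> r" "t \<le> b"
      have "\<bar>F (\<gamma> s) - F (\<gamma> r)\<bar> \<le> integral {r..s} (local_speed a b \<gamma>)"
        "\<bar>F (\<gamma> t) - F (\<gamma> s)\<bar> \<le> integral {s..t} (local_speed a b \<gamma>)"
        using P(1)[rule_format, OF rt(1) \<open>r \<le> s\<close>] P(2)[rule_format, OF _ \<open>s \<le> t\<close> rt(2)]
          rt \<open>r \<le> s\<close> \<open>s \<le> t\<close> by linarith+
      with add[OF rt] show "\<bar>F (\<gamma> t) - F (\<gamma> r)\<bar> \<le> integral {r..t} (local_speed a b \<gamma>)"
        by linarith
    qed
  next
    fix t assume t: "a \<le> t" "t \<le> b"
    obtain c V where c: "flat_chart c" "open V" "\<gamma> t \<in> V" "V \<subseteq> fst c"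
      "\<And>y z. y \<in> V \<Longrightarrow> z \<in> V \<Longrightarrow> \<bar>F y - F z\<bar> \<le> dist (snd c y) (snd c z)"
      using F unfolding locally_lipschitz_def by meson
    obtain T where T: "open T" "\<And>t. t \<in> {a..b} \<Longrightarrow> t \<in> T \<longleftrightarrow> \<gamma> t \<in> V"
      using open_vimage_curve[OF con c(2)] by metis
    have "t \<in> T" using T(2) t c(3) by simp
    then obtain e where e: "e > 0" "ball t e \<subseteq> T" using T(1) open_contains_ball by blast
    have "?P r s" if "r \<le> t" "t \<le> s" "s - r < e" for r s
    proof (intro impI)
      assume rs: "a \<le> r" "r \<le> s" "s \<le> b"
      have "{r..s} \<subseteq> ball t e" using that by (auto simp: dist_real_def)
      hence V: "\<gamma> u \<in> V" if "u \<in> {r..s}" for u using e T(2)[of u] that rs by auto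
      have "\<bar>F (\<gamma> s) - F (\<gamma> r)\<bar> \<le> dist (snd c (\<gamma> s)) (snd c (\<gamma> r))"
        using c(5) V rs by auto
      also have "\<dots> \<le> integral {r..s} (local_speed a b \<gamma>)"
        by (rule flat_chart_displacement[OF \<gamma> ab c(1) rs]) (use V c(4) in auto)
      finally show "\<bar>F (\<gamma> s) - F (\<gamma> r)\<bar> \<le> integral {r..s} (local_speed a b \<gamma>)" .
    qed
    thus "\<exists>e>0. \<forall>r s. r \<le> t \<and> t \<le> s \<and> s - r < e \<longrightarrow> ?P r s" using e(1) by blast
  qed (use ab in simp)
  thus ?thesis using ab by simp
qed

lemma locally_lipschitz_le_length:
  assumes F: "locally_lipschitz F" and l: "l \<in> lengths x y"
  shows "\<bar>F y - F x\<bar> \<le> l"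
proof -
  have "piecewise_length \<gamma> a b l \<Longrightarrow> \<bar>F (\<gamma> b) - F (\<gamma> a)\<bar> \<le> l" for \<gamma> a b l
  proof (induction rule: piecewise_length.induct)
    case (piece a b)
    thus ?case using locally_lipschitz_piece[OF F] by blast
  qed simp
  thus ?thesis using l unfolding lengths_def by blast
qed

text \<open>A distance function in a flat chart, truncated so that it extends to the whole manifold.\<close>

definition truncated_dist :: "('a, 'n) chart \<Rightarrow> 'a \<Rightarrow> real \<Rightarrow> 'a \<Rightarrow> real" where
  "truncated_dist c x r y = (if y \<in> fst c then min r (dist (snd c x) (snd c y)) else r)"

text \<open>Inside the chart this is the reverse triangle inequality. Outside, the preimage
  \<open>Z\<close> of the closed ball is compact, hence closed, so a point off the chart has a
  neighbourhood that misses \<open>Z\<close>, on which the function is constantly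
  \<open>r\<close>.\<close>

lemma truncated_dist_lipschitz:
  assumes c: "flat_chart c" and x: "cball (snd c x) r \<subseteq> snd c ` fst c"
  shows "locally_lipschitz (truncated_dist c x r)"
  unfolding locally_lipschitz_def
proof
  note ch = flat_chart_is_chart[OF c]
  fix p
  show "\<exists>c' V. flat_chart c' \<and> open V \<and> p \<in> V \<and> V \<subseteq> fst c' \<and>
     (\<forall>y\<in>V. \<forall>z\<in>V. \<bar>truncated_dist c x r y - truncated_dist c x r z\<bar> \<le> dist (snd c' y) (snd c' z))"
  proof (cases "p \<in> fst c")
    case True
    have "\<bar>truncated_dist c x r y - truncated_dist c x r z\<bar> \<le> dist (snd c y) (snd c z)"
      if "y \<in> fst c" "z \<in> fst c" for y z
      using dist_triangle[of "snd c x" "snd c y" "snd c z"] dist_triangle[of "snd c x" "snd c z" "snd c y"]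
        dist_commute[of "snd c y" "snd c z"] that
      by (auto simp: truncated_dist_def min_def)
    with True c is_chart_facts(1)[OF ch] show ?thesis by blast
  next
    case False
    define Z where "Z = inv_into (fst c) (snd c) ` cball (snd c x) r"
    have "compact Z" unfolding Z_def
      using continuous_on_subset[OF is_chart_facts(5)[OF ch] x] by (intro compact_continuous_image) auto
    hence Z: "closed Z" by (rule compact_imp_closed)
    have "Z \<subseteq> fst c" unfolding Z_def using x by (auto intro: inv_into_into)
    obtain c' where c': "flat_chart c'" "p \<in> fst c'" using flat_chart_exists by blast
    have "truncated_dist c x r y = r" if "y \<notin> Z" for y
    proof -
      have "dist (snd c x) (snd c y) > r" if "y \<in> fst c"
        using \<open>y \<notin> Z\<close> is_chart_facts(6)[OF ch that] unfolding Z_def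
        by (metis imageI linorder_not_le mem_cball)
      thus ?thesis by (auto simp: truncated_dist_def)
    qed
    moreover have "open (fst c' - Z)" using is_chart_facts(1)[OF flat_chart_is_chart[OF c'(1)]] Z by blast
    ultimately show ?thesis using c' False \<open>Z \<subseteq> fst c\<close>
      by (intro exI[of _ c'] exI[of _ "fst c' - Z"]) auto
  qed
qed

text \<open>Being joined by a curve is an equivalence relation with open classes, so connectedness
  leaves one class. It makes the infimum in the distance meaningful.\<close>

lemma lengths_nonempty: "lengths x y \<noteq> {}"
proof (rule connected_equivalence_relation[of UNIV x y "\<lambda>x y. lengths x y \<noteq> {}"])
  fix x :: 'a
  obtain c where c: "flat_chart c" "x \<in> fst c" using flat_chart_exists by blast
  note ch = flat_chart_is_chart[OF c(1)]
  obtain r where r: "r > 0" "ball (snd c x) r \<subseteq> snd c ` fst c"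
    using is_chart_facts(2)[OF ch] c(2) open_contains_ball by (metis imageI)
  define T where "T = fst c \<inter> snd c -` ball (snd c x) r"
  have "open T" unfolding T_def
    using is_chart_facts(1,4)[OF ch] by (intro continuous_open_preimage) auto
  moreover have "lengths x y \<noteq> {}" if "y \<in> T" for y
  proof -
    have "closed_segment (snd c x) (snd c y) \<subseteq> ball (snd c x) r"
      using that r(1) by (intro closed_segment_subset) (auto simp: T_def)
    with r(2) that segment_length[OF c, of y] show ?thesis by (auto simp: T_def)
  qed
  ultimately show "\<exists>T. openin (top_of_set UNIV) T \<and> x \<in> T \<and> (\<forall>y\<in>T. lengths x y \<noteq> {})"
    using c r by (intro exI[of _ T]) (auto simp: T_def)
qed (use conn lengths_sym lengths_trans in blast)+

section \<open>Symmetry, triangle inequality and local form of the Riemannian distance\<close>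

lemma riem_dist_le: "l \<in> lengths x y \<Longrightarrow> riem_dist A g x y \<le> l"
  unfolding riem_dist_eq_Inf by (intro cInf_lower bdd_belowI) (use lengths_nonneg in auto)

lemma riem_dist_ge: "(\<And>l. l \<in> lengths x y \<Longrightarrow> B \<le> l) \<Longrightarrow> B \<le> riem_dist A g x y"
  unfolding riem_dist_eq_Inf using lengths_nonempty by (intro cInf_greatest)

lemma riem_dist_nonneg: "0 \<le> riem_dist A g x y"
  using lengths_nonneg by (rule riem_dist_ge)

lemma riem_dist_commute: "riem_dist A g x y = riem_dist A g y x"
  unfolding riem_dist_eq_Inf using lengths_sym by (intro arg_cong[where f=Inf]) blast

lemma riem_dist_triangle: "riem_dist A g x z \<le> riem_dist A g x y + riem_dist A g y z"
proof -
  have *: "riem_dist A g x z - riem_dist A g y z \<le> l" if "l \<in> lengths x y" for l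
  proof -
    have **: "riem_dist A g x z - l \<le> l'" if "l' \<in> lengths y z" for l'
      using riem_dist_le[OF lengths_trans[OF \<open>l \<in> lengths x y\<close> that]] by simp
    have "riem_dist A g x z - l \<le> riem_dist A g y z" using ** by (rule riem_dist_ge)
    thus ?thesis by simp
  qed
  have "riem_dist A g x z - riem_dist A g y z \<le> riem_dist A g x y" using * by (rule riem_dist_ge)
  thus ?thesis by simp
qed

lemma truncated_dist_le_riem_dist:
  assumes c: "flat_chart c" and y: "y \<in> fst c" and r: "cball (snd c y) r \<subseteq> snd c ` fst c" "0 \<le> r"
  shows "truncated_dist c y r z \<le> riem_dist A g y z"
proof (rule riem_dist_ge)
  fix l assume "l \<in> lengths y z"
  from locally_lipschitz_le_length[OF truncated_dist_lipschitz[OF c r(1)] this]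
  show "truncated_dist c y r z \<le> l" using y r(2) by (simp add: truncated_dist_def)
qed

lemma riem_dist_flat_chart:
  obtains c :: "('a, 'n) chart" and r where "r > 0" "is_chart c" "x \<in> fst c" "{y. riem_dist A g x y < r} \<subseteq> fst c"
    "snd c ` {y. riem_dist A g x y < r} = ball (snd c x) r"
    "\<And>y z. riem_dist A g x y < r \<Longrightarrow> riem_dist A g x z < r \<Longrightarrow>
       riem_dist A g y z = dist (snd c y) (snd c z)"
proof -
  obtain c where c: "flat_chart c" "x \<in> fst c" using flat_chart_exists by blast
  note ch = flat_chart_is_chart[OF c(1)]
  obtain R where R: "R > 0" "cball (snd c x) R \<subseteq> snd c ` fst c"
    using is_chart_facts(2)[OF ch] c(2) open_contains_cball by (metis imageI)
  \<comment> \<open>Two points of the \<open>r\<close>-ball are at most \<open>2 * r\<close> apart,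
    and the closed ball of radius \<open>2 * r\<close> about either of them stays in the
    \<open>R\<close>-ball; hence truncation at \<open>2 * r\<close> does not alter their
    distance.\<close>
  define r where "r = R / 3"
  define B where "B = {y \<in> fst c. dist (snd c x) (snd c y) < r}"
  have r: "r > 0" "r \<le> R" using R by (auto simp: r_def)
  have d: "riem_dist A g y z = dist (snd c y) (snd c z)" if "y \<in> B" "z \<in> B" for y z
  proof (rule antisym)
    have "closed_segment (snd c y) (snd c z) \<subseteq> ball (snd c x) r"
      using that r(1) by (intro closed_segment_subset) (auto simp: B_def)
    hence "closed_segment (snd c y) (snd c z) \<subseteq> snd c ` fst c" using R r by force
    thus "riem_dist A g y z \<le> dist (snd c y) (snd c z)"
      using that by (intro riem_dist_le segment_length[OF c(1)]) (auto simp: B_def)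
    have "u \<in> cball (snd c x) R" if "u \<in> cball (snd c y) (2 * r)" for u
      using that \<open>y \<in> B\<close> dist_triangle[of "snd c x" u "snd c y"] by (auto simp: B_def r_def)
    hence "cball (snd c y) (2 * r) \<subseteq> snd c ` fst c" using R(2) by blast
    moreover have "dist (snd c y) (snd c z) \<le> 2 * r"
      using that dist_triangle2[of "snd c y" "snd c z" "snd c x"] 
      by (simp add: B_def dist_commute)
    ultimately show "dist (snd c y) (snd c z) \<le> riem_dist A g y z"
      using truncated_dist_le_riem_dist[OF c(1), of y "2 * r" z] that r
      by (simp add: B_def truncated_dist_def min_def split: if_splits)
  qed
  have xB: "x \<in> B" using c r by (simp add: B_def)
  have B: "B = {y. riem_dist A g x y < r}"
  proof safe
    fix y assume "y \<in> B" thus "riem_dist A g x y < r" using d[OF xB] by (simp add: B_def)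
  next
    fix y assume "riem_dist A g x y < r"
    moreover have "truncated_dist c x r y \<le> riem_dist A g x y"
      using R(2) r by (intro truncated_dist_le_riem_dist[OF c]) auto
    ultimately show "y \<in> B" by (auto simp: truncated_dist_def B_def split: if_splits)
  qed
  have im: "snd c ` B = ball (snd c x) r"
  proof
    show "ball (snd c x) r \<subseteq> snd c ` B"
    proof
      fix u assume u: "u \<in> ball (snd c x) r"
      hence "u \<in> snd c ` fst c" using R(2) r by auto
      then obtain y where "y \<in> fst c" "u = snd c y" by blast
      thus "u \<in> snd c ` B" using u by (auto simp: B_def)
    qed
  qed (auto simp: B_def)
  show thesis
  proof (rule that[of r c])
    show "{y. riem_dist A g x y < r} \<subseteq> fst c" unfolding B[symmetric] by (auto simp: B_def)
    show "snd c ` {y. riem_dist A g x y < r} = ball (snd c x) r" unfolding B[symmetric] by (fact im)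
    show "riem_dist A g y z = dist (snd c y) (snd c z)"
      if "riem_dist A g x y < r" "riem_dist A g x z < r" for y z
      using that d unfolding B by blast
  qed (use r ch c in auto)
qed

end

text \<open>The map \<open>\<phi>\<close> takes the ball onto the whole Euclidean ball, not just
  isometrically into it. \<open>similitude_image_dball\<close> rests on this.\<close>

locale locally_euclidean_space =
  fixes d :: "'a::t2_space \<Rightarrow> 'a \<Rightarrow> real"
  assumes nonneg: "0 \<le> d x y"
    and eq_0_iff: "d x y = 0 \<longleftrightarrow> x = y"
    and commute: "d x y = d y x"
    and triangle: "d x z \<le> d x y + d y z"
    and open_iff: "open S \<longleftrightarrow> (\<forall>x\<in>S. \<exists>e>0. \<forall>y. d x y < e \<longrightarrow> y \<in> S)"
    and locally_euclidean: "\<exists>r>0. \<exists>\<phi> :: 'a \<Rightarrow> 'v::euclidean_space. \<phi> ` {y. d x y < r} = ball (\<phi> x) r \<and>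
      (\<forall>y z. d x y < r \<longrightarrow> d x z < r \<longrightarrow> d y z = dist (\<phi> y) (\<phi> z))"

context flat_manifold begin

lemma riem_dist_locally_euclidean:
  "locally_euclidean_space TYPE(real ^ 'n) (riem_dist A g)"
proof
  show "open S \<longleftrightarrow> (\<forall>x\<in>S. \<exists>e>0. \<forall>y. riem_dist A g x y < e \<longrightarrow> y \<in> S)" for S :: "'a set"
  proof
    assume S: "open S"
    show "\<forall>x\<in>S. \<exists>e>0. \<forall>y. riem_dist A g x y < e \<longrightarrow> y \<in> S"
    proof
      fix x assume x: "x \<in> S"
      obtain c :: "('a, 'n) chart" and r where c: "r > 0" "is_chart c" "x \<in> fst c"
        "{y. riem_dist A g x y < r} \<subseteq> fst c"
        "\<And>y z. riem_dist A g x y < r \<Longrightarrow> riem_dist A g x z < r \<Longrightarrow>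
           riem_dist A g y z = dist (snd c y) (snd c z)"
        using riem_dist_flat_chart[of x] by metis
      have "open (snd c ` (S \<inter> fst c))"
        using S is_chart_facts(1)[OF c(2)] by (intro is_chart_facts(7)[OF c(2)]) auto
      then obtain e where e: "e > 0" "ball (snd c x) e \<subseteq> snd c ` (S \<inter> fst c)"
        using x c(3) open_contains_ball by (metis IntI imageI)
      have xx: "riem_dist A g x x < r"
        using riem_dist_le[OF segment_length[of _ x x]] flat_chart_exists[of x] c(1) by fastforce
      have "y \<in> S" if "riem_dist A g x y < min e r" for y
      proof -
        have "snd c y \<in> ball (snd c x) e" using c(5)[OF xx, of y] that by simp
        then obtain z where "z \<in> S" "z \<in> fst c" "snd c y = snd c z" using e(2) by blast
        moreover have "y \<in> fst c" using that c(4) by auto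
        ultimately show ?thesis using is_chart_facts(3)[OF c(2)] by (metis inj_onD)
      qed
      thus "\<exists>e>0. \<forall>y. riem_dist A g x y < e \<longrightarrow> y \<in> S"
        using e(1) c(1) by (intro exI[of _ "min e r"]) simp
    qed
  next
    assume S: "\<forall>x\<in>S. \<exists>e>0. \<forall>y. riem_dist A g x y < e \<longrightarrow> y \<in> S"
    show "open S"
    proof (subst open_subopen, rule ballI)
      fix x assume "x \<in> S"
      then obtain e where e: "e > 0" "\<And>y. riem_dist A g x y < e \<Longrightarrow> y \<in> S" using S by blast
      obtain c :: "('a, 'n) chart" and r where c: "r > 0" "is_chart c" "x \<in> fst c"
        "{y. riem_dist A g x y < r} \<subseteq> fst c" "snd c ` {y. riem_dist A g x y < r} = ball (snd c x) r"
        "\<And>y z. riem_dist A g x y < r \<Longrightarrow> riem_dist A g x z < r \<Longrightarrow>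
           riem_dist A g y z = dist (snd c y) (snd c z)"
        using riem_dist_flat_chart[of x] by metis
      \<comment> \<open>Coordinates of points of \<open>T\<close> lie in the image of the Riemannian
        \<open>r\<close>-ball; injectivity of the chart places the points themselves in that ball,
        where distances can be read off.\<close>
      define T where "T = fst c \<inter> snd c -` ball (snd c x) (min e r)"
      have xx: "riem_dist A g x x < r"
        using riem_dist_le[OF segment_length[of _ x x]] flat_chart_exists[of x] c(1) by fastforce
      have "open T" unfolding T_def
        using is_chart_facts(1,4)[OF c(2)] by (intro continuous_open_preimage) auto
      moreover have "y \<in> S" if "y \<in> T" for y
      proof -
        have "snd c y \<in> snd c ` {y. riem_dist A g x y < r}"
          unfolding c(5) using that by (simp add: T_def)
        then obtain z where z: "snd c y = snd c z" "riem_dist A g x z < r" by blast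
        hence "y = z" using is_chart_facts(3)[OF c(2)] c(4) that by (auto simp: T_def dest: inj_onD)
        thus ?thesis using e(2) c(6)[OF xx z(2)] that by (simp add: T_def)
      qed
      ultimately show "\<exists>T. open T \<and> x \<in> T \<and> T \<subseteq> S"
        using c(1,3) e(1) by (intro exI[of _ T]) (auto simp: T_def)
    qed
  qed
  show "\<exists>r>0. \<exists>\<phi> :: 'a \<Rightarrow> real ^ 'n. \<phi> ` {y. riem_dist A g x y < r} = ball (\<phi> x) r \<and>
      (\<forall>y z. riem_dist A g x y < r \<longrightarrow> riem_dist A g x z < r \<longrightarrow> riem_dist A g y z = dist (\<phi> y) (\<phi> z))" for x
    using riem_dist_flat_chart[of x] by metis
  show "riem_dist A g x y = 0 \<longleftrightarrow> x = y" for x y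
  proof
    obtain c :: "('a, 'n) chart" and r where c: "r > 0" "is_chart c" "x \<in> fst c"
        "{y. riem_dist A g x y < r} \<subseteq> fst c"
        "\<And>y z. riem_dist A g x y < r \<Longrightarrow> riem_dist A g x z < r \<Longrightarrow>
           riem_dist A g y z = dist (snd c y) (snd c z)"
      using riem_dist_flat_chart[of x] by metis
    have xx: "riem_dist A g x x = 0"
      using riem_dist_le[OF segment_length[of _ x x]] flat_chart_exists[of x] riem_dist_nonneg[of x x]
      by fastforce
    thus "x = y \<Longrightarrow> riem_dist A g x y = 0" by simp
    assume xy: "riem_dist A g x y = 0"
    hence "snd c x = snd c y" using c(5)[of x y] c(1) xx by simp
    moreover have "y \<in> fst c" using c(4) xy c(1) by auto
    ultimately show "x = y" using is_chart_facts(3)[OF c(2)] c(3) by (metis inj_onD)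
  qed
qed (rule riem_dist_nonneg riem_dist_commute riem_dist_triangle)+

end

section \<open>Packing in locally Euclidean metric spaces\<close>

text \<open>Within the target ball the image is open by invariance of domain. It is also relatively
  closed: preimages of a convergent sequence are Cauchy, and their limit has distance less than
  \<open>s\<close> from \<open>c\<close> because \<open>F\<close> scales distances to the centre. A
  nonempty clopen part of the connected target ball is all of it.\<close>

lemma similarity_image_ball:
  fixes F :: "'v::euclidean_space \<Rightarrow> 'v"
  assumes \<rho>: "0 < \<rho>"
    and F: "\<And>p q. p \<in> ball c s \<Longrightarrow> q \<in> ball c s \<Longrightarrow> dist (F p) (F q) = \<rho> * dist p q"
  shows "ball (F c) (\<rho> * s) \<subseteq> F ` ball c s"
proof (cases "s > 0")
  case s: True
  have cc: "c \<in> ball c s" using s by simp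
  have con: "continuous_on (ball c s) F"
  proof (rule lipschitz_on_continuous_on[of \<rho>], rule lipschitz_onI)
    show "dist (F p) (F q) \<le> \<rho> * dist p q" if "p \<in> ball c s" "q \<in> ball c s" for p q
      using F[OF that] by simp
  qed (use \<rho> in simp)
  have inj: "inj_on F (ball c s)"
  proof (rule inj_onI)
    fix p q assume "p \<in> ball c s" "q \<in> ball c s" "F p = F q"
    thus "p = q" using F[of p q] \<rho> by simp
  qed
  have o: "open (F ` ball c s)" using invariance_of_domain[OF con _ inj] by simp
  have lim_mem: "l \<in> F ` ball c s"
    if l: "l \<in> ball (F c) (\<rho> * s)" and cl: "l \<in> closure (F ` ball c s)" for l
  proof -
    obtain y where y: "\<And>n. y n \<in> F ` ball c s" and lim: "y \<longlonglongrightarrow> l"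
      using cl unfolding closure_sequential by auto
    have "\<forall>n. \<exists>p. p \<in> ball c s \<and> y n = F p"
    proof
      fix n
      show "\<exists>p. p \<in> ball c s \<and> y n = F p" using y[of n] by blast
    qed
    then obtain x where x: "\<And>n. x n \<in> ball c s" "\<And>n. y n = F (x n)" by metis
    have D: "dist (x n) (x m) = dist (y n) (y m) / \<rho>" for n m
      using F[OF x(1) x(1), of n m] x(2) \<rho> by simp
    have "Cauchy x"
    proof (rule metric_CauchyI)
      fix e :: real assume "e > 0"
      hence "\<exists>M. \<forall>m\<ge>M. \<forall>n\<ge>M. dist (y m) (y n) < e * \<rho>"
        using LIMSEQ_imp_Cauchy[OF lim] \<rho> by (intro metric_CauchyD) auto
      thus "\<exists>M. \<forall>m\<ge>M. \<forall>n\<ge>M. dist (x m) (x n) < e"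
        unfolding D using \<rho> by (simp add: pos_divide_less_eq)
    qed
    hence "convergent x" by (simp add: Cauchy_convergent_iff)
    then obtain p where p: "x \<longlonglongrightarrow> p" by (auto simp: convergent_def)
    have "(\<lambda>n. dist c (x n)) \<longlonglongrightarrow> dist c p" by (intro tendsto_intros p)
    moreover have "dist c (x n) = dist (F c) (y n) / \<rho>" for n
      using F[OF cc x(1), of n] x(2) \<rho> by simp
    hence "(\<lambda>n. dist c (x n)) \<longlonglongrightarrow> dist (F c) l / \<rho>" using \<rho> by (auto intro!: tendsto_intros lim)
    ultimately have "dist c p = dist (F c) l / \<rho>" by (rule LIMSEQ_unique)
    hence pb: "p \<in> ball c s" using l \<rho> by (simp add: pos_divide_less_eq mult.commute)
    have "(\<lambda>n. F (x n)) \<longlonglongrightarrow> F p"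
      by (rule continuous_on_tendsto_compose[OF con p pb]) (rule always_eventually, rule allI, rule x(1))
    moreover have "(\<lambda>n. F (x n)) = y" using x(2) by auto
    ultimately have "l = F p" using LIMSEQ_unique[OF lim] by simp
    thus ?thesis using pb by blast
  qed
  have "ball (F c) (\<rho> * s) \<inter> F ` ball c s = ball (F c) (\<rho> * s) \<inter> closure (F ` ball c s)"
    using lim_mem closure_subset[of "F ` ball c s"] by blast
  hence "closedin (top_of_set (ball (F c) (\<rho> * s))) (ball (F c) (\<rho> * s) \<inter> F ` ball c s)"
    by (simp add: closedin_closed_Int)
  moreover have "openin (top_of_set (ball (F c) (\<rho> * s))) (ball (F c) (\<rho> * s) \<inter> F ` ball c s)"
    using o by (rule openin_open_Int)
  ultimately have "ball (F c) (\<rho> * s) \<inter> F ` ball c s = {} \<or>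
      ball (F c) (\<rho> * s) \<inter> F ` ball c s = ball (F c) (\<rho> * s)"
    using connected_ball[of "F c" "\<rho> * s"] unfolding connected_clopen by simp
  moreover have "F c \<in> ball (F c) (\<rho> * s) \<inter> F ` ball c s" using s \<rho> cc by auto
  ultimately have "ball (F c) (\<rho> * s) \<inter> F ` ball c s = ball (F c) (\<rho> * s)"
    by (metis empty_iff)
  thus ?thesis by blast
next
  case False
  hence "ball (F c) (\<rho> * s) = {}" using \<rho> by (simp add: mult_le_0_iff)
  thus ?thesis by blast
qed

text \<open>After scaling by \<open>1 / t\<close> and moving \<open>c\<close> to the origin, each
  ball of radius \<open>a / 2\<close> contains at most one point. The bound is the size of a cover
  of \<open>cball 0 L\<close> by such balls, the same for all \<open>t\<close> and
  \<open>c\<close>.\<close>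

lemma ball_packing:
  fixes L a :: real
  assumes a: "0 < a"
  shows "\<exists>M::nat. \<forall>(t::real) (c::'v::euclidean_space) P. 0 < t \<longrightarrow> P \<subseteq> ball c (L * t) \<longrightarrow>
    (\<forall>p\<in>P. \<forall>q\<in>P. p \<noteq> q \<longrightarrow> a * t \<le> dist p q) \<longrightarrow> finite P \<and> card P \<le> M"
proof -
  have "compact (cball (0::'v) L)" by simp
  then obtain B :: "'v set" where B: "finite B" "cball 0 L \<subseteq> (\<Union>b\<in>B. ball b (a / 2))"
    using seq_compact_imp_totally_bounded[of "cball (0::'v) L", rule_format, of "a / 2"] a
    by (auto simp: compact_imp_seq_compact)
  have "finite P \<and> card P \<le> card B"
    if t: "0 < t" and P: "P \<subseteq> ball c (L * t)" "\<And>p q. p \<in> P \<Longrightarrow> q \<in> P \<Longrightarrow> p \<noteq> q \<Longrightarrow> a * t \<le> dist p q"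
    for t :: real and c :: 'v and P
  proof -
    define sc where "sc p = (p - c) /\<^sub>R t" for p
    have sc: "dist (sc p) (sc q) = dist p q / t" for p q
    proof -
      have "sc p - sc q = (p - q) /\<^sub>R t" by (simp add: sc_def algebra_simps)
      thus ?thesis using t by (simp add: dist_norm divide_inverse_commute)
    qed
    have "\<exists>b\<in>B. dist b (sc p) < a / 2" if "p \<in> P" for p
    proof -
      have "dist (sc c) (sc p) < L" using that P(1) t unfolding sc by (auto simp: pos_divide_less_eq)
      hence "sc p \<in> cball 0 L" by (simp add: sc_def)
      hence "sc p \<in> (\<Union>b\<in>B. ball b (a / 2))" using B(2) by blast
      thus ?thesis by auto
    qed
    then obtain h where h: "\<And>p. p \<in> P \<Longrightarrow> h p \<in> B" "\<And>p. p \<in> P \<Longrightarrow> dist (h p) (sc p) < a / 2"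
      by metis
    have inj: "inj_on h P"
    proof (rule inj_onI, rule ccontr)
      fix p q assume pq: "p \<in> P" "q \<in> P" "h p = h q" "p \<noteq> q"
      have "dist (sc p) (sc q) < a"
        using dist_triangle_half_r[of "h p" "sc p" a "sc q"] h(2)[OF pq(1)] h(2)[OF pq(2)] pq(3) by simp
      with P(2)[OF pq(1,2,4)] t show False unfolding sc by (simp add: pos_divide_less_eq)
    qed
    have im: "h ` P \<subseteq> B" using h by auto
    show ?thesis using inj_on_finite[OF inj im B(1)] card_inj_on_le[OF inj im B(1)] by blast
  qed
  note * = this
  show ?thesis by (rule exI[of _ "card B"], intro allI impI, rule *) blast+
qed

section \<open>Balls that are isometric to Euclidean balls\<close>

context locally_euclidean_space begin

lemma self_dist [simp]: "d x x = 0"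
  by (simp add: eq_0_iff)

lemma open_dball: "open {y. d x y < e}"
proof (subst open_iff, rule ballI)
  fix y assume "y \<in> {y. d x y < e}"
  hence "0 < e - d x y" by simp
  moreover have "d x z < e" if "d y z < e - d x y" for z
    using triangle[of x z y] that by simp
  ultimately show "\<exists>r>0. \<forall>z. d y z < r \<longrightarrow> z \<in> {y. d x y < e}" by blast
qed

lemma open_contains_dball:
  assumes "open S" "x \<in> S"
  obtains e where "e > 0" "{y. d x y < e} \<subseteq> S"
  using assms(1)[unfolded open_iff] assms(2) by blast

lemma compact_dist_bounded:
  assumes "compact C"
  obtains D where "D > 0" "\<And>x. x \<in> C \<Longrightarrow> d u x \<le> D"
proof -
  have "C \<subseteq> (\<Union>n\<in>(UNIV :: nat set). {y. d u y < real n})"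
    using reals_Archimedean2 by blast
  from compactE_image[OF assms _ this]
  obtain I where I: "finite I" "C \<subseteq> (\<Union>n\<in>I. {y. d u y < real n})" using open_dball by metis
  have "d u x \<le> 1 + real (Max (insert 0 I))" if x: "x \<in> C" for x
  proof -
    obtain n where "n \<in> I" "d u x < real n" using I(2) x by auto
    moreover have "n \<le> Max (insert 0 I)" using I(1) \<open>n \<in> I\<close> by (intro Max_ge) auto
    ultimately show ?thesis by linarith
  qed
  thus ?thesis by (intro that[of "1 + real (Max (insert 0 I))"]) auto
qed

definition euclidean_ball :: "'a \<Rightarrow> real \<Rightarrow> bool" where
  "euclidean_ball x r \<longleftrightarrow> (\<exists>\<phi> :: 'a \<Rightarrow> 'v. \<phi> ` {y. d x y < r} = ball (\<phi> x) r \<and>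
      (\<forall>y z. d x y < r \<longrightarrow> d x z < r \<longrightarrow> d y z = dist (\<phi> y) (\<phi> z)))"

lemma euclidean_ball_subset:
  assumes "euclidean_ball x r" "d x y + s \<le> r" "0 < s"
  shows "euclidean_ball y s"
proof -
  obtain \<phi> :: "'a \<Rightarrow> 'v" where \<phi>: "\<phi> ` {y. d x y < r} = ball (\<phi> x) r"
    "\<And>y z. d x y < r \<Longrightarrow> d x z < r \<Longrightarrow> d y z = dist (\<phi> y) (\<phi> z)"
    using assms(1) unfolding euclidean_ball_def by blast
  have r: "r > 0" using assms nonneg[of x y] by linarith
  have y: "d x y < r" using assms by simp
  have z: "d x z < r" if "d y z < s" for z using triangle[of x z y] that assms by simp
  have "\<phi> ` {z. d y z < s} = ball (\<phi> y) s"
  proof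
    show "\<phi> ` {z. d y z < s} \<subseteq> ball (\<phi> y) s"
    proof (rule image_subsetI)
      fix q assume "q \<in> {z. d y z < s}"
      thus "\<phi> q \<in> ball (\<phi> y) s" using \<phi>(2)[OF y z, of q] by simp
    qed
    show "ball (\<phi> y) s \<subseteq> \<phi> ` {z. d y z < s}"
    proof
      fix p assume p: "p \<in> ball (\<phi> y) s"
      have "dist (\<phi> x) p < r"
        using dist_triangle[of "\<phi> x" p "\<phi> y"] p \<phi>(2)[of x y] y r assms(2) by simp
      hence "p \<in> \<phi> ` {y. d x y < r}" unfolding \<phi>(1) by simp
      then obtain q where "p = \<phi> q" "d x q < r" by auto
      thus "p \<in> \<phi> ` {z. d y z < s}" using p \<phi>(2)[OF y, of q] by auto
    qed
  qed
  thus ?thesis unfolding euclidean_ball_def using \<phi>(2) z by blast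
qed

text \<open>A Lebesgue number argument; the three thirds pay for the step from a centre to
  \<open>x\<close>, for the step from \<open>x\<close> to \<open>y\<close>, and for the radius about
  \<open>y\<close>. The point \<open>y\<close> may lie off \<open>C\<close>, as images of a base
  point outside \<open>W\<close> will.\<close>

lemma uniform_euclidean_ball:
  assumes "compact C"
  obtains r where "r > 0" "\<And>x y. x \<in> C \<Longrightarrow> d x y < r \<Longrightarrow> euclidean_ball y r"
proof -
  have "\<exists>r. r > 0 \<and> euclidean_ball x r" for x
    using locally_euclidean[of x] by (simp only: euclidean_ball_def)
  then obtain R where R: "\<And>x. R x > 0" "\<And>x. euclidean_ball x (R x)" by metis
  have cover: "C \<subseteq> (\<Union>x\<in>UNIV. {y. d x y < R x / 3})"
  proof
    fix x
    have "x \<in> {y. d x y < R x / 3}" using R(1)[of x] by simp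
    thus "x \<in> (\<Union>x\<in>UNIV. {y. d x y < R x / 3})" by blast
  qed
  obtain I where I: "finite I" "C \<subseteq> (\<Union>x\<in>I. {y. d x y < R x / 3})"
  proof (rule compactE_image[OF assms _ cover])
    show "open {y. d x y < R x / 3}" for x by (rule open_dball)
  qed (rule that)
  define r where "r = Min (insert 1 ((\<lambda>x. R x / 3) ` I))"
  have r0: "r > 0" unfolding r_def using I(1) R(1) by simp
  have r: "r \<le> R x / 3" if "x \<in> I" for x unfolding r_def using I(1) that by (intro Min_le) auto
  show ?thesis
  proof (rule that[OF r0])
    fix z y assume "z \<in> C" "d z y < r"
    then obtain x where x: "x \<in> I" "d x z < R x / 3" using I(2) by blast
    have "d x y + r \<le> R x" using triangle[of x y z] x(2) \<open>d z y < r\<close> r[OF x(1)] by linarith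
    thus "euclidean_ball y r" by (rule euclidean_ball_subset[OF R(2) _ r0])
  qed
qed

text \<open>Read in Euclidean coordinates about \<open>u\<close> and about \<open>f u\<close>, the
  map is a similarity of balls in the model space. This supplies the size of the image, about which
  the open set condition is silent.\<close>

lemma similitude_image_dball:
  assumes u: "euclidean_ball u s" and fu: "euclidean_ball (f u) (\<rho> * s)" and \<rho>: "0 < \<rho>" and s: "0 < s"
    and f: "\<And>y z. d u y < s \<Longrightarrow> d u z < s \<Longrightarrow> d (f y) (f z) = \<rho> * d y z"
  shows "{y. d (f u) y < \<rho> * s} \<subseteq> f ` {y. d u y < s}"
proof
  obtain \<phi> :: "'a \<Rightarrow> 'v" where \<phi>: "\<phi> ` {y. d u y < s} = ball (\<phi> u) s"
    "\<And>y z. d u y < s \<Longrightarrow> d u z < s \<Longrightarrow> d y z = dist (\<phi> y) (\<phi> z)"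
    using u unfolding euclidean_ball_def by blast
  obtain \<psi> :: "'a \<Rightarrow> 'v" where \<psi>: "\<psi> ` {y. d (f u) y < \<rho> * s} = ball (\<psi> (f u)) (\<rho> * s)"
    "\<And>y z. d (f u) y < \<rho> * s \<Longrightarrow> d (f u) z < \<rho> * s \<Longrightarrow> d y z = dist (\<psi> y) (\<psi> z)"
    using fu unfolding euclidean_ball_def by blast
  define h where "h = inv_into {y. d u y < s} \<phi>"
  have h: "d u (h p) < s" "\<phi> (h p) = p" if "p \<in> ball (\<phi> u) s" for p
  proof -
    have "p \<in> \<phi> ` {y. d u y < s}" using that by (simp add: \<phi>(1))
    from inv_into_into[OF this] f_inv_into_f[OF this] show "d u (h p) < s" "\<phi> (h p) = p"
      by (simp_all add: h_def)
  qed
  have uu: "d u u < s" using s by simp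
  have fb: "d (f u) (f z) < \<rho> * s" if "d u z < s" for z
    using f[OF uu that] that \<rho> by simp
  have "h (\<phi> u) = u"
    using \<phi>(2)[OF uu h(1), of "\<phi> u"] h(2)[of "\<phi> u"] s by (simp add: eq_0_iff)
  define F where "F p = \<psi> (f (h p))" for p
  have F: "dist (F p) (F q) = \<rho> * dist p q" if "p \<in> ball (\<phi> u) s" "q \<in> ball (\<phi> u) s" for p q
    using \<psi>(2)[OF fb[OF h(1)[OF that(1)]] fb[OF h(1)[OF that(2)]]] f[OF h(1) h(1)] \<phi>(2)[OF h(1) h(1)] h(2) that
    by (simp add: F_def)
  fix y assume y: "y \<in> {y. d (f u) y < \<rho> * s}"
  have "\<psi> y \<in> ball (F (\<phi> u)) (\<rho> * s)" using y \<psi>(1) \<open>h (\<phi> u) = u\<close> by (auto simp: F_def)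
  hence "\<psi> y \<in> F ` ball (\<phi> u) s" using similarity_image_ball[OF \<rho> F, of "\<phi> u" s] by auto
  then obtain p where p: "p \<in> ball (\<phi> u) s" "\<psi> y = F p" by blast
  have "d y (f (h p)) = 0"
    using \<psi>(2)[of y "f (h p)"] y fb[OF h(1)[OF p(1)]] p(2) by (simp add: F_def)
  hence "y = f (h p)" by (simp add: eq_0_iff)
  thus "y \<in> f ` {y. d u y < s}" using h(1)[OF p(1)] by blast
qed

lemma dball_packing:
  fixes L a :: real
  assumes "0 < a"
  obtains M :: nat where "\<And>t x P. 0 < t \<Longrightarrow> euclidean_ball x (L * t) \<Longrightarrow> P \<subseteq> {y. d x y < L * t} \<Longrightarrow>
    (\<And>p q. p \<in> P \<Longrightarrow> q \<in> P \<Longrightarrow> p \<noteq> q \<Longrightarrow> a * t \<le> d p q) \<Longrightarrow> finite P \<and> card P \<le> M"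
proof -
  obtain M :: nat where M: "\<And>(t::real) (c::'v) P. 0 < t \<Longrightarrow> P \<subseteq> ball c (L * t) \<Longrightarrow>
    (\<forall>p\<in>P. \<forall>q\<in>P. p \<noteq> q \<longrightarrow> a * t \<le> dist p q) \<Longrightarrow> finite P \<and> card P \<le> M"
    using ball_packing[OF assms, of L, where 'v='v] by blast
  show ?thesis
  proof (rule that[of M])
    fix t x P
    assume t: "0 < (t::real)" and e: "euclidean_ball x (L * t)" and P: "P \<subseteq> {y. d x y < L * t}"
      "\<And>p q. p \<in> P \<Longrightarrow> q \<in> P \<Longrightarrow> p \<noteq> q \<Longrightarrow> a * t \<le> d p q"
    obtain \<phi> :: "'a \<Rightarrow> 'v" where \<phi>: "\<phi> ` {y. d x y < L * t} = ball (\<phi> x) (L * t)"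
      "\<And>y z. d x y < L * t \<Longrightarrow> d x z < L * t \<Longrightarrow> d y z = dist (\<phi> y) (\<phi> z)"
      using e unfolding euclidean_ball_def by blast
    have D: "d p q = dist (\<phi> p) (\<phi> q)" if "p \<in> P" "q \<in> P" for p q using \<phi>(2) P(1) that by blast
    have inj: "inj_on \<phi> P"
    proof (rule inj_onI)
      fix p q assume "p \<in> P" "q \<in> P" "\<phi> p = \<phi> q"
      hence "d p q = 0" using D by simp
      thus "p = q" by (simp add: eq_0_iff)
    qed
    have "finite (\<phi> ` P) \<and> card (\<phi> ` P) \<le> M"
    proof (rule M[OF t])
      show "\<phi> ` P \<subseteq> ball (\<phi> x) (L * t)" using P(1) \<phi>(1) by blast
      show "\<forall>p\<in>\<phi> ` P. \<forall>q\<in>\<phi> ` P. p \<noteq> q \<longrightarrow> a * t \<le> dist p q" using D P(2) by fastforce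
    qed
    thus "finite P \<and> card P \<le> M" using inj by (simp add: card_image finite_image_iff)
  qed
qed

end

section \<open>Hausdorff measure\<close>

context locally_euclidean_space begin

lemma diam_powr_le:
  assumes s: "0 < s" and b: "0 \<le> b" "\<And>x y. x \<in> C \<Longrightarrow> y \<in> C \<Longrightarrow> d x y \<le> b"
  shows "diam_powr d s C \<le> b powr s"
proof (cases "C = {}")
  case False
  then obtain x where x: "x \<in> C" by blast
  have bdd: "bdd_above ((\<lambda>(x, y). d x y) ` (C \<times> C))" using b(2) by (intro bdd_aboveI[of _ b]) auto
  have "0 \<le> (SUP (x, y)\<in>C \<times> C. d x y)"
    by (rule cSUP_upper2[OF bdd, of "(x, x)"]) (use x in auto)
  moreover have "(SUP (x, y)\<in>C \<times> C. d x y) \<le> b"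
    by (rule cSUP_least) (use x b(2) in auto)
  ultimately show ?thesis using False s by (simp add: diam_powr_def powr_mono2)
qed (simp add: diam_powr_def)

lemma hausdorff_measure_eq_0I:
  fixes K :: "'a set"
  assumes s: "0 < s"
    and cover: "\<And>\<delta> \<epsilon>. 0 < \<delta> \<Longrightarrow> 0 < \<epsilon> \<Longrightarrow> \<exists>(J :: 'j set) C b. finite J \<and> K \<subseteq> (\<Union>j\<in>J. C j) \<and>
      (\<forall>j\<in>J. 0 \<le> b j \<and> b j \<le> \<delta> \<and> (\<forall>x\<in>C j. \<forall>y\<in>C j. d x y \<le> b j)) \<and> (\<Sum>j\<in>J. b j powr s) \<le> \<epsilon>"
  shows "hausdorff_measure d s K = 0"
proof -
  have *: "hausdorff_premeasure d s \<delta> K \<le> 0 + ennreal \<epsilon>" if \<delta>: "\<delta> > 0" and \<epsilon>: "\<epsilon> > 0" for \<delta> \<epsilon>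
  proof -
    from cover[OF \<delta> \<epsilon>] obtain J :: "'j set" and C b where
      J0: "finite J \<and> K \<subseteq> (\<Union>j\<in>J. C j) \<and>
      (\<forall>j\<in>J. 0 \<le> b j \<and> b j \<le> \<delta> \<and> (\<forall>x\<in>C j. \<forall>y\<in>C j. d x y \<le> b j)) \<and> (\<Sum>j\<in>J. b j powr s) \<le> \<epsilon>"
      by (elim exE)
    hence J: "finite J" "K \<subseteq> (\<Union>j\<in>J. C j)"
      "\<And>j. j \<in> J \<Longrightarrow> 0 \<le> b j" "\<And>j. j \<in> J \<Longrightarrow> b j \<le> \<delta>"
      "\<And>j x y. j \<in> J \<Longrightarrow> x \<in> C j \<Longrightarrow> y \<in> C j \<Longrightarrow> d x y \<le> b j" "(\<Sum>j\<in>J. b j powr s) \<le> \<epsilon>"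
      by simp_all
    obtain h where h: "bij_betw h {0..<card J} J" using ex_bij_betw_nat_finite[OF J(1)] by blast
    \<comment> \<open>The finite cover becomes a sequence by padding with empty sets, to which
      \<open>diam_powr\<close> assigns 0.\<close>
    define C' where "C' i = (if i < card J then C (h i) else {})" for i
    have hJ: "h i \<in> J" if "i < card J" for i using bij_betwE[OF h] that by simp
    have "K \<subseteq> (\<Union>i. C' i)"
    proof
      fix x assume "x \<in> K"
      then obtain j where j: "j \<in> J" "x \<in> C j" using J(2) by blast
      then obtain i where "i < card J" "h i = j" using h unfolding bij_betw_def by (metis atLeastLessThan_iff imageE)
      thus "x \<in> (\<Union>i. C' i)" using j by (auto simp: C'_def intro!: exI[of _ i])
    qed
    moreover have "d x y \<le> \<delta>" if "x \<in> C' i" "y \<in> C' i" for i x y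
      using that J(4,5) hJ by (force simp: C'_def split: if_splits)
    ultimately have "hausdorff_premeasure d s \<delta> K \<le> (\<Sum>i. ennreal (diam_powr d s (C' i)))"
      unfolding hausdorff_premeasure_def by (intro INF_lower) auto
    also have "\<dots> = (\<Sum>i<card J. ennreal (diam_powr d s (C' i)))"
      by (rule suminf_finite) (auto simp: C'_def diam_powr_def)
    also have "\<dots> \<le> (\<Sum>i<card J. ennreal (b (h i) powr s))"
      using diam_powr_le[OF s J(3) J(5)] hJ by (intro sum_mono ennreal_leI) (simp add: C'_def)
    also have "\<dots> = ennreal (\<Sum>i<card J. b (h i) powr s)" by (rule sum_ennreal) simp
    also have "(\<Sum>i<card J. b (h i) powr s) = (\<Sum>j\<in>J. b j powr s)"
      using sum.reindex_bij_betw[OF h] by (simp add: atLeast0LessThan)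
    finally show ?thesis using J(6) ennreal_leI[OF J(6)] by simp
  qed
  have "hausdorff_premeasure d s \<delta> K \<le> 0" if "\<delta> > 0" for \<delta>
    by (rule ennreal_le_epsilon) (rule *[OF that])
  thus ?thesis unfolding hausdorff_measure_def by (simp add: SUP_eq_const)
qed

text \<open>Lets arbitrary covers be replaced by open ones at small cost, so that compactness can
  extract a finite subcover. The strict bound by \<open>\<delta>'\<close> leaves room for a radius
  above the diameter.\<close>

lemma diam_powr_enlarge:
  assumes C: "C \<noteq> {}" and s: "0 \<le> s" and \<delta>: "\<And>x y. x \<in> C \<Longrightarrow> y \<in> C \<Longrightarrow> d x y \<le> \<delta>" "\<delta> < \<delta>'"
    and \<epsilon>: "0 < \<epsilon>"
  shows "\<exists>V r. open V \<and> C \<subseteq> V \<and> 0 < r \<and> r < \<delta>' \<and> r powr s \<le> diam_powr d s C + \<epsilon> \<and>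
    (\<forall>x\<in>V. \<forall>y\<in>V. d x y \<le> r)"
proof -
  define D where "D = (SUP (x, y)\<in>C \<times> C. d x y)"
  obtain x where x: "x \<in> C" using C by blast
  have bdd: "bdd_above ((\<lambda>(x, y). d x y) ` (C \<times> C))" using \<delta>(1) by (intro bdd_aboveI[of _ \<delta>]) auto
  have D: "d x y \<le> D" if "x \<in> C" "y \<in> C" for x y
    unfolding D_def by (rule cSUP_upper2[OF bdd, of "(x, y)"]) (use that in auto)
  have D0: "0 \<le> D" using D[OF x x] by simp
  have D\<delta>: "D \<le> \<delta>" unfolding D_def by (rule cSUP_least) (use x \<delta>(1) in auto)
  have "\<exists>r>D. r < \<delta>' \<and> r powr s \<le> diam_powr d s C + \<epsilon>"
  proof (cases "s = 0")
    case True
    have "D < (D + \<delta>') / 2" "(D + \<delta>') / 2 < \<delta>'" using D\<delta> \<delta>(2) by simp_all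
    thus ?thesis using True C D0 \<epsilon> by (intro exI[of _ "(D + \<delta>') / 2"]) (simp add: diam_powr_def)
  next
    case False
    \<comment> \<open>The diameter \<open>D\<close> may be 0, where continuity of
      \<open>powr\<close> depends on \<open>s > 0\<close> and on approaching from the right.\<close>
    have "((\<lambda>r. r powr s) \<longlongrightarrow> D powr s) (at_right D)"
      by (rule tendsto_powr') (use False s D0 in \<open>auto intro!: tendsto_intros eventually_mono[OF eventually_at_right_less]\<close>)
    hence "eventually (\<lambda>r. r powr s < D powr s + \<epsilon>) (at_right D)"
      using \<epsilon> by (intro order_tendstoD) auto
    moreover have "eventually (\<lambda>r. r < \<delta>') (at_right D)"
      by (rule order_tendstoD(2)[OF tendsto_ident_at]) (use D\<delta> \<delta>(2) in simp)
    moreover have "eventually (\<lambda>r. D < r) (at_right D)" by (rule eventually_at_right_less)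
    ultimately have "eventually (\<lambda>r. D < r \<and> r < \<delta>' \<and> r powr s < D powr s + \<epsilon>) (at_right D)"
      by eventually_elim simp
    from eventually_happens[OF this] show ?thesis
      using False C by (auto simp: diam_powr_def D_def[symmetric] less_imp_le)
  qed
  then obtain r where r: "D < r" "r < \<delta>'" "r powr s \<le> diam_powr d s C + \<epsilon>" by blast
  \<comment> \<open>A margin of \<open>(r - D) / 2\<close> at each of two points lengthens their
    distance by at most \<open>r - D\<close>.\<close>
  define V where "V = (\<Union>x\<in>C. {y. d x y < (r - D) / 2})"
  have "open V" unfolding V_def by (intro open_UN ballI open_dball)
  moreover have "C \<subseteq> V"
  proof
    fix x assume "x \<in> C"
    thus "x \<in> V" unfolding V_def using r(1) by (intro UN_I[of x]) auto
  qed
  moreover have "d x' y' \<le> r" if V: "x' \<in> V" "y' \<in> V" for x' y'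
  proof -
    obtain x y where xy: "x \<in> C" "y \<in> C" "d x x' < (r - D) / 2" "d y y' < (r - D) / 2"
      using V unfolding V_def by blast
    have "d x' y' \<le> d x x' + (d x y + d y y')"
      using triangle[of x' y' x] triangle[of x y' y] commute[of x' x] by simp
    thus ?thesis using xy D[OF xy(1,2)] by simp
  qed
  moreover have "0 < r" using r(1) D0 by simp
  ultimately show ?thesis using r(2,3) by (intro exI[of _ V] exI[of _ r]) simp
qed

text \<open>Reduces countable covers to finite ones. Covers of diameter \<open>\<delta> / 2\<close>
  are taken so that the enlarged open sets remain below \<open>\<delta>\<close>.\<close>

lemma hausdorff_measure_neq_0I:
  assumes K: "compact K" and s: "0 \<le> s" and \<delta>: "0 < \<delta>" and M: "0 < M"
    and bound: "\<And>(I :: nat set) V r. finite I \<Longrightarrow> K \<subseteq> (\<Union>i\<in>I. V i) \<Longrightarrow>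
      (\<And>i. i \<in> I \<Longrightarrow> 0 < r i \<and> r i < \<delta>) \<Longrightarrow>
      (\<And>i x y. i \<in> I \<Longrightarrow> x \<in> V i \<Longrightarrow> y \<in> V i \<Longrightarrow> d x y \<le> r i) \<Longrightarrow> 1 \<le> M * (\<Sum>i\<in>I. r i powr s)"
  shows "hausdorff_measure d s K \<noteq> 0"
proof -
  have "ennreal (1 / (2 * M)) \<le> hausdorff_premeasure d s (\<delta> / 2) K"
    unfolding hausdorff_premeasure_def
  proof (rule INF_greatest)
    fix C :: "nat \<Rightarrow> 'a set"
    assume "C \<in> {C. K \<subseteq> (\<Union>i. C i) \<and> (\<forall>i. \<forall>x\<in>C i. \<forall>y\<in>C i. d x y \<le> \<delta> / 2)}"
    hence C: "K \<subseteq> (\<Union>i. C i)" "\<And>i x y. x \<in> C i \<Longrightarrow> y \<in> C i \<Longrightarrow> d x y \<le> \<delta> / 2" by auto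
    \<comment> \<open>The enlargements cost at most \<open>1 / (2 * M)\<close> altogether, half of
      what \<open>bound\<close> guarantees.\<close>
    define \<epsilon> where "\<epsilon> i = (1 / (2 * M)) * (1/2) ^ Suc i" for i :: nat
    have \<epsilon>: "0 < \<epsilon> i" for i using M by (simp add: \<epsilon>_def)
    \<comment> \<open>Empty members are dropped: they contribute 0, and a positive radius chosen for
      them would not be paid for.\<close>
    define P where "P = {i. C i \<noteq> {}}"
    have "\<exists>q. open (fst q) \<and> C i \<subseteq> fst q \<and> 0 < snd q \<and> snd q < \<delta> \<and>
      snd q powr s \<le> diam_powr d s (C i) + \<epsilon> i \<and> (\<forall>x\<in>fst q. \<forall>y\<in>fst q. d x y \<le> snd q)" if "i \<in> P" for i
    proof -
      have "C i \<noteq> {}" "\<delta> / 2 < \<delta>" using that \<delta> by (auto simp: P_def)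
      from diam_powr_enlarge[OF this(1) s C(2) this(2) \<epsilon>[of i]] show ?thesis by simp
    qed
    hence "\<forall>i\<in>P. \<exists>q. open (fst q) \<and> C i \<subseteq> fst q \<and> 0 < snd q \<and> snd q < \<delta> \<and>
      snd q powr s \<le> diam_powr d s (C i) + \<epsilon> i \<and> (\<forall>x\<in>fst q. \<forall>y\<in>fst q. d x y \<le> snd q)" ..
    from bchoice[OF this] obtain q where
      q: "\<forall>i\<in>P. open (fst (q i)) \<and> C i \<subseteq> fst (q i) \<and> 0 < snd (q i) \<and> snd (q i) < \<delta> \<and>
      snd (q i) powr s \<le> diam_powr d s (C i) + \<epsilon> i \<and>
      (\<forall>x\<in>fst (q i). \<forall>y\<in>fst (q i). d x y \<le> snd (q i))" ..
    define V where "V i = fst (q i)" for i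
    define r where "r i = snd (q i)" for i
    have Vo: "open (V i)" if "i \<in> P" for i using q that by (simp add: V_def)
    have r: "0 < r i \<and> r i < \<delta>" "r i powr s \<le> diam_powr d s (C i) + \<epsilon> i" if "i \<in> P" for i
      using q that by (simp_all add: r_def)
    have Vr: "d x y \<le> r i" if "i \<in> P" "x \<in> V i" "y \<in> V i" for i x y
      using q that by (simp add: V_def r_def)
    have cover: "K \<subseteq> (\<Union>i\<in>P. V i)"
    proof
      fix x assume "x \<in> K"
      then obtain i where i: "x \<in> C i" using C(1) by blast
      hence iP: "i \<in> P" by (auto simp: P_def)
      hence "x \<in> V i" using q i by (auto simp: V_def)
      thus "x \<in> (\<Union>i\<in>P. V i)" using iP by blast
    qed
    obtain I where I: "I \<subseteq> P" "finite I" "K \<subseteq> (\<Union>i\<in>I. V i)"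
    proof (rule compactE_image[OF K _ cover])
      show "open (V i)" if "i \<in> P" for i by (rule Vo[OF that])
    qed (rule that)
    have "1 \<le> M * (\<Sum>i\<in>I. r i powr s)"
    proof (rule bound[OF I(2,3)])
      show "0 < r i \<and> r i < \<delta>" if "i \<in> I" for i using r(1) I(1) that by blast
      show "d x y \<le> r i" if "i \<in> I" "x \<in> V i" "y \<in> V i" for i x y
        using Vr that I(1) by blast
    qed
    also have "(\<Sum>i\<in>I. r i powr s) \<le> (\<Sum>i\<in>I. diam_powr d s (C i) + \<epsilon> i)"
      using r(2) I(1) by (intro sum_mono) auto
    also have "\<dots> = (\<Sum>i\<in>I. diam_powr d s (C i)) + (\<Sum>i\<in>I. \<epsilon> i)" by (simp add: sum.distrib)
    also have "(\<Sum>i\<in>I. \<epsilon> i) \<le> 1 / (2 * M)"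
    proof -
      have "(\<Sum>i\<in>I. (1/2::real) ^ Suc i) \<le> (\<Sum>i. (1/2) ^ Suc i)"
        by (rule sum_le_suminf[OF sums_summable[OF power_half_series] I(2)]) simp
      also have "\<dots> = 1" using power_half_series sums_unique by force
      finally show ?thesis using M unfolding \<epsilon>_def sum_distrib_left[symmetric]
        by (intro mult_left_le) auto
    qed
    finally have "1 \<le> M * (\<Sum>i\<in>I. diam_powr d s (C i)) + 1 / 2"
      using M by (simp add: distrib_left)
    hence "1 / (2 * M) \<le> (\<Sum>i\<in>I. diam_powr d s (C i))" using M by (simp add: field_simps)
    hence "ennreal (1 / (2 * M)) \<le> ennreal (\<Sum>i\<in>I. diam_powr d s (C i))" by (rule ennreal_leI)
    also have "\<dots> = (\<Sum>i\<in>I. ennreal (diam_powr d s (C i)))"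
      by (rule sum_ennreal[symmetric]) (simp add: diam_powr_def)
    also have "\<dots> \<le> (\<Sum>i. ennreal (diam_powr d s (C i)))"
      using I(2) by (intro sum_le_suminf) auto
    finally show "ennreal (1 / (2 * M)) \<le> (\<Sum>i. ennreal (diam_powr d s (C i)))" .
  qed
  also have "\<dots> \<le> hausdorff_measure d s K"
    unfolding hausdorff_measure_def using \<delta> by (intro SUP_upper) auto
  finally show ?thesis using M by (auto simp: ennreal_eq_0_iff le_zero_eq)
qed

section \<open>Lower bounds by distributing mass over words\<close>

lemma powr_scale_index:
  fixes c r :: real
  assumes c: "0 < c" "c < 1" and r: "0 < r" "r < c ^ k0"
  obtains k where "k \<ge> k0" "c ^ Suc k < r" "r \<le> c ^ k"
proof -
  have ex: "\<exists>n. c ^ n < r" using real_arch_pow_inv[OF r(1) c(2)] .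
  define n where "n = (LEAST n. c ^ n < r)"
  have n: "c ^ n < r" unfolding n_def using ex by (rule LeastI_ex)
  have "k0 < n"
  proof (rule ccontr)
    assume "\<not> k0 < n"
    hence "c ^ k0 \<le> c ^ n" using c by (intro power_decreasing) auto
    thus False using n r by simp
  qed
  then obtain k where k: "n = Suc k" "k \<ge> k0" by (metis Suc_leD Suc_le_mono less_iff_Suc_add less_imp_Suc_add le_add1)
  have "\<not> c ^ k < r" using not_less_Least[of k "\<lambda>n. c ^ n < r"] k(1) unfolding n_def by simp
  thus ?thesis using that[of k] k n by simp
qed

text \<open>Mass distribution: giving equal weight to the words of a large fixed length, a set of
  diameter about \<open>c ^ k\<close> meets boundedly many of the cells \<open>foldr f v ` W\<close> with \<open>v\<close> of length \<open>k\<close>,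
  because the disjoint open sets \<open>foldr f v ` U\<close> contain balls of comparable radius.\<close>

lemma homogeneous_ifs_hausdorff_measure:
  fixes T :: "'i set" and f :: "'i \<Rightarrow> 'a \<Rightarrow> 'a"
  assumes T: "finite T" and c: "0 < c" "c < 1"
    and sim: "\<And>t x y. t \<in> T \<Longrightarrow> x \<in> U \<union> W \<Longrightarrow> y \<in> U \<union> W \<Longrightarrow> d (f t x) (f t y) = c * d x y"
    and U: "open U" "u \<in> U" "\<And>t. t \<in> T \<Longrightarrow> f t ` U \<subseteq> U"
    and disj: "\<And>t t'. t \<in> T \<Longrightarrow> t' \<in> T \<Longrightarrow> t \<noteq> t' \<Longrightarrow> f t ` U \<inter> f t' ` U = {}"
    and W: "compact W" "W \<noteq> {}" "\<And>t. t \<in> T \<Longrightarrow> f t ` W \<subseteq> W"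
    and K: "compact K" "\<And>ws. set ws \<subseteq> T \<Longrightarrow> foldr f ws ` W \<inter> K \<noteq> {}"
    and s: "0 \<le> s" "1 \<le> real (card T) * c powr s"
  shows "hausdorff_measure d s K \<noteq> 0"
proof -
  define words where "words n = {ws. set ws \<subseteq> T \<and> length ws = n}" for n
  have fin: "finite (words n)" for n unfolding words_def by (rule finite_lists_length_eq[OF T])
  have card: "card (words n) = card T ^ n" for n unfolding words_def by (rule card_lists_length_eq[OF T])
  have fU: "foldr f ws x \<in> U" if "set ws \<subseteq> T" "x \<in> U" for ws x
    using that by (induction ws) (use U(3) in auto)
  have fW: "foldr f ws x \<in> W" if "set ws \<subseteq> T" "x \<in> W" for ws x
    using that by (induction ws) (use W(3) in auto)
  have fsim: "d (foldr f ws x) (foldr f ws y) = c ^ length ws * d x y"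
    if "set ws \<subseteq> T" "x \<in> U \<union> W" "y \<in> U \<union> W" for ws x y
    using that(1)
  proof (induction ws)
    case (Cons t ws)
    have "foldr f ws z \<in> U \<union> W" if "z \<in> U \<union> W" for z using that fU[of ws] fW[of ws] Cons by auto
    thus ?case using Cons sim[of t "foldr f ws x" "foldr f ws y"] \<open>x \<in> U \<union> W\<close> \<open>y \<in> U \<union> W\<close> by simp
  qed simp
  have fdisj: "foldr f ws ` U \<inter> foldr f ws' ` U = {}"
    if "length ws = length ws'" "set ws \<subseteq> T" "set ws' \<subseteq> T" "ws \<noteq> ws'" for ws ws'
    using that
  proof (induction ws ws' rule: list_induct2)
    case (Cons t ws t' ws')
    show ?case
    proof (cases "t = t'")
      case True
      hence IH: "foldr f ws ` U \<inter> foldr f ws' ` U = {}" using Cons by simp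
      show ?thesis
      proof (rule ccontr)
        assume "\<not> ?thesis"
        then obtain x y where xy: "x \<in> U" "y \<in> U" "f t (foldr f ws x) = f t (foldr f ws' y)"
          using True by auto
        hence "0 = c * d (foldr f ws x) (foldr f ws' y)"
          using sim[of t "foldr f ws x" "foldr f ws' y"] fU[of ws x] fU[of ws' y] Cons by simp
        hence "foldr f ws x = foldr f ws' y" using c by (simp add: eq_0_iff)
        thus False using IH xy by blast
      qed
    next
      case False
      have "foldr f (t # ws) ` U \<subseteq> f t ` U" "foldr f (t' # ws') ` U \<subseteq> f t' ` U"
        using fU[of ws] fU[of ws'] Cons by auto
      moreover have "f t ` U \<inter> f t' ` U = {}" using disj[of t t'] False Cons by simp
      ultimately show ?thesis by blast
    qed
  qed simp
  obtain w0 where w0: "w0 \<in> W" using W(2) by blast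
  obtain D where D: "D > 0" "\<And>x. x \<in> W \<Longrightarrow> d u x \<le> D" using compact_dist_bounded[OF W(1)] by metis
  obtain r0 where r0: "r0 > 0" "\<And>x y. x \<in> W \<Longrightarrow> d x y < r0 \<Longrightarrow> euclidean_ball y r0"
    using uniform_euclidean_ball[OF W(1)] by metis
  obtain s0 where s0: "s0 > 0" "{y. d u y < s0} \<subseteq> U" "euclidean_ball u s0"
  proof -
    obtain e where e: "e > 0" "{y. d u y < e} \<subseteq> U" using open_contains_dball[OF U(1,2)] by metis
    obtain r where r: "r > 0" "\<And>x y. x \<in> {u} \<Longrightarrow> d x y < r \<Longrightarrow> euclidean_ball y r"
      using uniform_euclidean_ball[of "{u}"] by auto
    have "euclidean_ball u (min e r)"
      by (rule euclidean_ball_subset[OF r(2)[of u u]]) (use r(1) e(1) in auto)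
    thus ?thesis using that[of "min e r"] e r(1) by auto
  qed
  \<comment> \<open>In units of \<open>c ^ k\<close>, base points of two cells that meet a common
    set of diameter 1 are at most \<open>2 * D + 1\<close> apart. The summand \<open>s0\<close>
    makes the separation balls fit as well.\<close>
  define L where "L = 2 * D + s0 + 2"
  have L: "L > 0" "s0 \<le> L" using D(1) s0(1) by (auto simp: L_def)
  obtain M where M: "\<And>t x P. 0 < t \<Longrightarrow> euclidean_ball x (L * t) \<Longrightarrow> P \<subseteq> {y. d x y < L * t} \<Longrightarrow>
    (\<And>p q. p \<in> P \<Longrightarrow> q \<in> P \<Longrightarrow> p \<noteq> q \<Longrightarrow> s0 * t \<le> d p q) \<Longrightarrow> finite P \<and> card P \<le> M"
    using dball_packing[OF s0(1), of L] by metis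
  obtain k0 where k0: "c ^ k0 < r0 / L" using real_arch_pow_inv[of "r0 / L" c] c r0(1) L(1) by auto
  have k0': "L * c ^ k < r0" if "k \<ge> k0" for k
  proof -
    have "c ^ k \<le> c ^ k0" using that c by (intro power_decreasing) auto
    hence "c ^ k < r0 / L" using k0 by simp
    thus ?thesis using L(1) by (simp add: pos_less_divide_eq mult.commute)
  qed
  \<comment> \<open>The point \<open>u\<close> may be far from \<open>W\<close>, but its image is
    within \<open>c ^ k * D\<close> of the point \<open>foldr f v w0\<close> of \<open>W\<close>,
    near which balls of radius \<open>r0\<close> are Euclidean.\<close>
  have eb: "euclidean_ball (foldr f v u) r" if v: "v \<in> words k" "k \<ge> k0" and r: "0 < r" "r \<le> L * c ^ k" for v k r
  proof -
    have "d (foldr f v w0) (foldr f v u) = c ^ k * d u w0"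
      using v w0 U(2) fsim[of v w0 u] by (simp add: words_def commute)
    also have "\<dots> \<le> c ^ k * D" using D(2)[OF w0] c by simp
    also have "\<dots> < c ^ k * L" using c D(1) s0(1) by (simp add: L_def)
    also have "\<dots> < r0" using k0'[OF v(2)] by (simp add: mult.commute)
    finally have "euclidean_ball (foldr f v u) r0"
      using v(1) by (intro r0(2)[OF fW[OF _ w0]]) (auto simp: words_def)
    thus ?thesis by (rule euclidean_ball_subset) (use r k0'[OF v(2)] in auto)
  qed
  \<comment> \<open>The image of \<open>U\<close> under \<open>v\<close> contains the ball of radius
    \<open>c ^ k * s0\<close> about \<open>foldr f v u\<close>; the base point of another word in
    this ball would contradict \<open>fdisj\<close>.\<close>
  have sep: "s0 * c ^ k \<le> d (foldr f v u) (foldr f v' u)"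
    if v: "v \<in> words k" "v' \<in> words k" "v \<noteq> v'" and k: "k \<ge> k0" for v v' k
  proof (rule ccontr)
    assume "\<not> ?thesis"
    hence "foldr f v' u \<in> {y. d (foldr f v u) y < c ^ k * s0}" by (simp add: mult.commute)
    also have "\<dots> \<subseteq> foldr f v ` {y. d u y < s0}"
    proof (rule similitude_image_dball[OF s0(3) _ _ s0(1)])
      show "euclidean_ball (foldr f v u) (c ^ k * s0)"
        using s0(1) c L(2) by (intro eb[OF v(1) k]) (auto simp: mult.commute)
      show "d (foldr f v y) (foldr f v z) = c ^ k * d y z" if "d u y < s0" "d u z < s0" for y z
        using fsim[of v y z] v(1) s0(2) that by (auto simp: words_def)
    qed (use c in auto)
    finally have "foldr f v' u \<in> foldr f v ` U" using s0(2) by blast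
    moreover have "foldr f v' u \<in> foldr f v' ` U" using U(2) by blast
    moreover have "foldr f v ` U \<inter> foldr f v' ` U = {}" using fdisj[of v v'] v by (auto simp: words_def)
    ultimately show False by blast
  qed
  \<comment> \<open>All base points of cells meeting \<open>C\<close> lie in one ball of radius
    \<open>L * c ^ k\<close> about the base point of a fixed \<open>v0\<close>, so the packing bound
    applies to them.\<close>
  have cells: "card {v \<in> words k. foldr f v ` W \<inter> C \<noteq> {}} \<le> M"
    if k: "k \<ge> k0" and C: "\<And>x y. x \<in> C \<Longrightarrow> y \<in> C \<Longrightarrow> d x y \<le> c ^ k" for k C
  proof (cases "{v \<in> words k. foldr f v ` W \<inter> C \<noteq> {}} = {}")
    case False
    let ?V = "{v \<in> words k. foldr f v ` W \<inter> C \<noteq> {}}"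
    obtain v0 where v0: "v0 \<in> ?V" using False by blast
    have near: "\<exists>p\<in>C. d (foldr f v u) p \<le> c ^ k * D" if "v \<in> ?V" for v
    proof -
      obtain w where w: "w \<in> W" "foldr f v w \<in> C" using \<open>v \<in> ?V\<close> by blast
      have "d (foldr f v u) (foldr f v w) = c ^ k * d u w"
        using fsim[of v u w] that w(1) U(2) by (simp add: words_def)
      also have "\<dots> \<le> c ^ k * D" using D(2)[OF w(1)] c by simp
      finally show ?thesis using w(2) by blast
    qed
    have "(\<lambda>v. foldr f v u) ` ?V \<subseteq> {y. d (foldr f v0 u) y < L * c ^ k}"
    proof (rule image_subsetI)
      fix v assume v: "v \<in> ?V"
      obtain p q where p: "p \<in> C" "d (foldr f v0 u) p \<le> c ^ k * D" and q: "q \<in> C" "d (foldr f v u) q \<le> c ^ k * D"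
        using near[OF v0] near[OF v] by blast
      have "d (foldr f v0 u) (foldr f v u) \<le> d (foldr f v0 u) p + (d p q + d (foldr f v u) q)"
        using triangle[of "foldr f v0 u" "foldr f v u" p] triangle[of p "foldr f v u" q]
          commute[of q "foldr f v u"] by simp
      also have "\<dots> \<le> c ^ k * D + (c ^ k + c ^ k * D)"
        by (intro add_mono p(2) q(2) C[OF p(1) q(1)])
      also have "\<dots> = c ^ k * (2 * D + 1)" by (simp add: algebra_simps)
      also have "\<dots> < c ^ k * L" using c s0(1) by (simp add: L_def)
      finally show "foldr f v u \<in> {y. d (foldr f v0 u) y < L * c ^ k}" by (simp add: mult.commute)
    qed
    moreover have "euclidean_ball (foldr f v0 u) (L * c ^ k)"
      by (rule eb[of v0 k]) (use v0 k L(1) c in auto)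
    moreover have "s0 * c ^ k \<le> d p q"
      if "p \<in> (\<lambda>v. foldr f v u) ` ?V" "q \<in> (\<lambda>v. foldr f v u) ` ?V" "p \<noteq> q" for p q
      using that sep[OF _ _ _ k] by blast
    ultimately have "card ((\<lambda>v. foldr f v u) ` ?V) \<le> M" using M[of "c ^ k"] c by simp
    moreover have "inj_on (\<lambda>v. foldr f v u) ?V"
    proof (rule inj_onI, rule ccontr)
      fix v v' assume "v \<in> ?V" "v' \<in> ?V" "foldr f v u = foldr f v' u" "v \<noteq> v'"
      hence "s0 * c ^ k \<le> 0" using sep[of v k v'] k by simp
      thus False using mult_pos_pos[OF s0(1) zero_less_power[OF c(1), of k]] by simp
    qed
    ultimately show ?thesis by (simp add: card_image)
  next
    case True
    thus ?thesis by (simp only: card.empty)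
  qed
  have "\<exists>x. x \<in> foldr f ws ` W \<inter> K" if "set ws \<subseteq> T" for ws using K(2)[OF that] by blast
  \<comment> \<open>One point of \<open>K\<close> marks each word. Counting marks among the words of
    length \<open>n\<close> plays the role of a mass distribution on \<open>K\<close>.\<close>
  then obtain x where x: "\<And>ws. set ws \<subseteq> T \<Longrightarrow> x ws \<in> foldr f ws ` W \<inter> K" by metis
  have pw: "(c ^ k) powr s = (c powr s) ^ k" for k
    using c by (induction k) (auto simp: powr_mult)
  have T1: "1 \<le> real (card T) ^ k * (c ^ k) powr s" for k
    unfolding pw power_mult_distrib[symmetric] by (rule one_le_power[OF s(2)])
  \<comment> \<open>A word marked in \<open>C\<close> is determined by its prefix of length
    \<open>k\<close>, whose cell meets \<open>C\<close>, and by an arbitrary suffix. The factor of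
    \<open>T1\<close>, at least 1, turns the number of suffixes into the number of all words times
    \<open>(c ^ k) powr s\<close>.\<close>
  have count: "real (card {w \<in> words n. x w \<in> C}) \<le> real M * real (card T) ^ n * (c ^ k) powr s"
    if k: "k \<ge> k0" and n: "n \<ge> k" and C: "\<And>x y. x \<in> C \<Longrightarrow> y \<in> C \<Longrightarrow> d x y \<le> c ^ k" for n k C
  proof -
    let ?V = "{v \<in> words k. foldr f v ` W \<inter> C \<noteq> {}}"
    have "inj_on (\<lambda>w. (take k w, drop k w)) {w \<in> words n. x w \<in> C}"
      by (rule inj_onI) (metis append_take_drop_id prod.inject)
    moreover have "(\<lambda>w. (take k w, drop k w)) ` {w \<in> words n. x w \<in> C} \<subseteq> ?V \<times> words (n - k)"
    proof (rule image_subsetI)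
      fix w assume w: "w \<in> {w \<in> words n. x w \<in> C}"
      have st: "set (take k w) \<subseteq> T" "set (drop k w) \<subseteq> T"
        using w set_take_subset[of k w] set_drop_subset[of k w] by (auto simp: words_def)
      have "foldr f w y = foldr f (take k w) (foldr f (drop k w) y)" for y
        by (metis append_take_drop_id foldr_append comp_apply)
      moreover obtain y where "y \<in> W" "x w = foldr f w y" using x[of w] w by (auto simp: words_def)
      ultimately have "x w \<in> foldr f (take k w) ` W" using fW[OF st(2)] by auto
      thus "(take k w, drop k w) \<in> ?V \<times> words (n - k)" using w st n by (auto simp: words_def)
    qed
    ultimately have "card {w \<in> words n. x w \<in> C} \<le> card (?V \<times> words (n - k))"
      using fin by (intro card_inj_on_le) auto
    also have "\<dots> = card ?V * card T ^ (n - k)" by (simp only: card_cartesian_product card)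
    also have "\<dots> \<le> M * card T ^ (n - k)" using cells[OF k C] by (intro mult_right_mono) auto
    finally have "real (card {w \<in> words n. x w \<in> C}) \<le> real (M * card T ^ (n - k))" by (rule of_nat_mono)
    also have "\<dots> = real M * (real (card T) ^ (n - k) * 1)" by simp
    also have "\<dots> \<le> real M * (real (card T) ^ (n - k) * (real (card T) ^ k * (c ^ k) powr s))"
      using T1[of k] by (intro mult_left_mono) auto
    also have "\<dots> = real M * (real (card T) ^ (n - k + k) * (c ^ k) powr s)"
      by (simp only: power_add mult.assoc)
    also have "\<dots> = real M * real (card T) ^ n * (c ^ k) powr s" using n by simp
    finally show ?thesis .
  qed
  have Npos: "real (card T) > 0"
    using s(2) by (cases "card T = 0") auto
  \<comment> \<open>The power of \<open>1 / c\<close> pays for \<open>c ^ k < r / c\<close>, the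
    rounding of a radius to a power of \<open>c\<close>; \<open>M + 1\<close> keeps the constant
    positive even if \<open>M = 0\<close>.\<close>
  define M' where "M' = (real M + 1) * (1 / c) powr s"
  show ?thesis
  proof (rule hausdorff_measure_neq_0I[OF K(1) s(1), of "c ^ k0" M'])
    fix I :: "nat set" and V r
    assume I: "finite I" "K \<subseteq> (\<Union>i\<in>I. V i)" and r: "\<And>i. i \<in> I \<Longrightarrow> 0 < r i \<and> r i < c ^ k0"
      and Vr: "\<And>i x y. i \<in> I \<Longrightarrow> x \<in> V i \<Longrightarrow> y \<in> V i \<Longrightarrow> d x y \<le> r i"
    have "\<forall>i\<in>I. \<exists>k. k \<ge> k0 \<and> c ^ Suc k < r i \<and> r i \<le> c ^ k"
      using powr_scale_index[OF c] r by metis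
    from bchoice[OF this] obtain k where
      k: "\<And>i. i \<in> I \<Longrightarrow> k i \<ge> k0" "\<And>i. i \<in> I \<Longrightarrow> c ^ Suc (k i) < r i" "\<And>i. i \<in> I \<Longrightarrow> r i \<le> c ^ k i"
      by blast
    \<comment> \<open>A common word length that resolves every set of the finite cover, so that all
      counts refer to the same words.\<close>
    define n where "n = Max (insert 0 (k ` I))"
    have n: "k i \<le> n" if "i \<in> I" for i unfolding n_def using I(1) that by (intro Max_ge) auto
    have "words n \<subseteq> (\<Union>i\<in>I. {w \<in> words n. x w \<in> V i})"
    proof
      fix w assume w: "w \<in> words n"
      hence "x w \<in> K" using x by (auto simp: words_def)
      thus "w \<in> (\<Union>i\<in>I. {w \<in> words n. x w \<in> V i})" using I(2) w by blast
    qed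
    hence "card (words n) \<le> card (\<Union>i\<in>I. {w \<in> words n. x w \<in> V i})"
      using fin[of n] I(1) by (intro card_mono) auto
    also have "\<dots> \<le> (\<Sum>i\<in>I. card {w \<in> words n. x w \<in> V i})" by (rule card_UN_le[OF I(1)])
    finally have "real (card (words n)) \<le> real (\<Sum>i\<in>I. card {w \<in> words n. x w \<in> V i})"
      by (rule of_nat_mono)
    also have "\<dots> = (\<Sum>i\<in>I. real (card {w \<in> words n. x w \<in> V i}))" by simp
    also have "\<dots> \<le> (\<Sum>i\<in>I. real (card T) ^ n * (M' * r i powr s))"
    proof (rule sum_mono)
      fix i assume i: "i \<in> I"
      have "d y z \<le> c ^ k i" if "y \<in> V i" "z \<in> V i" for y z
        using Vr[OF i that] k(3)[OF i] by simp
      from count[OF k(1)[OF i] n[OF i] this]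
      have "real (card {w \<in> words n. x w \<in> V i}) \<le> real M * real (card T) ^ n * (c ^ k i) powr s" by blast
      also have "\<dots> \<le> (real M + 1) * real (card T) ^ n * (c ^ k i) powr s"
        by (intro mult_right_mono) auto
      also have "\<dots> \<le> (real M + 1) * real (card T) ^ n * (((1 / c) * r i) powr s)"
        using k(2)[OF i] c s(1) by (intro mult_left_mono powr_mono2) (auto simp: field_simps)
      also have "((1 / c) * r i) powr s = (1 / c) powr s * r i powr s"
        by (rule powr_mult)
      also have "(real M + 1) * real (card T) ^ n * ((1 / c) powr s * r i powr s) =
        real (card T) ^ n * (M' * r i powr s)"
        by (simp only: M'_def mult_ac)
      finally show "real (card {w \<in> words n. x w \<in> V i}) \<le> real (card T) ^ n * (M' * r i powr s)" .
    qed
    also have "\<dots> = real (card T) ^ n * (M' * (\<Sum>i\<in>I. r i powr s))"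
      by (simp add: sum_distrib_left)
    finally show "1 \<le> M' * (\<Sum>i\<in>I. r i powr s)" using Npos by (simp add: card)
  qed (use c in \<open>auto simp: M'_def\<close>)
qed

end

section \<open>Spectral radius of nonnegative matrices\<close>

text \<open>Matrix powers entry by entry, so that real entries keep their order. The first factor is
  split off, just as \<open>paths_Suc\<close> splits off the first edge.\<close>

primrec entry_power :: "nat \<Rightarrow> (nat \<Rightarrow> nat \<Rightarrow> 'b::comm_semiring_1) \<Rightarrow> nat \<Rightarrow> nat \<Rightarrow> nat \<Rightarrow> 'b" where
  "entry_power n a 0 i j = (if i = j then 1 else 0)"
| "entry_power n a (Suc q) i j = (\<Sum>k<n. a i k * entry_power n a q k j)"

lemma entry_power_add:
  assumes "i < n"
  shows "entry_power n a (p + q) i j = (\<Sum>k<n. entry_power n a p i k * entry_power n a q k j)"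
  using assms
proof (induction p arbitrary: i)
  case 0
  have "(\<Sum>k<n. (if i = k then 1 else 0) * entry_power n a q k j) =
      (\<Sum>k<n. if i = k then entry_power n a q k j else 0)"
    by (intro sum.cong) auto
  thus ?case using 0 by simp
next
  case (Suc p)
  have "entry_power n a (Suc p + q) i j =
      (\<Sum>k<n. a i k * (\<Sum>l<n. entry_power n a p k l * entry_power n a q l j))"
    using Suc by simp
  also have "\<dots> = (\<Sum>k<n. \<Sum>l<n. a i k * entry_power n a p k l * entry_power n a q l j)"
    by (simp add: sum_distrib_left mult.assoc)
  also have "\<dots> = (\<Sum>l<n. \<Sum>k<n. a i k * entry_power n a p k l * entry_power n a q l j)"
    by (rule sum.swap)
  finally show ?case by (simp add: sum_distrib_right)
qed

text \<open>The matrix power \<open>^\<^sub>m\<close> unfolds on the right, so the link with it in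
  \<open>complex_mat_power\<close> goes through this form.\<close>

lemma entry_power_Suc_right:
  assumes "i < n" "j < n"
  shows "entry_power n a (Suc q) i j = (\<Sum>k<n. entry_power n a q i k * a k j)"
proof -
  have "entry_power n a 1 k j = a k j" for k
  proof -
    have "(\<Sum>l<n. a k l * (if l = j then 1 else 0)) = (\<Sum>l<n. if l = j then a k l else 0)"
      by (intro sum.cong) auto
    thus ?thesis using assms by simp
  qed
  thus ?thesis using entry_power_add[OF assms(1), of a q 1 j] by simp
qed

lemma entry_power_nonneg:
  fixes a :: "nat \<Rightarrow> nat \<Rightarrow> real"
  assumes "\<And>i j. 0 \<le> a i j"
  shows "0 \<le> entry_power n a q i j"
  by (induction q arbitrary: i) (auto intro!: sum_nonneg mult_nonneg_nonneg assms)

lemma entry_power_mult_le: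
  fixes a :: "nat \<Rightarrow> nat \<Rightarrow> real"
  assumes a: "\<And>i j. 0 \<le> a i j" and "i < n" "k < n"
  shows "entry_power n a p i k * entry_power n a q k j \<le> entry_power n a (p + q) i j"
  unfolding entry_power_add[OF assms(2)]
  using assms entry_power_nonneg[of a, OF a] by (intro member_le_sum) auto

lemma entry_power_iterate_le:
  fixes a :: "nat \<Rightarrow> nat \<Rightarrow> real"
  assumes a: "\<And>i j. 0 \<le> a i j" and "i < n"
  shows "entry_power n a q i i ^ m \<le> entry_power n a (q * m) i i"
proof (induction m)
  case (Suc m)
  have "entry_power n a q i i ^ Suc m \<le> entry_power n a q i i * entry_power n a (q * m) i i"
    using Suc entry_power_nonneg[of a, OF a] by (simp add: mult_left_mono)
  also have "\<dots> \<le> entry_power n a (q * Suc m) i i"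
    using entry_power_mult_le[OF a assms(2,2), where p=q and q="q * m" and j=i] by simp
  finally show ?case .
qed simp

abbreviation complex_mat :: "nat \<Rightarrow> (nat \<Rightarrow> nat \<Rightarrow> real) \<Rightarrow> complex Matrix.mat" where
  "complex_mat n a \<equiv> Matrix.mat n n (\<lambda>(i, j). complex_of_real (a i j))"

lemma complex_mat_power_carrier: "complex_mat n a ^\<^sub>m q \<in> carrier_mat n n"
  by (rule pow_carrier_mat) simp

lemma complex_mat_power:
  "i < n \<Longrightarrow> j < n \<Longrightarrow> (complex_mat n a ^\<^sub>m q) $$ (i, j) = complex_of_real (entry_power n a q i j)"
proof (induction q arbitrary: i j)
  case (Suc q)
  thus ?case using complex_mat_power_carrier[of n a q]
    by (simp add: scalar_prod_def atLeast0LessThan entry_power_Suc_right del: entry_power.simps)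
qed simp

text \<open>\<open>c\<close>-subinvariant vectors: for \<open>c > 0\<close> they exist iff the spectral radius is at least \<open>c\<close>.\<close>

definition subinvariant :: "nat \<Rightarrow> (nat \<Rightarrow> nat \<Rightarrow> real) \<Rightarrow> real \<Rightarrow> bool" where
  "subinvariant n a c \<longleftrightarrow> (\<exists>u. (\<forall>i<n. 0 \<le> u i) \<and> (\<exists>i<n. 0 < u i) \<and>
     (\<forall>i<n. c * u i \<le> (\<Sum>j<n. a i j * u j)))"

lemma subinvariant_power:
  fixes a :: "nat \<Rightarrow> nat \<Rightarrow> real"
  assumes a: "\<And>i j. 0 \<le> a i j" and c: "0 \<le> c"
    and u: "\<And>i. i < n \<Longrightarrow> c * u i \<le> (\<Sum>j<n. a i j * u j)" and i: "i < n"
  shows "c ^ q * u i \<le> (\<Sum>j<n. entry_power n a q i j * u j)"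
  using i
proof (induction q arbitrary: i)
  case 0
  have "(\<Sum>j<n. (if i = j then 1 else 0) * u j) = (\<Sum>j<n. if i = j then u j else 0)"
    by (intro sum.cong) auto
  thus ?case using 0 by simp
next
  case (Suc q)
  have "c ^ Suc q * u i = c ^ q * (c * u i)" by simp
  also have "\<dots> \<le> c ^ q * (\<Sum>j<n. a i j * u j)" using u[OF Suc(2)] c by (intro mult_left_mono) auto
  also have "\<dots> = (\<Sum>j<n. a i j * (c ^ q * u j))" by (simp add: sum_distrib_left mult_ac)
  also have "\<dots> \<le> (\<Sum>j<n. a i j * (\<Sum>k<n. entry_power n a q j k * u k))"
    using Suc.IH a by (intro sum_mono mult_left_mono) auto
  also have "\<dots> = (\<Sum>j<n. \<Sum>k<n. a i j * entry_power n a q j k * u k)"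
    by (simp add: sum_distrib_left mult.assoc)
  also have "\<dots> = (\<Sum>k<n. \<Sum>j<n. a i j * entry_power n a q j k * u k)" by (rule sum.swap)
  finally show ?case by (simp add: sum_distrib_right)
qed

text \<open>The vector consists of the moduli of the entries of an eigenvector for an eigenvalue of
  maximal modulus; nonnegativity of \<open>a\<close> turns the triangle inequality into
  subinvariance.\<close>

lemma subinvariant_spectral_radius:
  assumes a: "\<And>i j. 0 \<le> a i j" and n: "0 < n"
  shows "subinvariant n a (spectral_radius (complex_mat n a))"
proof -
  have A: "complex_mat n a \<in> carrier_mat n n" by simp
  obtain k where k: "k \<in> spectrum (complex_mat n a)" "spectral_radius (complex_mat n a) = norm k"
    using spectral_radius_mem_max(1)[OF A n] by auto
  obtain v where v: "v \<in> carrier_vec n" "v \<noteq> 0\<^sub>v n" "complex_mat n a *\<^sub>v v = k \<cdot>\<^sub>v v"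
    using k(1) unfolding spectrum_def eigenvalue_def eigenvector_def by auto
  define u where "u i = norm (vec_index v i)" for i
  have "\<exists>i<n. 0 < u i"
  proof (rule ccontr)
    assume "\<not> ?thesis"
    hence "v = 0\<^sub>v n" using v(1) by (intro eq_vecI) (auto simp: u_def)
    thus False using v(2) by simp
  qed
  moreover have "norm k * u i \<le> (\<Sum>j<n. a i j * u j)" if i: "i < n" for i
  proof -
    have "k * (vec_index v i) = vec_index (complex_mat n a *\<^sub>v v) i" using v i by simp
    also have "\<dots> = (\<Sum>j<n. complex_of_real (a i j) * (vec_index v j))"
      using v(1) i by (simp add: scalar_prod_def atLeast0LessThan)
    finally have "norm k * u i = norm (\<Sum>j<n. complex_of_real (a i j) * (vec_index v j))"
      by (simp add: u_def flip: norm_mult)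
    also have "\<dots> \<le> (\<Sum>j<n. norm (complex_of_real (a i j) * (vec_index v j)))" by (rule norm_sum)
    also have "\<dots> = (\<Sum>j<n. a i j * u j)" using a by (simp add: norm_mult u_def)
    finally show ?thesis .
  qed
  ultimately show ?thesis unfolding subinvariant_def k(2) by (intro exI[of _ u]) (auto simp: u_def)
qed

lemma spectral_radius_scale_less:
  assumes n: "0 < n" and c: "0 < c" and r: "spectral_radius (complex_mat n a) < c"
  shows "spectral_radius (complex_mat n (\<lambda>i j. a i j / c)) < 1"
proof -
  have A: "complex_mat n b \<in> carrier_mat n n" for b by simp
  obtain k where k: "k \<in> spectrum (complex_mat n (\<lambda>i j. a i j / c))"
      "spectral_radius (complex_mat n (\<lambda>i j. a i j / c)) = norm k"
    using spectral_radius_mem_max(1)[OF A n, of "\<lambda>i j. a i j / c"] by blast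
  obtain v where v: "v \<in> carrier_vec n" "v \<noteq> 0\<^sub>v n" "complex_mat n (\<lambda>i j. a i j / c) *\<^sub>v v = k \<cdot>\<^sub>v v"
    using k(1) unfolding spectrum_def eigenvalue_def eigenvector_def by auto
  have "complex_mat n a *\<^sub>v v = (of_real c * k) \<cdot>\<^sub>v v"
  proof (rule eq_vecI)
    fix i assume "i < dim_vec ((of_real c * k) \<cdot>\<^sub>v v)"
    hence i: "i < n" using v(1) by simp
    have "k * (vec_index v i) = vec_index (complex_mat n (\<lambda>i j. a i j / c) *\<^sub>v v) i" using v i by simp
    also have "\<dots> = (\<Sum>j<n. complex_of_real (a i j / c) * (vec_index v j))"
      using v(1) i by (simp add: scalar_prod_def atLeast0LessThan)
    finally have "of_real c * (k * (vec_index v i)) = (\<Sum>j<n. complex_of_real (a i j) * (vec_index v j))"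
      using c by (simp add: sum_distrib_left)
    thus "vec_index (complex_mat n a *\<^sub>v v) i = vec_index ((of_real c * k) \<cdot>\<^sub>v v) i"
      using v(1) i by (simp add: scalar_prod_def atLeast0LessThan mult.assoc)
  qed (use v in simp)
  hence "of_real c * k \<in> spectrum (complex_mat n a)"
    unfolding spectrum_def eigenvalue_def eigenvector_def using v by auto
  hence "norm (of_real c * k) \<le> spectral_radius (complex_mat n a)"
    by (intro spectral_radius_mem_max(2)[OF A n]) auto
  moreover have "norm (of_real c * k) = c * norm k" using c by (simp add: norm_mult)
  ultimately have "c * norm k < c * 1" using r by linarith
  hence "norm k < 1" using c by (simp only: mult_less_cancel_left_pos)
  thus ?thesis by (simp only: k(2))
qed

lemma entry_power_scale: "entry_power n (\<lambda>i j. a i j / c) q i j = entry_power n a q i j / (c::real) ^ q"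
  by (induction q arbitrary: i) (simp_all add: sum_divide_distrib)

text \<open>Dividing by a number \<open>c\<close> strictly between the radius and 1 keeps the radius
  below 1, so the powers of the scaled matrix are bounded. Undoing the scaling gives decay like
  \<open>c ^ q\<close>. The maximum with 0 ensures \<open>0 < c\<close>.\<close>

lemma entry_power_tendsto_0:
  assumes n: "0 < n" and r: "spectral_radius (complex_mat n a) < 1" and ij: "i < n" "j < n"
  shows "(\<lambda>q. entry_power n a q i j) \<longlonglongrightarrow> 0"
proof -
  define c where "c = (max 0 (spectral_radius (complex_mat n a)) + 1) / 2"
  have c: "0 < c" "c < 1" "spectral_radius (complex_mat n a) < c" using r by (auto simp: c_def)
  let ?B = "complex_mat n (\<lambda>i j. a i j / c)"
  have "?B \<in> carrier_mat n n" by simp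
  from spectral_radius_jnf_norm_bound_less_1_upper_triangular[OF this spectral_radius_scale_less[OF n c(1,3)]]
  obtain C where C: "\<And>q. norm_bound (?B ^\<^sub>m q) C" by blast
  have bound: "\<bar>entry_power n a q i j\<bar> \<le> C * c ^ q" for q
  proof -
    have "norm ((?B ^\<^sub>m q) $$ (i, j)) \<le> C"
      using C[of q] complex_mat_power_carrier[of n "\<lambda>i j. a i j / c" q] ij by (auto simp: norm_bound_def)
    hence "\<bar>entry_power n a q i j\<bar> / \<bar>c ^ q\<bar> \<le> C"
      by (simp only: complex_mat_power[OF ij] entry_power_scale norm_of_real abs_divide)
    hence "\<bar>entry_power n a q i j\<bar> / c ^ q \<le> C" using c by simp
    thus ?thesis using c by (simp add: pos_divide_le_eq)
  qed
  have "(\<lambda>q. C * c ^ q) \<longlonglongrightarrow> C * 0" using c by (intro tendsto_intros LIMSEQ_power_zero) auto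
  hence "(\<lambda>q. C * c ^ q) \<longlonglongrightarrow> 0" by simp
  thus ?thesis by (rule Lim_null_comparison[rotated]) (use bound in auto)
qed

text \<open>Were the radius below \<open>c\<close>, the powers of \<open>a / c\<close> would tend to
  0, whereas iterated subinvariance keeps their product with \<open>u\<close> at least
  \<open>u i\<close> in the coordinate \<open>i\<close>.\<close>

lemma spectral_radius_ge:
  assumes a: "\<And>i j. 0 \<le> a i j" and n: "0 < n" and c: "0 < c" and s: "subinvariant n a c"
  shows "c \<le> spectral_radius (complex_mat n a)"
proof (rule ccontr)
  assume "\<not> ?thesis"
  hence r: "spectral_radius (complex_mat n a) < c" by simp
  obtain u i where u: "\<And>i. i < n \<Longrightarrow> 0 \<le> u i" "i < n" "0 < u i"
      "\<And>i. i < n \<Longrightarrow> c * u i \<le> (\<Sum>j<n. a i j * u j)"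
    using s unfolding subinvariant_def by blast
  have "(\<lambda>q. \<Sum>j<n. entry_power n (\<lambda>i j. a i j / c) q i j * u j) \<longlonglongrightarrow> (\<Sum>j<n. 0 * u j)"
    by (intro tendsto_sum tendsto_mult_right entry_power_tendsto_0[OF n spectral_radius_scale_less[OF n c r] u(2)]) auto
  hence lim: "(\<lambda>q. \<Sum>j<n. entry_power n (\<lambda>i j. a i j / c) q i j * u j) \<longlonglongrightarrow> 0" by simp
  have "u i \<le> (\<Sum>j<n. entry_power n (\<lambda>i j. a i j / c) q i j * u j)" for q
    using subinvariant_power[of a c n u i q, OF a _ u(4) u(2)] c
    by (simp add: entry_power_scale pos_le_divide_eq mult.commute flip: sum_divide_distrib)
  hence "u i \<le> 0" using LIMSEQ_le_const[OF lim] by blast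
  thus False using u(3) by simp
qed

text \<open>Start from a vertex \<open>i\<close> in the support of \<open>u\<close> from which every reachable vertex of the support
  leads back to \<open>i\<close>; if the diagonal entries stayed bounded, so would all \<open>c ^ q * u i\<close>.\<close>

lemma subinvariant_diagonal_gt_1:
  assumes a: "\<And>i j. 0 \<le> a i j" and c: "1 < c" and s: "subinvariant n a c"
  shows "\<exists>i q. i < n \<and> 1 \<le> q \<and> 1 < entry_power n a q i i"
proof (rule ccontr)
  assume neg: "\<not> ?thesis"
  have le1: "entry_power n a q i i \<le> 1" if "i < n" for i q
  proof (cases q)
    case (Suc q')
    show ?thesis
    proof (rule ccontr)
      assume "\<not> ?thesis"
      hence "1 < entry_power n a q i i" by simp
      with \<open>i < n\<close> Suc neg show False by (metis One_nat_def Suc_le_mono le0)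
    qed
  qed simp
  have nn: "0 \<le> entry_power n a q i j" for q i j using entry_power_nonneg[of a, OF a] .
  obtain u i0 where u: "\<And>i. i < n \<Longrightarrow> 0 \<le> u i" "i0 < n" "0 < u i0"
      "\<And>i. i < n \<Longrightarrow> c * u i \<le> (\<Sum>j<n. a i j * u j)"
    using s unfolding subinvariant_def by blast
  define S where "S = {i. i < n \<and> 0 < u i}"
  define reach where "reach i = {j \<in> S. \<exists>q. 0 < entry_power n a q i j}" for i
  have finS: "finite S" unfolding S_def by simp
  have "i0 \<in> S" using u by (simp add: S_def)
  \<comment> \<open>Take a vertex of the support that reaches the fewest vertices of the support.
    What a reachable \<open>j\<close> reaches is reachable from \<open>i\<close>, so minimality
    makes both sets equal, and \<open>j\<close> leads back to \<open>i\<close>.\<close>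
  from ex_has_least_nat[of "\<lambda>i. i \<in> S" i0 "\<lambda>i. card (reach i)", OF this]
  obtain i where i: "i \<in> S" "\<And>j. j \<in> S \<Longrightarrow> card (reach i) \<le> card (reach j)" by blast
  have i_n: "i < n" "0 < u i" using i(1) by (auto simp: S_def)
  have return: "\<exists>l. 0 < entry_power n a l j i" if j: "j \<in> reach i" for j
  proof -
    have jS: "j \<in> S" "j < n" using j by (auto simp: reach_def S_def)
    obtain q where q: "0 < entry_power n a q i j" using j by (auto simp: reach_def)
    have "reach j \<subseteq> reach i"
    proof
      fix k assume "k \<in> reach j"
      then obtain p where p: "k \<in> S" "0 < entry_power n a p j k" by (auto simp: reach_def)
      have "0 < entry_power n a q i j * entry_power n a p j k" using q p by simp
      also have "\<dots> \<le> entry_power n a (q + p) i k" by (rule entry_power_mult_le[OF a i_n(1) jS(2)])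
      finally show "k \<in> reach i" using p by (auto simp: reach_def)
    qed
    moreover have "finite (reach i)" using finS by (simp add: reach_def)
    ultimately have "reach j = reach i" using i(2)[OF jS(1)] by (intro card_subset_eq) (auto intro: antisym card_mono)
    moreover have "i \<in> reach i" using i(1) unfolding reach_def by (auto intro!: exI[of _ 0])
    ultimately show ?thesis by (auto simp: reach_def)
  qed
  hence "\<forall>j\<in>reach i. \<exists>l. 0 < entry_power n a l j i" ..
  from bchoice[OF this] obtain l where l: "\<And>j. j \<in> reach i \<Longrightarrow> 0 < entry_power n a (l j) j i" by blast
  \<comment> \<open>Going to \<open>j\<close> and returning contributes to a diagonal entry, hence
    at most 1; dividing by the fixed return weight bounds the entries towards \<open>j\<close>
    uniformly in \<open>q\<close>.\<close>
  define B where "B j = (if j \<in> reach i then u j / entry_power n a (l j) j i else 0)" for j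
  have bnd: "entry_power n a q i j * u j \<le> B j" if j: "j < n" for q j
  proof (cases "j \<in> reach i")
    case True
    have "entry_power n a q i j * entry_power n a (l j) j i \<le> 1"
      using entry_power_mult_le[OF a i_n(1) j, where p=q and q="l j" and j=i] le1[OF i_n(1)] by (rule order_trans)
    hence "entry_power n a q i j \<le> 1 / entry_power n a (l j) j i"
      using l[OF True] by (simp add: pos_le_divide_eq)
    from mult_right_mono[OF this u(1)[OF j]] show ?thesis using True by (simp add: B_def)
  next
    case False
    have "u j = 0 \<or> entry_power n a q i j = 0"
    proof (rule ccontr)
      assume "\<not> ?thesis"
      hence "0 < u j" "0 < entry_power n a q i j" using u(1)[OF j] nn[of q i j] by auto
      thus False using False j by (auto simp: reach_def S_def)
    qed
    thus ?thesis using False by (auto simp: B_def)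
  qed
  have "c ^ q * u i \<le> (\<Sum>j<n. B j)" for q
  proof -
    have "c ^ q * u i \<le> (\<Sum>j<n. entry_power n a q i j * u j)"
      by (rule subinvariant_power[OF a _ u(4) i_n(1)]) (use c in auto)
    also have "\<dots> \<le> (\<Sum>j<n. B j)" using bnd by (intro sum_mono) auto
    finally show ?thesis .
  qed
  moreover obtain q where "(\<Sum>j<n. B j) / u i < c ^ q" using real_arch_pow[OF c] by blast
  ultimately show False using i_n(2) by (simp add: pos_divide_less_eq leD)
qed

text \<open>Expresses a radius of at least 1 through path sums, which are continuous in the
  exponent. This is what passes to a limit of exponents in \<open>critical_exponent\<close>.\<close>

lemma subinvariant_total:
  assumes a: "\<And>i j. 0 \<le> a i j" and s: "subinvariant n a 1"
  shows "1 \<le> (\<Sum>i<n. \<Sum>j<n. entry_power n a q i j)"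
proof -
  obtain u i where u: "\<And>i. i < n \<Longrightarrow> 0 \<le> u i" "i < n" "0 < u i"
      "\<And>i. i < n \<Longrightarrow> 1 * u i \<le> (\<Sum>j<n. a i j * u j)"
    using s unfolding subinvariant_def by blast
  define U where "U = (\<Sum>i<n. u i)"
  have uU: "u j \<le> U" if "j < n" for j unfolding U_def using u(1) that by (intro member_le_sum) auto
  have U: "0 < U" using uU[OF u(2)] u(3) by simp
  have "U = (\<Sum>i<n. 1 ^ q * u i)" by (simp add: U_def)
  also have "\<dots> \<le> (\<Sum>i<n. \<Sum>j<n. entry_power n a q i j * u j)"
    by (intro sum_mono subinvariant_power[OF a _ u(4)]) auto
  also have "\<dots> \<le> (\<Sum>i<n. \<Sum>j<n. entry_power n a q i j * U)"
    using uU entry_power_nonneg[of a, OF a] by (intro sum_mono mult_left_mono) auto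
  also have "\<dots> = (\<Sum>i<n. \<Sum>j<n. entry_power n a q i j) * U" by (simp add: sum_distrib_right)
  finally show ?thesis using U by simp
qed

lemma subinvariant_weaken: "subinvariant n a c \<Longrightarrow> c' \<le> c \<Longrightarrow> subinvariant n a c'"
  unfolding subinvariant_def
proof (elim exE conjE, intro exI conjI allI impI)
  fix u :: "nat \<Rightarrow> real" and i
  assume "\<forall>i<n. 0 \<le> u i" "\<forall>i<n. c * u i \<le> (\<Sum>j<n. a i j * u j)" "c' \<le> c" "i < n"
  thus "c' * u i \<le> (\<Sum>j<n. a i j * u j)" using mult_right_mono[of c' c "u i"] by force
qed auto

text \<open>Serves to compare exponents: changing the exponent multiplies each entry by at least
  some factor \<open>k\<close>, and the same vector works for the new matrix.\<close>

lemma subinvariant_scale: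
  assumes s: "subinvariant n a c" and k: "0 \<le> k" and ab: "\<And>i j. i < n \<Longrightarrow> j < n \<Longrightarrow> k * a i j \<le> b i j"
  shows "subinvariant n b (k * c)"
proof -
  obtain u where u: "\<forall>i<n. 0 \<le> u i" "\<exists>i<n. 0 < u i" "\<And>i. i < n \<Longrightarrow> c * u i \<le> (\<Sum>j<n. a i j * u j)"
    using s unfolding subinvariant_def by blast
  have "k * c * u i \<le> (\<Sum>j<n. b i j * u j)" if i: "i < n" for i
  proof -
    have "k * c * u i \<le> k * (\<Sum>j<n. a i j * u j)"
      using mult_left_mono[OF u(3)[OF i] k] by (simp add: mult.assoc)
    also have "\<dots> = (\<Sum>j<n. k * a i j * u j)" by (simp add: sum_distrib_left mult.assoc)
    also have "\<dots> \<le> (\<Sum>j<n. b i j * u j)"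
      using ab[OF i] u(1) by (intro sum_mono mult_right_mono) auto
    finally show ?thesis .
  qed
  thus ?thesis unfolding subinvariant_def using u(1,2) by (intro exI[of _ u]) simp
qed

section \<open>Dependence of the spectral radius on the exponent\<close>

locale edge_weights =
  fixes n :: nat and E :: "nat \<Rightarrow> nat \<Rightarrow> 'e set" and \<rho> :: "'e \<Rightarrow> real"
  assumes n: "0 < n" and finite_E: "finite (E i j)"
    and \<rho>: "e \<in> E i j \<Longrightarrow> 0 < \<rho> e \<and> \<rho> e < 1"
begin

definition weight :: "real \<Rightarrow> nat \<Rightarrow> nat \<Rightarrow> real" where
  "weight s i j = (\<Sum>e\<in>E i j. \<rho> e powr s)"

lemma weight_nonneg: "0 \<le> weight s i j"
  unfolding weight_def by (intro sum_nonneg) simp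

lemma ratio_bounds:
  obtains \<eta> \<kappa> where "0 < \<eta>" "\<eta> < 1" "0 < \<kappa>" "\<kappa> < 1"
    "\<And>i j e. i < n \<Longrightarrow> j < n \<Longrightarrow> e \<in> E i j \<Longrightarrow> \<eta> \<le> \<rho> e \<and> \<rho> e \<le> \<kappa>"
proof -
  \<comment> \<open>The element \<open>1/2\<close> provides a minimum and a maximum in the absence
    of edges.\<close>
  define S where "S = insert (1/2) (\<rho> ` (\<Union>i<n. \<Union>j<n. E i j))"
  have fin: "finite S" "S \<noteq> {}" unfolding S_def using finite_E by auto
  have S: "0 < x \<and> x < 1" if "x \<in> S" for x using that \<rho> by (auto simp: S_def)
  show ?thesis
  proof (rule that[of "Min S" "Max S"])
    show "Min S \<le> \<rho> e \<and> \<rho> e \<le> Max S" if "i < n" "j < n" "e \<in> E i j" for i j e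
    proof -
      have "\<rho> e \<in> S" using that by (auto simp: S_def)
      thus ?thesis using fin by simp
    qed
  qed (use S[OF Min_in[OF fin]] S[OF Max_in[OF fin]] in auto)
qed

lemma weight_compare:
  assumes "s \<le> t" "0 < \<eta>" "\<And>e. e \<in> E i j \<Longrightarrow> \<eta> \<le> \<rho> e \<and> \<rho> e \<le> \<kappa>"
  shows "\<eta> powr (t - s) * weight s i j \<le> weight t i j" "weight t i j \<le> \<kappa> powr (t - s) * weight s i j"
proof -
  have e: "\<rho> e powr t = \<rho> e powr (t - s) * \<rho> e powr s" for e by (simp flip: powr_add)
  show "\<eta> powr (t - s) * weight s i j \<le> weight t i j"
    unfolding weight_def sum_distrib_left e
    using assms by (intro sum_mono mult_right_mono powr_mono2) auto
  show "weight t i j \<le> \<kappa> powr (t - s) * weight s i j"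
    unfolding weight_def sum_distrib_left e
    using assms \<rho> by (intro sum_mono mult_right_mono powr_mono2) (auto intro: less_imp_le)
qed

lemma continuous_entry_power: "continuous_on UNIV (\<lambda>s. entry_power n (weight s) q i j)"
proof (induction q arbitrary: i)
  case (Suc q)
  have "continuous_on UNIV (\<lambda>s. weight s i k)" for k
    unfolding weight_def
  proof (intro continuous_on_sum)
    fix e assume "e \<in> E i k"
    hence "\<rho> e \<noteq> 0" using \<rho> by force
    thus "continuous_on UNIV (\<lambda>s. \<rho> e powr s)" by (intro continuous_intros) auto
  qed
  thus ?case using Suc by (auto intro!: continuous_on_sum continuous_on_mult)
qed simp

abbreviation radius :: "real \<Rightarrow> real" where
  "radius s \<equiv> spectral_radius (complex_mat n (weight s))"

lemma radius_ge: "0 < c \<Longrightarrow> c \<le> radius s \<longleftrightarrow> subinvariant n (weight s) c"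
  using spectral_radius_ge[of "weight s", OF weight_nonneg n] subinvariant_weaken
    subinvariant_spectral_radius[of "weight s", OF weight_nonneg n] by blast

text \<open>Passing from \<open>t\<close> down to \<open>s\<close> multiplies every entry by at
  least \<open>\<kappa> powr (s - t)\<close>, which exceeds 1. The assumption on \<open>t\<close>
  excludes nilpotent matrices, whose radius is 0 at every exponent.\<close>

lemma radius_strict_decreasing:
  assumes "s < t" "1 \<le> radius t"
  shows "1 < radius s"
proof -
  obtain \<eta> \<kappa> where k: "0 < \<eta>" "0 < \<kappa>" "\<kappa> < 1"
    "\<And>i j e. i < n \<Longrightarrow> j < n \<Longrightarrow> e \<in> E i j \<Longrightarrow> \<eta> \<le> \<rho> e \<and> \<rho> e \<le> \<kappa>" using ratio_bounds by metis
  have "subinvariant n (weight s) (\<kappa> powr (s - t) * 1)"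
  proof (rule subinvariant_scale)
    show "subinvariant n (weight t) 1" using assms(2) radius_ge[of 1 t] by simp
    fix i j assume ij: "i < n" "j < n"
    have "weight t i j \<le> \<kappa> powr (t - s) * weight s i j"
      by (rule weight_compare(2)[of s t \<eta>]) (use assms(1) k(1) k(4)[OF ij] in auto)
    hence "\<kappa> powr (s - t) * weight t i j \<le> \<kappa> powr (s - t) * (\<kappa> powr (t - s) * weight s i j)"
      by (intro mult_left_mono) auto
    also have "\<dots> = weight s i j" using k(2) by (simp flip: mult.assoc powr_add)
    finally show "\<kappa> powr (s - t) * weight t i j \<le> weight s i j" .
  qed simp
  moreover have gt: "1 < \<kappa> powr (s - t)" using assms(1) k by (simp add: powr_def mult_neg_neg)
  ultimately have "\<kappa> powr (s - t) \<le> radius s" 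
    using radius_ge[of "\<kappa> powr (s - t)" s] k(2) by (simp only: mult_1_right powr_gt_zero)
  thus ?thesis using gt by simp
qed

lemma total_tendsto_0:
  assumes "radius s < 1"
  shows "(\<lambda>q. \<Sum>i<n. \<Sum>j<n. entry_power n (weight s) q i j) \<longlonglongrightarrow> 0"
proof -
  have "(\<lambda>q. \<Sum>i<n. \<Sum>j<n. entry_power n (weight s) q i j) \<longlonglongrightarrow> (\<Sum>i<n. \<Sum>j<n. 0)"
    by (intro tendsto_sum entry_power_tendsto_0[OF n assms]) auto
  thus ?thesis by simp
qed

text \<open>The exponent is the supremum of the set \<open>T\<close> of exponents with radius at
  least 1. The hypothesis puts 0 into \<open>T\<close>: path sums that never drop below 1 cannot
  tend to 0.\<close>

lemma critical_exponent:
  assumes total: "\<And>q. 1 \<le> (\<Sum>i<n. \<Sum>j<n. entry_power n (weight 0) q i j)"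
  obtains \<alpha> where "0 \<le> \<alpha>" "radius \<alpha> = 1" "\<And>\<beta>. 0 \<le> \<beta> \<Longrightarrow> radius \<beta> = 1 \<Longrightarrow> \<beta> = \<alpha>"
    "\<And>s. \<alpha> < s \<Longrightarrow> (\<lambda>q. \<Sum>i<n. \<Sum>j<n. entry_power n (weight s) q i j) \<longlonglongrightarrow> 0"
    "\<And>s. 0 \<le> s \<Longrightarrow> s < \<alpha> \<Longrightarrow> \<exists>i q. i < n \<and> 1 \<le> q \<and> 1 < entry_power n (weight s) q i i"
proof -
  obtain \<eta> \<kappa> where k: "0 < \<eta>" "\<eta> < 1" "0 < \<kappa>" "\<kappa> < 1"
    "\<And>i j e. i < n \<Longrightarrow> j < n \<Longrightarrow> e \<in> E i j \<Longrightarrow> \<eta> \<le> \<rho> e \<and> \<rho> e \<le> \<kappa>" using ratio_bounds by metis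
  define T where "T = {s. 0 \<le> s \<and> 1 \<le> radius s}"
  define \<alpha> where "\<alpha> = Sup T"
  have T_total: "1 \<le> (\<Sum>i<n. \<Sum>j<n. entry_power n (weight s) q i j)" if "s \<in> T" for s q
    using that radius_ge[of 1 s] by (intro subinvariant_total weight_nonneg) (simp add: T_def)
  have "0 \<in> T"
  proof (rule ccontr)
    assume "0 \<notin> T"
    hence "radius 0 < 1" by (simp add: T_def)
    from LIMSEQ_le_const[OF total_tendsto_0[OF this], of 1] total show False by auto
  qed
  have bdd: "bdd_above T"
  proof -
    define C where "C = (\<Sum>i<n. \<Sum>j<n. weight 0 i j)"
    have C: "0 \<le> C" unfolding C_def by (intro sum_nonneg weight_nonneg)
    \<comment> \<open>For exponents beyond \<open>m\<close> the factor
      \<open>\<kappa> powr s\<close> presses the total weight of all edges below 1, against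
      \<open>T_total\<close> for paths of length 1.\<close>
    obtain m where m: "\<kappa> ^ m < 1 / (C + 1)" using real_arch_pow_inv[of "1 / (C + 1)" \<kappa>] k C by auto
    have "s \<le> real m" if s: "s \<in> T" for s
    proof (rule ccontr)
      assume "\<not> s \<le> real m"
      have "1 \<le> (\<Sum>i<n. \<Sum>j<n. weight s i j)"
      proof -
        have "entry_power n (weight s) 1 i j = weight s i j" if "i < n" "j < n" for i j
          using entry_power_Suc_right[OF that, of "weight s" 0] that by (simp add: sum.delta' if_distrib if_distribR cong: if_cong)
        hence "(\<Sum>i<n. \<Sum>j<n. entry_power n (weight s) 1 i j) = (\<Sum>i<n. \<Sum>j<n. weight s i j)"
          by (intro sum.cong refl) (auto simp del: entry_power.simps)
        thus ?thesis using T_total[OF s, of 1] by (simp only:)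
      qed
      also have "\<dots> \<le> (\<Sum>i<n. \<Sum>j<n. \<kappa> powr s * weight 0 i j)"
      proof (intro sum_mono)
        fix i j assume "i \<in> {..<n}" "j \<in> {..<n}"
        hence ij: "i < n" "j < n" by auto
        have "weight s i j \<le> \<kappa> powr (s - 0) * weight 0 i j"
          by (rule weight_compare(2)[of 0 s \<eta>]) (use s k(1) k(5)[OF ij] in \<open>auto simp: T_def\<close>)
        thus "weight s i j \<le> \<kappa> powr s * weight 0 i j" by simp
      qed
      also have "\<dots> = \<kappa> powr s * C" by (simp add: C_def sum_distrib_left)
      also have "\<dots> \<le> \<kappa> powr real m * C"
        using \<open>\<not> s \<le> real m\<close> k C by (intro mult_right_mono powr_mono') auto
      also have "\<dots> = \<kappa> ^ m * C" using k by (simp add: powr_realpow)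
      also have "\<dots> \<le> 1 / (C + 1) * C" using m C by (intro mult_right_mono) auto
      also have "\<dots> < 1" using C by simp
      finally show False by simp
    qed
    thus ?thesis by (intro bdd_aboveI)
  qed
  have \<alpha>0: "0 \<le> \<alpha>" unfolding \<alpha>_def using \<open>0 \<in> T\<close> bdd by (rule cSup_upper)
  \<comment> \<open>Were the radius below 1, some path sum would be below 1 at \<alpha>, hence also
    at nearby exponents. Some of these belong to \<open>T\<close>, which contradicts
    \<open>T_total\<close>.\<close>
  have ge: "1 \<le> radius \<alpha>"
  proof (rule ccontr)
    assume "\<not> ?thesis"
    hence "radius \<alpha> < 1" by simp
    from order_tendstoD(2)[OF total_tendsto_0[OF this], of 1]
    obtain q where q: "(\<Sum>i<n. \<Sum>j<n. entry_power n (weight \<alpha>) q i j) < 1"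
      using eventually_happens[of _ sequentially] by auto
    have "continuous_on UNIV (\<lambda>s. \<Sum>i<n. \<Sum>j<n. entry_power n (weight s) q i j)"
      by (intro continuous_on_sum continuous_entry_power)
    hence "isCont (\<lambda>s. \<Sum>i<n. \<Sum>j<n. entry_power n (weight s) q i j) \<alpha>"
      by (simp add: continuous_on_eq_continuous_at)
    hence "((\<lambda>s. \<Sum>i<n. \<Sum>j<n. entry_power n (weight s) q i j) \<longlongrightarrow>
        (\<Sum>i<n. \<Sum>j<n. entry_power n (weight \<alpha>) q i j)) (at \<alpha>)" by (simp add: isCont_def)
    from order_tendstoD(2)[OF this q] obtain \<delta> where \<delta>: "0 < \<delta>"
      "\<And>s. s \<noteq> \<alpha> \<Longrightarrow> dist s \<alpha> < \<delta> \<Longrightarrow> (\<Sum>i<n. \<Sum>j<n. entry_power n (weight s) q i j) < 1"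
      unfolding eventually_at by auto
    obtain s where s: "s \<in> T" "\<alpha> - \<delta> < s"
      using less_cSupE[of "\<alpha> - \<delta>" T] \<open>0 \<in> T\<close> \<delta>(1) unfolding \<alpha>_def by auto
    have "s \<le> \<alpha>" unfolding \<alpha>_def using s(1) bdd by (rule cSup_upper)
    hence "(\<Sum>i<n. \<Sum>j<n. entry_power n (weight s) q i j) < 1"
      using q \<delta>(2)[of s] s(2) by (cases "s = \<alpha>") (auto simp: dist_real_def)
    thus False using T_total[OF s(1), of q] by simp
  qed
  have le: "radius \<alpha> \<le> 1"
  proof (rule ccontr)
    assume "\<not> ?thesis"
    hence c: "1 < radius \<alpha>" by simp
    \<comment> \<open>Chosen to solve \<open>\<eta> powr t * radius \<alpha> = 1\<close>: raising
      the exponent by \<open>t\<close> shrinks no entry by more than \<open>\<eta> powr t\<close>,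
      so \<open>\<alpha> + t\<close> would still belong to \<open>T\<close>.\<close>
    define t where "t = ln (radius \<alpha>) / (- ln \<eta>)"
    have t: "0 < t" unfolding t_def by (rule divide_pos_pos) (use c k in auto)
    have \<eta>t: "\<eta> powr t = 1 / radius \<alpha>"
    proof -
      have "t * ln \<eta> = - ln (radius \<alpha>)" using k by (simp add: t_def field_simps)
      thus ?thesis using k c by (simp add: powr_def exp_minus inverse_eq_divide)
    qed
    have "subinvariant n (weight (\<alpha> + t)) (\<eta> powr t * radius \<alpha>)"
    proof (rule subinvariant_scale)
      show "subinvariant n (weight \<alpha>) (radius \<alpha>)"
        by (rule subinvariant_spectral_radius[OF weight_nonneg n])
      fix i j assume ij: "i < n" "j < n"
      have "\<eta> powr (\<alpha> + t - \<alpha>) * weight \<alpha> i j \<le> weight (\<alpha> + t) i j"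
        by (rule weight_compare(1)[of _ _ _ _ _ \<kappa>]) (use t k(1) k(5)[OF ij] in auto)
      thus "\<eta> powr t * weight \<alpha> i j \<le> weight (\<alpha> + t) i j" by simp
    qed simp
    hence "subinvariant n (weight (\<alpha> + t)) 1" using \<eta>t c by simp
    hence "\<alpha> + t \<in> T" using radius_ge[of 1 "\<alpha> + t"] \<alpha>0 t by (simp add: T_def)
    hence "\<alpha> + t \<le> \<alpha>" unfolding \<alpha>_def using bdd by (rule cSup_upper)
    thus False using t by simp
  qed
  show ?thesis
  proof (rule that[of \<alpha>])
    show "\<beta> = \<alpha>" if "radius \<beta> = 1" for \<beta>
      using radius_strict_decreasing[of \<alpha> \<beta>] radius_strict_decreasing[of \<beta> \<alpha>] that ge le
      by (cases \<beta> \<alpha> rule: linorder_cases) auto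
    show "(\<lambda>q. \<Sum>i<n. \<Sum>j<n. entry_power n (weight s) q i j) \<longlonglongrightarrow> 0" if "\<alpha> < s" for s
    proof (rule total_tendsto_0)
      have "s \<notin> T" using that cSup_upper[OF _ bdd, of s] by (auto simp: \<alpha>_def)
      thus "radius s < 1" using that \<alpha>0 by (auto simp: T_def)
    qed
    show "\<exists>i q. i < n \<and> 1 \<le> q \<and> 1 < entry_power n (weight s) q i i" if "s < \<alpha>" for s
      by (rule subinvariant_diagonal_gt_1[OF weight_nonneg radius_strict_decreasing[OF that ge]
            subinvariant_spectral_radius[OF weight_nonneg n]])
  qed (use \<alpha>0 ge le in auto)
qed

end

section \<open>Graph-directed systems of similitudes\<close>

definition path_ratio :: "('e \<Rightarrow> real) \<Rightarrow> 'e list \<Rightarrow> real" where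
  "path_ratio \<rho> es = (\<Prod>e\<leftarrow>es. \<rho> e)"

lemma path_ratio_simps [simp]:
  "path_ratio \<rho> [] = 1" "path_ratio \<rho> (e # es) = \<rho> e * path_ratio \<rho> es"
  by (simp_all add: path_ratio_def)

lemma path_map_simps [simp]:
  "path_map G [] x = x" "path_map G (e # es) x = map_of_edge G e (path_map G es x)"
  by (simp_all add: path_map_def)

lemma path_map_append: "path_map G (es @ fs) x = path_map G es (path_map G fs x)"
  by (induction es) auto

lemma path_map_concat: "path_map G (concat ess) x = foldr (path_map G) ess x"
  by (induction ess) (auto simp: path_map_append)

lemma edges_between_iff:
  "e \<in> edges_between G i j \<longleftrightarrow> e \<in> edges G \<and> tail (graph G) e = i \<and> head (graph G) e = j"
  by (simp add: edges_between_def)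

lemma paths_iff:
  "es \<in> paths G q i j \<longleftrightarrow> i \<in> verts (graph G) \<and> set es \<subseteq> edges G \<and> pre_digraph.cas (graph G) i es j \<and> length es = q"
  by (auto simp: paths_def pre_digraph.awalk_def)

lemma paths_0: "i \<in> verts (graph G) \<Longrightarrow> paths G 0 i j = (if i = j then {[]} else {})"
  by (auto simp: paths_iff pre_digraph.cas.simps)

lemma paths_Suc:
  assumes "fin_digraph (graph G)" "i \<in> verts (graph G)"
  shows "paths G (Suc q) i j =
    (\<Union>k\<in>verts (graph G). (\<lambda>(e, es). e # es) ` (edges_between G i k \<times> paths G q k j))"
proof (intro equalityI subsetI)
  interpret fin_digraph "graph G" by fact
  fix es assume es: "es \<in> paths G (Suc q) i j"
  then obtain e es' where "es = e # es'" by (cases es) (auto simp: paths_iff)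
  with es have "e \<in> edges_between G i (head (graph G) e)" "es' \<in> paths G q (head (graph G) e) j"
    "head (graph G) e \<in> verts (graph G)"
    by (auto simp: paths_iff edges_between_iff)
  with \<open>es = e # es'\<close> show "es \<in> (\<Union>k\<in>verts (graph G). (\<lambda>(e, es). e # es) ` (edges_between G i k \<times> paths G q k j))"
    by (intro UN_I[of "head (graph G) e"] image_eqI[of _ _ "(e, es')"]) auto
next
  fix es assume "es \<in> (\<Union>k\<in>verts (graph G). (\<lambda>(e, es). e # es) ` (edges_between G i k \<times> paths G q k j))"
  then obtain k e es' where "es = e # es'" "e \<in> edges_between G i k" "es' \<in> paths G q k j" by auto
  thus "es \<in> paths G (Suc q) i j"
    using assms(2) by (auto simp: paths_iff edges_between_iff pre_digraph.cas.simps)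
qed

lemma cas_append:
  "pre_digraph.cas D i es k \<Longrightarrow> pre_digraph.cas D k fs j \<Longrightarrow> pre_digraph.cas D i (es @ fs) j"
  by (induction es arbitrary: i) (auto simp: pre_digraph.cas.simps)

lemma paths_append:
  "es \<in> paths G p i k \<Longrightarrow> fs \<in> paths G q k j \<Longrightarrow> es @ fs \<in> paths G (p + q) i j"
  using cas_append[of "graph G" i es k fs j] by (simp add: paths_iff)

lemma paths_concat:
  assumes "i \<in> verts (graph G)" "set ess \<subseteq> paths G q i i"
  shows "concat ess \<in> paths G (q * length ess) i i"
  using assms(2)
proof (induction ess)
  case Nil
  thus ?case using assms(1) by (simp add: paths_0)
next
  case (Cons es ess)
  thus ?case using paths_append[of es G q i i "concat ess" "q * length ess" i] by simp
qed

lemma finite_paths: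
  assumes "fin_digraph (graph G)"
  shows "finite (paths G q i j)"
proof (rule finite_subset)
  show "paths G q i j \<subseteq> {es. set es \<subseteq> edges G \<and> length es = q}" by (auto simp: paths_iff)
  show "finite {es. set es \<subseteq> edges G \<and> length es = q}"
    using fin_digraph.finite_arcs[OF assms] by (rule finite_lists_length_eq)
qed

lemma path_ratio_pos: "(\<And>e. e \<in> set es \<Longrightarrow> 0 < \<rho> e) \<Longrightarrow> 0 < path_ratio \<rho> es"
  by (induction es) auto

lemma path_ratio_count:
  assumes "finite S" "set es \<subseteq> S"
  shows "path_ratio \<rho> es = (\<Prod>e\<in>S. \<rho> e ^ count_list es e)"
  using assms(2)
proof (induction es)
  case (Cons e es)
  have "(\<Prod>x\<in>S. \<rho> x ^ count_list (e # es) x) = (\<Prod>x\<in>S. (if x = e then \<rho> x else 1) * \<rho> x ^ count_list es x)"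
    by (intro prod.cong) auto
  also have "\<dots> = (\<Prod>x\<in>S. if x = e then \<rho> x else 1) * path_ratio \<rho> es"
    using Cons by (simp add: prod.distrib)
  also have "(\<Prod>x\<in>S. if x = e then \<rho> x else 1) = \<rho> e"
    using Cons(2) assms(1) by (simp add: prod.delta)
  finally show ?case by simp
qed simp

text \<open>By commutativity a ratio depends only on how often each edge occurs, a number between 0
  and \<open>q\<close>.\<close>

lemma card_path_ratios:
  assumes G: "fin_digraph (graph G)"
  shows "card (path_ratio \<rho> ` paths G q i j) \<le> (q + 1) ^ card (edges G)"
proof -
  have fin: "finite (edges G)" using fin_digraph.finite_arcs[OF G] .
  let ?P = "PiE (edges G) (\<lambda>_. {0..q})"
  have "path_ratio \<rho> ` paths G q i j \<subseteq> (\<lambda>m. \<Prod>e\<in>edges G. \<rho> e ^ m e) ` ?P"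
  proof (rule image_subsetI)
    fix es assume es: "es \<in> paths G q i j"
    hence "path_ratio \<rho> es = (\<Prod>e\<in>edges G. \<rho> e ^ restrict (count_list es) (edges G) e)"
      using path_ratio_count[OF fin, of es \<rho>] by (auto simp: paths_iff cong: prod.cong)
    moreover have "restrict (count_list es) (edges G) \<in> ?P"
      using es count_le_length[of es] by (auto simp: paths_iff)
    ultimately show "path_ratio \<rho> es \<in> (\<lambda>m. \<Prod>e\<in>edges G. \<rho> e ^ m e) ` ?P" by blast
  qed
  hence "card (path_ratio \<rho> ` paths G q i j) \<le> card ?P"
    using fin by (intro surj_card_le finite_PiE) auto
  also have "\<dots> = (q + 1) ^ card (edges G)" using fin by (simp add: card_PiE)
  finally show ?thesis .
qed

text \<open>With \<open>x\<close> the root of \<open>b\<close> of order \<open>k + 1\<close>, it is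
  enough that \<open>x ^ m\<close> outgrows a linear function. Using \<open>k + 1\<close> instead of
  \<open>k\<close> includes the case \<open>k = 0\<close>.\<close>

lemma exp_beats_poly:
  fixes b :: real and q k :: nat
  assumes b: "1 < b"
  obtains m where "1 \<le> m" "real ((q * m + 1) ^ k) < b ^ m"
proof -
  define x where "x = root (Suc k) b"
  have x: "1 < x" using b by (simp add: x_def)
  have xb: "x ^ Suc k = b" unfolding x_def by (rule real_root_pow_pos2) (use b in auto)
  have "(\<lambda>m. real (q + 1) * (real m / x ^ m)) \<longlonglongrightarrow> real (q + 1) * 0"
    using x by (intro tendsto_mult tendsto_const lim_n_over_pown) auto
  hence "eventually (\<lambda>m. real (q + 1) * (real m / x ^ m) < 1) sequentially"
    by (intro order_tendstoD(2)) auto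
  hence "eventually (\<lambda>m. 1 \<le> m \<and> real (q + 1) * (real m / x ^ m) < 1) sequentially"
    using eventually_ge_at_top[of 1] by eventually_elim auto
  from eventually_happens[OF this] obtain m where m: "1 \<le> m" "real (q + 1) * (real m / x ^ m) < 1"
    by auto
  have "real (q * m + 1) \<le> real (q + 1) * real m" using m(1) by (simp add: algebra_simps)
  also have "\<dots> < x ^ m" using m(2) x by (simp add: pos_divide_less_eq)
  finally have lt: "real (q * m + 1) < x ^ m" .
  have "real ((q * m + 1) ^ k) \<le> real (q * m + 1) ^ Suc k"
    unfolding of_nat_power by (rule power_increasing) auto
  also have "\<dots> < (x ^ m) ^ Suc k" using lt by (intro power_strict_mono) auto
  also have "\<dots> = b ^ m" unfolding xb[symmetric] power_mult[symmetric] by (simp only: mult.commute)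
  finally show ?thesis using that m(1) by blast
qed

section \<open>Paths of a graph weighted by their ratios\<close>

locale weighted_gifs =
  fixes G :: "('a, 'e) gifs" and n :: nat and \<rho> :: "'e \<Rightarrow> real"
  assumes fin_digraph: "fin_digraph (graph G)"
    and verts: "verts (graph G) = {1..n}" and n: "0 < n"
    and ratio: "e \<in> edges G \<Longrightarrow> 0 < \<rho> e \<and> \<rho> e < 1"

sublocale weighted_gifs \<subseteq> edge_weights n "\<lambda>i j. edges_between G (Suc i) (Suc j)" \<rho>
proof
  show "finite (edges_between G (Suc i) (Suc j))" for i j
    using fin_digraph.finite_arcs[OF fin_digraph] by (simp add: edges_between_def)
qed (use n ratio in \<open>auto simp: edges_between_iff\<close>)

context weighted_gifs begin

lemma path_ratio_pos': "es \<in> paths G q i j \<Longrightarrow> 0 < path_ratio \<rho> es"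
  using ratio by (intro path_ratio_pos) (auto simp: paths_iff)

lemma path_ratio_less_1: "es \<in> paths G q i j \<Longrightarrow> 1 \<le> q \<Longrightarrow> path_ratio \<rho> es < 1"
proof -
  have le: "set es \<subseteq> edges G \<Longrightarrow> 0 < path_ratio \<rho> es \<and> path_ratio \<rho> es \<le> 1" for es
    
  proof (induction es)
    case (Cons e es)
    thus ?case using ratio[of e] mult_mono[of "\<rho> e" 1 "path_ratio \<rho> es" 1] by simp
  qed simp
  assume "es \<in> paths G q i j" "1 \<le> q"
  then obtain e fs where "es = e # fs" "e \<in> edges G" "set fs \<subseteq> edges G"
    by (cases es) (auto simp: paths_iff)
  moreover from this have "\<rho> e * path_ratio \<rho> fs \<le> \<rho> e * 1"
    using ratio[of e] le[of fs] by (intro mult_left_mono) auto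
  moreover have "\<rho> e < 1" using ratio[of e] \<open>e \<in> edges G\<close> by simp
  ultimately have "\<rho> e * path_ratio \<rho> fs < 1" by linarith
  thus ?thesis by (simp add: \<open>es = e # fs\<close>)
qed

lemma path_sum:
  assumes "i < n" "j < n"
  shows "(\<Sum>es\<in>paths G q (Suc i) (Suc j). path_ratio \<rho> es powr s) = entry_power n (weight s) q i j"
  using assms(1)
proof (induction q arbitrary: i)
  case 0
  thus ?case using assms by (simp add: paths_0 verts)
next
  case (Suc q)
  let ?F = "\<lambda>k. (\<lambda>(e, es). e # es) ` (edges_between G (Suc i) (Suc k) \<times> paths G q (Suc k) (Suc j))"
  have fin: "finite (edges_between G (Suc i) (Suc k) \<times> paths G q (Suc k) (Suc j))" for k
    using finite_E finite_paths[OF fin_digraph] by blast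
  have v: "verts (graph G) = Suc ` {..<n}" unfolding verts by (simp add: image_Suc_lessThan)
  have "(\<Sum>es\<in>paths G (Suc q) (Suc i) (Suc j). path_ratio \<rho> es powr s) =
      (\<Sum>es\<in>(\<Union>k<n. ?F k). path_ratio \<rho> es powr s)"
    using Suc(2) by (subst paths_Suc[OF fin_digraph]) (auto simp: v)
  also have "\<dots> = (\<Sum>k<n. \<Sum>es\<in>?F k. path_ratio \<rho> es powr s)"
    using fin by (intro sum.UNION_disjoint) (auto simp: edges_between_iff)
  also have "\<dots> = (\<Sum>k<n. weight s i k * entry_power n (weight s) q k j)"
  proof (rule sum.cong[OF refl])
    fix k assume k: "k \<in> {..<n}"
    have "(\<Sum>es\<in>?F k. path_ratio \<rho> es powr s) =
      (\<Sum>p\<in>edges_between G (Suc i) (Suc k) \<times> paths G q (Suc k) (Suc j). path_ratio \<rho> (fst p # snd p) powr s)"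
      by (subst sum.reindex) (auto simp: inj_on_def case_prod_unfold)
    also have "\<dots> = (\<Sum>p\<in>edges_between G (Suc i) (Suc k) \<times> paths G q (Suc k) (Suc j).
        \<rho> (fst p) powr s * path_ratio \<rho> (snd p) powr s)"
      by (simp add: powr_mult)
    also have "\<dots> = weight s i k * (\<Sum>es\<in>paths G q (Suc k) (Suc j). path_ratio \<rho> es powr s)"
      unfolding weight_def sum_product sum.cartesian_product by (simp add: case_prod_unfold)
    finally show "(\<Sum>es\<in>?F k. path_ratio \<rho> es powr s) = weight s i k * entry_power n (weight s) q k j"
      using Suc.IH k by simp
  qed
  finally show ?case by simp
qed

text \<open>There are only polynomially many ratios of loops of a given length, so among exponentially much
  weight one of them must carry enough.\<close>

lemma homogeneous_loops:
  assumes i: "i < n" and q: "1 \<le> q" and gt: "1 < entry_power n (weight s) q i i"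
  obtains Q L c where "1 \<le> Q" "L \<subseteq> paths G Q (Suc i) (Suc i)" "\<And>es. es \<in> L \<Longrightarrow> path_ratio \<rho> es = c"
    "0 < c" "c < 1" "1 \<le> real (card L) * c powr s"
proof -
  obtain m where m: "1 \<le> m" "real ((q * m + 1) ^ card (edges G)) < entry_power n (weight s) q i i ^ m"
    using exp_beats_poly[OF gt, of q "card (edges G)"] by metis
  define Q where "Q = q * m"
  define P where "P = paths G Q (Suc i) (Suc i)"
  have finP: "finite P" unfolding P_def by (rule finite_paths[OF fin_digraph])
  define L where "L c = {es \<in> P. path_ratio \<rho> es = c}" for c
  have "\<exists>c\<in>path_ratio \<rho> ` P. 1 \<le> real (card (L c)) * c powr s"
  proof (rule ccontr)
    assume "\<not> ?thesis"
    hence small: "real (card (L c)) * c powr s \<le> 1" if "c \<in> path_ratio \<rho> ` P" for c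
      using that by (auto simp: not_le less_imp_le)
    have "real ((Q + 1) ^ card (edges G)) < entry_power n (weight s) Q i i"
      using m(2) entry_power_iterate_le[of "weight s" i n q m, OF weight_nonneg i] by (simp add: Q_def)
    also have "\<dots> = (\<Sum>es\<in>P. path_ratio \<rho> es powr s)" unfolding P_def path_sum[OF i i] ..
    also have "\<dots> = (\<Sum>c\<in>path_ratio \<rho> ` P. \<Sum>es\<in>L c. path_ratio \<rho> es powr s)"
      unfolding L_def by (rule sum.image_gen[OF finP])
    also have "\<dots> = (\<Sum>c\<in>path_ratio \<rho> ` P. real (card (L c)) * c powr s)"
    proof (rule sum.cong[OF refl])
      fix c
      have "(\<Sum>es\<in>L c. path_ratio \<rho> es powr s) = (\<Sum>es\<in>L c. c powr s)"
        by (intro sum.cong) (auto simp: L_def)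
      thus "(\<Sum>es\<in>L c. path_ratio \<rho> es powr s) = real (card (L c)) * c powr s" by simp
    qed
    also have "\<dots> \<le> (\<Sum>c\<in>path_ratio \<rho> ` P. 1)" using small by (intro sum_mono) auto
    also have "\<dots> = real (card (path_ratio \<rho> ` P))" by simp
    also have "\<dots> \<le> real ((Q + 1) ^ card (edges G))"
      unfolding P_def using card_path_ratios[OF fin_digraph] by (rule of_nat_mono)
    finally show False by simp
  qed
  then obtain c where c: "c \<in> path_ratio \<rho> ` P" "1 \<le> real (card (L c)) * c powr s" by blast
  have Q: "1 \<le> Q" using q m(1) by (simp add: Q_def)
  have "0 < c" "c < 1" using c(1) path_ratio_pos' path_ratio_less_1[OF _ Q] by (auto simp: P_def)
  show ?thesis
  proof (rule that[of Q "L c" c])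
    show "L c \<subseteq> paths G Q (Suc i) (Suc i)" by (auto simp: L_def P_def)
    show "path_ratio \<rho> es = c" if "es \<in> L c" for es using that by (simp add: L_def)
  qed fact+
qed

end

section \<open>Cells of a graph-directed system and their attractor\<close>

lemma (in locally_euclidean_space) nonexpansive_continuous_on:
  assumes "\<And>x y. x \<in> S \<Longrightarrow> y \<in> S \<Longrightarrow> d (f x) (f y) \<le> d x y"
  shows "continuous_on S f"
  unfolding continuous_on_topological
proof (intro ballI allI impI)
  fix x B assume x: "x \<in> S" and B: "open B" "f x \<in> B"
  obtain e where e: "e > 0" "{y. d (f x) y < e} \<subseteq> B" using open_contains_dball[OF B] by metis
  have "f y \<in> B" if "y \<in> S" "d x y < e" for y
    using assms[OF x that(1)] that(2) e(2) by auto
  thus "\<exists>A. open A \<and> x \<in> A \<and> (\<forall>y\<in>S. y \<in> A \<longrightarrow> f y \<in> B)"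
    using open_dball[of x e] e(1) by (intro exI[of _ "{y. d x y < e}"]) simp
qed

lemma path_map_invariant:
  assumes G: "fin_digraph (graph G)" and U: "invariant_family G U"
    and es: "es \<in> paths G q i j" and x: "x \<in> U j"
  shows "path_map G es x \<in> U i"
  using es
proof (induction es arbitrary: i q)
  case Nil
  thus ?case using x by (simp add: paths_iff pre_digraph.cas.simps)
next
  case (Cons e es)
  interpret fin_digraph "graph G" by (fact G)
  have e: "e \<in> edges_between G i (head (graph G) e)" "es \<in> paths G (q - 1) (head (graph G) e) j"
    "i \<in> verts (graph G)" "head (graph G) e \<in> verts (graph G)"
    using Cons.prems by (auto simp: paths_iff edges_between_iff)
  have "map_of_edge G e ` U (head (graph G) e) \<subseteq> U i"
    using U e unfolding invariant_family_def by blast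
  thus ?case using Cons.IH[OF e(2)] by auto
qed

text \<open>Of the relation system there remain the inclusions between \<open>K\<close> and the
  levels. \<open>K_superset\<close> speaks of the multiples of one length because repeating a loop
  of length \<open>q\<close> yields points of just these levels.\<close>

locale similitude_gifs = locally_euclidean_space d + weighted_gifs G n \<rho>
  for d :: "'a::t2_space \<Rightarrow> 'a \<Rightarrow> real" and G :: "('a, 'e) gifs" and n :: nat and \<rho> :: "'e \<Rightarrow> real" +
  fixes W :: "nat \<Rightarrow> 'a set" and K :: "'a set"
  assumes domains: "invariant_family G (domain_of G)"
    and similitude: "e \<in> edges G \<Longrightarrow> x \<in> domain_of G (head (graph G) e) \<Longrightarrow>
      y \<in> domain_of G (head (graph G) e) \<Longrightarrow>
      d (map_of_edge G e x) (map_of_edge G e y) = \<rho> e * d x y"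
    and W_invariant: "invariant_family G W"
    and W_compact: "j \<in> verts (graph G) \<Longrightarrow> compact (W j)"
    and W_nonempty: "j \<in> verts (graph G) \<Longrightarrow> W j \<noteq> {}"
    and K_compact: "compact K"
    and K_subset: "1 \<le> q \<Longrightarrow> K \<subseteq> gifs_level G W q"
    and K_superset: "1 \<le> q \<Longrightarrow> (\<Inter>m\<in>{1..}. gifs_level G W (q * m)) \<subseteq> K"
    and level_nonempty: "1 \<le> q \<Longrightarrow> gifs_level G W q \<noteq> {}"
begin

lemma path_verts: "es \<in> paths G q i j \<Longrightarrow> i \<in> verts (graph G)" "es \<in> paths G q i j \<Longrightarrow> j \<in> verts (graph G)"
proof -
  show "i \<in> verts (graph G)" if "es \<in> paths G q i j" using that by (simp add: paths_iff)
  interpret fin_digraph "graph G" by (rule fin_digraph)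
  show "j \<in> verts (graph G)" if "es \<in> paths G q i j"
    using that
  proof (induction es arbitrary: i q)
    case (Cons e es)
    hence "es \<in> paths G (q - 1) (head (graph G) e) j" by (auto simp: paths_iff)
    thus ?case by (rule Cons.IH)
  qed (simp add: paths_iff)
qed

lemma W_domain: "j \<in> verts (graph G) \<Longrightarrow> W j \<subseteq> domain_of G j"
  using W_invariant by (simp add: invariant_family_def)

lemma path_similitude:
  assumes es: "es \<in> paths G q i j" and x: "x \<in> domain_of G j" and y: "y \<in> domain_of G j"
  shows "d (path_map G es x) (path_map G es y) = path_ratio \<rho> es * d x y"
  using es
proof (induction es arbitrary: i q)
  case (Cons e es)
  interpret fin_digraph "graph G" by (rule fin_digraph)
  have e: "e \<in> edges G" "es \<in> paths G (q - 1) (head (graph G) e) j"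
    using Cons.prems by (auto simp: paths_iff)
  have "path_map G es x \<in> domain_of G (head (graph G) e)" "path_map G es y \<in> domain_of G (head (graph G) e)"
    using path_map_invariant[OF fin_digraph domains e(2)] x y by blast+
  thus ?case using Cons.IH[OF e(2)] similitude[OF e(1)] by simp
qed simp

text \<open>Two paths of equal length from one vertex first differ in edges that leave a common
  vertex, where \<open>disj\<close> applies. The common initial part preserves disjointness since
  similitudes with positive ratio are injective.\<close>

lemma path_disjoint:
  assumes U: "\<And>j. j \<in> verts (graph G) \<Longrightarrow> U j \<subseteq> domain_of G j" "invariant_family G U"
    and disj: "\<And>i j1 j2 e e'. e \<in> edges_between G i j1 \<Longrightarrow> e' \<in> edges_between G i j2 \<Longrightarrow> e \<noteq> e' \<Longrightarrow>
      map_of_edge G e ` U j1 \<inter> map_of_edge G e' ` U j2 = {}"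
    and "es \<in> paths G q i j" "es' \<in> paths G q i j'" "es \<noteq> es'"
  shows "path_map G es ` U j \<inter> path_map G es' ` U j' = {}"
  using assms(4-)
proof (induction q arbitrary: i es es')
  case 0
  thus ?case by (simp add: paths_iff)
next
  case (Suc q)
  interpret fin_digraph "graph G" by (rule fin_digraph)
  obtain e fs where es: "es = e # fs" using Suc.prems(1) by (cases es) (auto simp: paths_iff)
  obtain e' fs' where es': "es' = e' # fs'" using Suc.prems(2) by (cases es') (auto simp: paths_iff)
  let ?k = "head (graph G) e" and ?k' = "head (graph G) e'"
  have e: "e \<in> edges_between G i ?k" "e' \<in> edges_between G i ?k'" "e \<in> edges G"
    and fs: "fs \<in> paths G q ?k j" "fs' \<in> paths G q ?k' j'"
    using Suc.prems(1,2) unfolding es es' by (auto simp: paths_iff edges_between_iff)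
  have inU: "path_map G fs ` U j \<subseteq> U ?k" "path_map G fs' ` U j' \<subseteq> U ?k'"
    using path_map_invariant[OF fin_digraph U(2)] fs by blast+
  show ?case
  proof (cases "e = e'")
    case False
    have "path_map G es ` U j \<subseteq> map_of_edge G e ` U ?k" "path_map G es' ` U j' \<subseteq> map_of_edge G e' ` U ?k'"
      using inU unfolding es es' by auto
    thus ?thesis using disj[OF e(1,2) False] by blast
  next
    case True
    have IH: "path_map G fs ` U j \<inter> path_map G fs' ` U j' = {}"
      using Suc.IH[OF fs(1), of fs'] fs(2) Suc.prems(3) True by (simp add: es es')
    show ?thesis
    proof (rule ccontr)
      assume "\<not> ?thesis"
      then obtain x y where xy: "x \<in> U j" "y \<in> U j'"
        "map_of_edge G e (path_map G fs x) = map_of_edge G e (path_map G fs' y)"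
        using True unfolding es es' by auto
      have "path_map G fs x \<in> U ?k" "path_map G fs' y \<in> U ?k" using inU xy True by auto
      hence "path_map G fs x \<in> domain_of G ?k" "path_map G fs' y \<in> domain_of G ?k"
        using U(1)[of ?k] e(3) by auto
      from similitude[OF e(3) this] xy(3) have "d (path_map G fs x) (path_map G fs' y) = 0"
        using ratio[OF e(3)] by simp
      hence "path_map G fs x = path_map G fs' y" by (simp add: eq_0_iff)
      thus False using IH xy by blast
    qed
  qed
qed

text \<open>The images of \<open>W i\<close> under repetitions of the loop are nonempty, compact and
  decreasing. A common point lies in the levels of all lengths \<open>q * m\<close>, hence in
  \<open>K\<close>.\<close>

lemma loop_meets_K:
  assumes es: "es \<in> paths G q i i" and q: "1 \<le> q"
  shows "path_map G es ` W i \<inter> K \<noteq> {}"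
proof -
  have i: "i \<in> verts (graph G)" using path_verts es by blast
  define F where "F m = path_map G (concat (replicate m es))" for m
  have rep: "concat (replicate m es) \<in> paths G (q * m) i i" for m
  proof -
    have "set (replicate m es) \<subseteq> paths G q i i" using es by auto
    from paths_concat[OF i this] show ?thesis by simp
  qed
  have F_Suc: "F (m + k) x = F m (F k x)" for m k x
    by (simp add: F_def replicate_add path_map_append)
  have FW: "F m ` W i \<subseteq> W i" for m
    unfolding F_def using path_map_invariant[OF fin_digraph W_invariant rep] by blast
  have comp: "compact (F m ` W i)" for m
  proof (rule compact_continuous_image[OF nonexpansive_continuous_on W_compact[OF i]])
    fix x y assume "x \<in> W i" "y \<in> W i"
    hence "d (F m x) (F m y) = path_ratio \<rho> (concat (replicate m es)) * d x y"
      unfolding F_def using path_similitude[OF rep] W_domain[OF i] by blast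
    also have "\<dots> \<le> 1 * d x y"
    proof (rule mult_right_mono[OF _ nonneg])
      show "path_ratio \<rho> (concat (replicate m es)) \<le> 1"
      proof (cases m)
        case (Suc m')
        thus ?thesis using path_ratio_less_1[OF rep[of m]] q by simp
      qed simp
    qed
    finally show "d (F m x) (F m y) \<le> d x y" by simp
  qed
  \<comment> \<open>The finite intersection property is applied inside the image under
    \<open>F 1\<close>, so that the common point also belongs to the cell of \<open>es\<close>
    itself.\<close>
  have "F 1 ` W i \<inter> (\<Inter>m\<in>{1..}. F m ` W i) \<noteq> {}"
  proof (rule compact_imp_fip_image[OF comp])
    show "closed (F m ` W i)" for m by (rule compact_imp_closed[OF comp])
    fix I :: "nat set" assume I: "finite I" "I \<subseteq> {1..}"
    define M where "M = Max (insert 1 I)"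
    have M: "m \<le> M" if "m \<in> insert 1 I" for m unfolding M_def using I that by (intro Max_ge) auto
    have "F M ` W i \<subseteq> F m ` W i" if "m \<in> insert 1 I" for m
    proof -
      have "F M x = F m (F (M - m) x)" for x using F_Suc[of m "M - m" x] M[OF that] by simp
      thus ?thesis using FW[of "M - m"] by auto
    qed
    note sub = this
    have "F M ` W i \<noteq> {}" using W_nonempty[OF i] by simp
    then obtain x where x: "x \<in> F M ` W i" by blast
    have "x \<in> F m ` W i" if "m \<in> insert 1 I" for m using sub[OF that] x by (rule subsetD)
    hence "x \<in> F 1 ` W i \<inter> (\<Inter>m\<in>I. F m ` W i)" by simp
    thus "F 1 ` W i \<inter> (\<Inter>m\<in>I. F m ` W i) \<noteq> {}" by blast
  qed
  then obtain x where x: "x \<in> F 1 ` W i" "\<And>m. 1 \<le> m \<Longrightarrow> x \<in> F m ` W i" by auto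
  have "x \<in> gifs_level G W (q * m)" if "1 \<le> m" for m
    using x(2)[OF that] rep[of m] i unfolding gifs_level_def F_def by blast
  hence "x \<in> K" using K_superset[OF q] by blast
  thus ?thesis using x(1) by (auto simp: F_def)
qed

lemma total_weight:
  "(\<Sum>i<n. \<Sum>j<n. entry_power n (weight s) q i j) =
    (\<Sum>(i, j, es)\<in>(SIGMA i:verts (graph G). SIGMA j:verts (graph G). paths G q i j). path_ratio \<rho> es powr s)"
proof -
  have v: "verts (graph G) = Suc ` {..<n}" unfolding verts by (simp add: image_Suc_lessThan)
  have "(\<Sum>i<n. \<Sum>j<n. entry_power n (weight s) q i j) =
      (\<Sum>i<n. \<Sum>j<n. \<Sum>es\<in>paths G q (Suc i) (Suc j). path_ratio \<rho> es powr s)"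
    by (intro sum.cong refl) (simp add: path_sum)
  also have "\<dots> = (\<Sum>i\<in>verts (graph G). \<Sum>j\<in>verts (graph G). \<Sum>es\<in>paths G q i j. path_ratio \<rho> es powr s)"
    unfolding v by (simp add: sum.reindex)
  also have "\<dots> = (\<Sum>i\<in>verts (graph G). \<Sum>(j, es)\<in>(SIGMA j:verts (graph G). paths G q i j). path_ratio \<rho> es powr s)"
    using finite_paths[OF fin_digraph] by (intro sum.cong refl sum.Sigma) (auto simp: verts)
  also have "\<dots> = (\<Sum>(i, j, es)\<in>(SIGMA i:verts (graph G). SIGMA j:verts (graph G). paths G q i j).
      path_ratio \<rho> es powr s)"
    using finite_paths[OF fin_digraph] by (subst sum.Sigma) (auto simp: verts case_prod_unfold)
  finally show ?thesis .
qed

lemma hausdorff_measure_0: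
  assumes s: "0 < s" and lim: "(\<lambda>q. \<Sum>i<n. \<Sum>j<n. entry_power n (weight s) q i j) \<longlonglongrightarrow> 0"
  shows "hausdorff_measure d s K = 0"
proof (rule hausdorff_measure_eq_0I[OF s])
  fix \<delta> \<epsilon> :: real assume \<delta>: "0 < \<delta>" and \<epsilon>: "0 < \<epsilon>"
  have "\<exists>D>0. \<forall>x\<in>W j. \<forall>y\<in>W j. d x y \<le> D" if j: "j \<in> verts (graph G)" for j
  proof -
    obtain w where w: "w \<in> W j" using W_nonempty[OF j] by blast
    obtain D where D: "D > 0" "\<And>x. x \<in> W j \<Longrightarrow> d w x \<le> D" using compact_dist_bounded[OF W_compact[OF j]] by metis
    have "d x y \<le> 2 * D" if "x \<in> W j" "y \<in> W j" for x y
      using triangle[of x y w] D(2)[OF that(1)] D(2)[OF that(2)] commute[of x w] by simp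
    thus ?thesis using D(1) by (intro exI[of _ "2 * D"]) simp
  qed
  hence "\<forall>j\<in>verts (graph G). \<exists>D>0. \<forall>x\<in>W j. \<forall>y\<in>W j. d x y \<le> D" ..
  from bchoice[OF this] obtain Dj where
    Dj: "\<forall>j\<in>verts (graph G). 0 < Dj j \<and> (\<forall>x\<in>W j. \<forall>y\<in>W j. d x y \<le> Dj j)" by auto
  define D where "D = (\<Sum>j\<in>verts (graph G). Dj j)"
  have DjD: "Dj j \<le> D" if "j \<in> verts (graph G)" for j
    unfolding D_def using Dj that by (intro member_le_sum) (auto simp: verts less_imp_le)
  have D: "0 < D" unfolding D_def using Dj n by (intro sum_pos) (auto simp: verts)
  have D': "d x y \<le> D" if "j \<in> verts (graph G)" "x \<in> W j" "y \<in> W j" for j x y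
    using Dj DjD[OF that(1)] that by force
  \<comment> \<open>One threshold has two purposes: the whole sum stays below \<epsilon>, and each
    single term stays below \<open>\<delta> powr s\<close>, which forces the diameters below
    \<delta>.\<close>
  have "0 < min \<epsilon> (\<delta> powr s) / D powr s" using \<delta> \<epsilon> D by simp
  from eventually_conj[OF order_tendstoD(2)[OF lim this] eventually_ge_at_top[of 1]]
  obtain q where q: "(\<Sum>i<n. \<Sum>j<n. entry_power n (weight s) q i j) < min \<epsilon> (\<delta> powr s) / D powr s" "1 \<le> q"
    using eventually_happens[of _ sequentially] by auto
  define J where "J = (SIGMA i:verts (graph G). SIGMA j:verts (graph G). paths G q i j)"
  define C where "C p = (case p of (i, j, es) \<Rightarrow> path_map G es ` W j)" for p :: "nat \<times> nat \<times> 'e list"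
  define b where "b p = (case p of (i, j, es) \<Rightarrow> path_ratio \<rho> es * D)" for p :: "nat \<times> nat \<times> 'e list"
  have finJ: "finite J" unfolding J_def verts using finite_paths[OF fin_digraph] by (intro finite_SigmaI) auto
  have b0: "0 \<le> b p" if "p \<in> J" for p
    using that D path_ratio_pos' by (force simp: J_def b_def)
  have "(\<Sum>p\<in>J. b p powr s) = (\<Sum>(i, j, es)\<in>J. D powr s * path_ratio \<rho> es powr s)"
    by (intro sum.cong) (auto simp: b_def powr_mult)
  also have "\<dots> = D powr s * (\<Sum>(i, j, es)\<in>J. path_ratio \<rho> es powr s)"
    by (simp add: sum_distrib_left case_prod_unfold)
  also have "\<dots> = D powr s * (\<Sum>i<n. \<Sum>j<n. entry_power n (weight s) q i j)"
    by (simp only: total_weight J_def)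
  also have "\<dots> < min \<epsilon> (\<delta> powr s)" using q(1) D by (simp add: pos_less_divide_eq mult.commute)
  finally have sum: "(\<Sum>p\<in>J. b p powr s) < min \<epsilon> (\<delta> powr s)" .
  have "b p \<le> \<delta>" if "p \<in> J" for p
  proof (rule ccontr)
    assume "\<not> b p \<le> \<delta>"
    hence "\<delta> powr s \<le> b p powr s" using \<delta> s by (intro powr_mono2) auto
    also have "\<dots> \<le> (\<Sum>p\<in>J. b p powr s)" using finJ that by (intro member_le_sum) auto
    finally show False using sum by simp
  qed
  moreover have "d x y \<le> b p" if p: "p \<in> J" and xy: "x \<in> C p" "y \<in> C p" for p x y
  proof -
    obtain i j es where ij: "p = (i, j, es)" "j \<in> verts (graph G)" "es \<in> paths G q i j"
      using p by (auto simp: J_def)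
    obtain x' y' where x': "x' \<in> W j" "x = path_map G es x'" "y' \<in> W j" "y = path_map G es y'"
      using xy by (auto simp: C_def ij)
    have "d x y = path_ratio \<rho> es * d x' y'"
      using path_similitude[OF ij(3)] W_domain[OF ij(2)] x' by blast
    also have "\<dots> \<le> path_ratio \<rho> es * D"
      using D'[OF ij(2) x'(1,3)] path_ratio_pos'[OF ij(3)] by simp
    finally show ?thesis by (simp add: b_def ij)
  qed
  moreover have "K \<subseteq> (\<Union>p\<in>J. C p)"
  proof
    fix x assume "x \<in> K"
    hence "x \<in> gifs_level G W q" using K_subset[OF q(2)] by blast
    then obtain i j es where "i \<in> verts (graph G)" "j \<in> verts (graph G)" "es \<in> paths G q i j" "x \<in> path_map G es ` W j"
      unfolding gifs_level_def by blast
    thus "x \<in> (\<Union>p\<in>J. C p)" by (intro UN_I[of "(i, j, es)"]) (auto simp: J_def C_def)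
  qed
  ultimately show "\<exists>(J :: (nat \<times> nat \<times> 'e list) set) C b. finite J \<and> K \<subseteq> (\<Union>j\<in>J. C j) \<and>
      (\<forall>j\<in>J. 0 \<le> b j \<and> b j \<le> \<delta> \<and> (\<forall>x\<in>C j. \<forall>y\<in>C j. d x y \<le> b j)) \<and> (\<Sum>j\<in>J. b j powr s) \<le> \<epsilon>"
    using finJ b0 sum by (intro exI[of _ J] exI[of _ C] exI[of _ b]) auto
qed

lemma hausdorff_measure_neq_0:
  assumes gosc: "GOSC d G" and s: "0 \<le> s" and i: "i < n" and q: "1 \<le> q"
    and gt: "1 < entry_power n (weight s) q i i"
  shows "hausdorff_measure d s K \<noteq> 0"
proof -
  obtain Q L c where L: "1 \<le> Q" "L \<subseteq> paths G Q (Suc i) (Suc i)" "\<And>es. es \<in> L \<Longrightarrow> path_ratio \<rho> es = c"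
    "0 < c" "c < 1" "1 \<le> real (card L) * c powr s"
    using homogeneous_loops[OF i q gt] by metis
  have v: "Suc i \<in> verts (graph G)" using i by (simp add: verts)
  from gosc obtain U where
    U1: "\<forall>j\<in>verts (graph G). U j \<noteq> {} \<and> open (U j) \<and> Metric_space.mbounded UNIV d (U j) \<and> U j \<subseteq> domain_of G j"
    and U2: "\<forall>i\<in>verts (graph G).
      (\<forall>j\<in>verts (graph G). (\<Union>e\<in>edges_between G i j. map_of_edge G e ` U j) \<subseteq> U i) \<and>
      (\<forall>j1\<in>verts (graph G). \<forall>j2\<in>verts (graph G). \<forall>e\<in>edges_between G i j1. \<forall>e'\<in>edges_between G i j2.
         e \<noteq> e' \<longrightarrow> map_of_edge G e ` U j1 \<inter> map_of_edge G e' ` U j2 = {})"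
    unfolding GOSC_def by (elim exE conjE)
  have U: "U j \<noteq> {} \<and> open (U j) \<and> U j \<subseteq> domain_of G j" if "j \<in> verts (graph G)" for j
    using U1 that by simp
  interpret fin_digraph "graph G" by (rule fin_digraph)
  have Uinv: "invariant_family G U" unfolding invariant_family_def using U U2 by simp
  have disj: "map_of_edge G e ` U j1 \<inter> map_of_edge G e' ` U j2 = {}"
    if "e \<in> edges_between G i j1" "e' \<in> edges_between G i j2" "e \<noteq> e'" for i j1 j2 e e'
  proof -
    have "i \<in> verts (graph G)" "j1 \<in> verts (graph G)" "j2 \<in> verts (graph G)"
      using that by (auto simp: edges_between_iff)
    with U2 that show ?thesis by simp
  qed
  obtain u where u: "u \<in> U (Suc i)" using U[OF v] by blast
  have finL: "finite L" using L(2) finite_paths[OF fin_digraph] by (rule finite_subset)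
  have W_inv: "path_map G es ` W (Suc i) \<subseteq> W (Suc i)" if "es \<in> L" for es
    using path_map_invariant[OF fin_digraph W_invariant] that L(2) by blast
  show ?thesis
  \<comment> \<open>The alphabet is the set \<open>L\<close> of loops. A word over it is a list of
    loops, and \<open>path_map_concat\<close> reads it as one long loop.\<close>
  proof (rule homogeneous_ifs_hausdorff_measure[where f = "path_map G" and T = L and c = c
        and U = "U (Suc i)" and W = "W (Suc i)" and u = u])
    show "d (path_map G es x) (path_map G es y) = c * d x y"
      if "es \<in> L" "x \<in> U (Suc i) \<union> W (Suc i)" "y \<in> U (Suc i) \<union> W (Suc i)" for es x y
      using path_similitude[of es Q "Suc i" "Suc i" x y] L(2,3) U[OF v] W_domain[OF v] that by auto
    show "path_map G es ` U (Suc i) \<subseteq> U (Suc i)" if "es \<in> L" for es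
      using path_map_invariant[OF fin_digraph Uinv] that L(2) by blast
    show "path_map G es ` U (Suc i) \<inter> path_map G es' ` U (Suc i) = {}"
      if "es \<in> L" "es' \<in> L" "es \<noteq> es'" for es es'
      by (rule path_disjoint[OF _ Uinv disj]) (use U that L(2) in auto)
    show "foldr (path_map G) ess ` W (Suc i) \<inter> K \<noteq> {}" if ess: "set ess \<subseteq> L" for ess
    proof (cases "ess = []")
      case False
      have "concat ess \<in> paths G (Q * length ess) (Suc i) (Suc i)"
        using paths_concat[OF v, of ess Q] ess L(2) by blast
      moreover have "1 \<le> Q * length ess" using False L(1) by (cases ess) auto
      ultimately have "path_map G (concat ess) ` W (Suc i) \<inter> K \<noteq> {}" by (rule loop_meets_K)
      thus ?thesis by (simp add: path_map_concat)
    next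
      case True
      \<comment> \<open>The empty word has the cell \<open>W (Suc i)\<close>, which meets
        \<open>K\<close> because it contains the cell of any single loop.\<close>
      have "L \<noteq> {}" using L(6) by auto
      then obtain es where "es \<in> L" by blast
      hence "path_map G es ` W (Suc i) \<inter> K \<noteq> {}" using loop_meets_K[OF _ L(1)] L(2) by blast
      thus ?thesis using W_inv[OF \<open>es \<in> L\<close>] True by auto
    qed
  qed (use finL L U[OF v] u W_compact[OF v] W_nonempty[OF v] W_inv K_compact s in auto)
qed

text \<open>The infimum is caught from two sides: every exponent above \<alpha> gives measure 0, and
  no nonnegative exponent below it does.\<close>

theorem gifs_hausdorff_dim:
  assumes "GOSC d G"
  obtains \<alpha> where "0 \<le> \<alpha>" "radius \<alpha> = 1" "\<And>\<beta>. 0 \<le> \<beta> \<Longrightarrow> radius \<beta> = 1 \<Longrightarrow> \<beta> = \<alpha>"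
    "hausdorff_dim d K = ereal \<alpha>"
proof -
  \<comment> \<open>At exponent 0 every path has weight 1, so the sum counts the paths of length
    \<open>q\<close>; a nonempty level needs at least one.\<close>
  have total: "1 \<le> (\<Sum>i<n. \<Sum>j<n. entry_power n (weight 0) q i j)" for q
  proof (cases "q = 0")
    case True
    thus ?thesis using n by simp
  next
    case False
    let ?J = "SIGMA i:verts (graph G). SIGMA j:verts (graph G). paths G q i j"
    have "gifs_level G W q \<noteq> {}" using level_nonempty False by simp
    then obtain i j es where p: "(i, j, es) \<in> ?J" unfolding gifs_level_def by auto
    have fin: "finite ?J" unfolding verts using finite_paths[OF fin_digraph] by (intro finite_SigmaI) auto
    have "1 = (case (i, j, es) of (i, j, es) \<Rightarrow> path_ratio \<rho> es powr 0)"
      using p path_ratio_pos'[of es q i j] by simp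
    also have "\<dots> \<le> (\<Sum>(i, j, es)\<in>?J. path_ratio \<rho> es powr 0)"
    proof (rule member_le_sum[OF p _ fin])
      show "0 \<le> (case r of (i, j, es) \<Rightarrow> path_ratio \<rho> es powr 0)" for r by (cases r) simp
    qed
    finally show ?thesis unfolding total_weight .
  qed
  obtain \<alpha> where \<alpha>: "0 \<le> \<alpha>" "radius \<alpha> = 1" "\<And>\<beta>. 0 \<le> \<beta> \<Longrightarrow> radius \<beta> = 1 \<Longrightarrow> \<beta> = \<alpha>"
    "\<And>s. \<alpha> < s \<Longrightarrow> (\<lambda>q. \<Sum>i<n. \<Sum>j<n. entry_power n (weight s) q i j) \<longlonglongrightarrow> 0"
    "\<And>s. 0 \<le> s \<Longrightarrow> s < \<alpha> \<Longrightarrow> \<exists>i q. i < n \<and> 1 \<le> q \<and> 1 < entry_power n (weight s) q i i"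
    by (rule critical_exponent[OF total]) (rule that, assumption+)
  have "hausdorff_dim d K = ereal \<alpha>"
    unfolding hausdorff_dim_def
  proof (rule antisym)
    show "(INF s\<in>{s. 0 \<le> s \<and> hausdorff_measure d s K = 0}. ereal s) \<le> ereal \<alpha>"
    proof (rule ereal_le_epsilon2)
      fix e :: real assume "0 < e"
      hence "hausdorff_measure d (\<alpha> + e) K = 0"
        using \<alpha>(1) by (intro hausdorff_measure_0 \<alpha>(4)) auto
      hence "(INF s\<in>{s. 0 \<le> s \<and> hausdorff_measure d s K = 0}. ereal s) \<le> ereal (\<alpha> + e)"
        using \<alpha>(1) \<open>0 < e\<close> by (intro INF_lower) auto
      thus "(INF s\<in>{s. 0 \<le> s \<and> hausdorff_measure d s K = 0}. ereal s) \<le> ereal \<alpha> + ereal e" by simp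
    qed
    show "ereal \<alpha> \<le> (INF s\<in>{s. 0 \<le> s \<and> hausdorff_measure d s K = 0}. ereal s)"
    proof (rule INF_greatest)
      fix s assume s: "s \<in> {s. 0 \<le> s \<and> hausdorff_measure d s K = 0}"
      have "\<not> s < \<alpha>"
      proof
        assume "s < \<alpha>"
        then obtain i q where "i < n" "1 \<le> q" "1 < entry_power n (weight s) q i i" using \<alpha>(5)[of s] s by auto
        from hausdorff_measure_neq_0[OF assms _ this] s show False by simp
      qed
      thus "ereal \<alpha> \<le> ereal s" by simp
    qed
  qed
  with \<alpha>(1-3) show ?thesis by (rule that)
qed

end

section \<open>Iterated relation systems and minimality\<close>

lemma irs_level_compact:
  assumes "is_IRS E0 N R"
  shows "compact (irs_level E0 N R k) \<and> irs_level E0 N R k \<noteq> {} \<and> irs_level E0 N R k \<subseteq> E0"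
proof (induction k)
  case 0
  thus ?case using assms by (simp add: is_IRS_def)
next
  case (Suc k)
  let ?F = "irs_level E0 N R k"
  have t: "compact (rel_image (R t) ?F) \<and> rel_image (R t) ?F \<noteq> {}" "rel_image (R t) E0 \<subseteq> E0" if "t \<in> {1..N}" for t
    using assms Suc that unfolding is_IRS_def by blast+
  have N: "1 \<in> {1..N}" using assms by (simp add: is_IRS_def)
  have "compact (\<Union>t\<in>{1..N}. rel_image (R t) ?F)" using t by (intro compact_UN) auto
  moreover have "rel_image (R t) ?F \<subseteq> E0" if "t \<in> {1..N}" for t
    using t(2)[OF that] Suc unfolding rel_image_def by blast
  moreover have "(\<Union>t\<in>{1..N}. rel_image (R t) ?F) \<noteq> {}" using t(1)[OF N] N by blast
  ultimately show ?case by (simp only: irs_level.simps) blast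
qed

lemma irs_level_decreasing:
  assumes "is_IRS E0 N R" "k \<le> l"
  shows "irs_level E0 N R l \<subseteq> irs_level E0 N R k"
  using assms(2)
proof (rule lift_Suc_antimono_le[rotated])
  show "irs_level E0 N R (Suc k) \<subseteq> irs_level E0 N R k" for k
  proof (induction k)
    case 0
    thus ?case using assms(1) by (auto simp: is_IRS_def)
  next
    case (Suc k)
    have "rel_image (R t) (irs_level E0 N R (Suc k)) \<subseteq> rel_image (R t) (irs_level E0 N R k)" for t
      using Suc unfolding rel_image_def by blast
    thus ?case by (simp only: irs_level.simps(2)) (rule UN_mono; simp)
  qed
qed

text \<open>The first letter of a word acts last, so putting a letter in front passes to the next
  level. Together with \<open>associated_GIFS\<close> this identifies the levels of the graph with
  those of the relations, shifted by \<open>k0\<close>.\<close>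

lemma irs_level_words:
  "(\<Union>ts\<in>{ts. set ts \<subseteq> {1..N} \<and> length ts = q}. word_image R ts (irs_level E0 N R k)) = irs_level E0 N R (k + q)"
proof (induction q)
  case 0
  thus ?case by (simp add: word_image_def)
next
  case (Suc q)
  let ?S = "\<lambda>q. {ts. set ts \<subseteq> {1..N} \<and> length ts = q}"
  have S: "?S (Suc q) = (\<Union>t\<in>{1..N}. (#) t ` ?S q)"
    by (auto simp: length_Suc_conv image_iff)
  have "irs_level E0 N R (k + Suc q) = (\<Union>t\<in>{1..N}. rel_image (R t) (\<Union>ts\<in>?S q. word_image R ts (irs_level E0 N R k)))"
    by (simp only: irs_level.simps add_Suc_right Suc)
  also have "\<dots> = (\<Union>t\<in>{1..N}. \<Union>ts\<in>?S q. word_image R (t # ts) (irs_level E0 N R k))"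
    by (simp add: rel_image_def word_image_def)
  also have "\<dots> = (\<Union>ts\<in>?S (Suc q). word_image R ts (irs_level E0 N R k))"
    unfolding S by simp
  finally show ?case by simp
qed

lemma simplified_GIFS_relabelling:
  assumes "simplified_GIFS d G W Gh Wh"
  obtains \<sigma> where "inj_on \<sigma> (verts (graph Gh))" "\<sigma> ` verts (graph Gh) \<subseteq> verts (graph G)"
    "\<And>j. j \<in> verts (graph Gh) \<Longrightarrow> Wh j = W (\<sigma> j) \<and> domain_of Gh j = domain_of G (\<sigma> j)"
    "\<And>e. e \<in> edges Gh \<Longrightarrow> tail (graph G) e = \<sigma> (tail (graph Gh) e) \<and>
        head (graph G) e = \<sigma> (head (graph Gh) e) \<and> map_of_edge Gh e = map_of_edge G e"
proof -
  from assms have "\<exists>\<sigma>. inj_on \<sigma> (verts (graph Gh)) \<and> \<sigma> ` verts (graph Gh) \<subseteq> verts (graph G) \<and>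
    (\<forall>j\<in>verts (graph Gh). Wh j = W (\<sigma> j) \<and> domain_of Gh j = domain_of G (\<sigma> j)) \<and>
    (\<forall>e\<in>edges Gh. tail (graph G) e = \<sigma> (tail (graph Gh) e) \<and>
        head (graph G) e = \<sigma> (head (graph Gh) e) \<and> map_of_edge Gh e = map_of_edge G e)"
    unfolding simplified_GIFS_def by (elim conjE)
  then obtain \<sigma> where *: "inj_on \<sigma> (verts (graph Gh))" "\<sigma> ` verts (graph Gh) \<subseteq> verts (graph G)"
    "\<forall>j\<in>verts (graph Gh). Wh j = W (\<sigma> j) \<and> domain_of Gh j = domain_of G (\<sigma> j)"
    "\<forall>e\<in>edges Gh. tail (graph G) e = \<sigma> (tail (graph Gh) e) \<and>
        head (graph G) e = \<sigma> (head (graph Gh) e) \<and> map_of_edge Gh e = map_of_edge G e"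
    by (elim exE conjE)
  show ?thesis using * by (intro that[of \<sigma>]) simp_all
qed

text \<open>Deleting a vertex \<open>v\<close> with \<open>Wh v = {}\<close> (and giving its number to the last vertex) does not
  change any level, because no path through \<open>v\<close> has a nonempty image.\<close>

lemma minimal_simplified_GIFS_nonempty:
  assumes min: "minimal_simplified_GIFS d G W Gh Wh" and v: "v \<in> verts (graph Gh)"
  shows "Wh v \<noteq> {}"
proof
  assume empty: "Wh v = {}"
  have simp: "simplified_GIFS d G W Gh Wh" using min by (simp add: minimal_simplified_GIFS_def)
  have gifs: "is_GIFS d Gh" and inv: "invariant_family Gh Wh"
    and sub: "edges Gh \<subseteq> edges G" "gifs_order Gh \<le> gifs_order G" "invariant_family G W"
    and lev: "\<And>q. q \<ge> 1 \<Longrightarrow> gifs_level G W q = gifs_level Gh Wh q"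
    using simp by (auto simp: simplified_GIFS_def)
  obtain \<sigma> where \<sigma>: "inj_on \<sigma> (verts (graph Gh))" "\<sigma> ` verts (graph Gh) \<subseteq> verts (graph G)"
    "\<And>j. j \<in> verts (graph Gh) \<Longrightarrow> Wh j = W (\<sigma> j) \<and> domain_of Gh j = domain_of G (\<sigma> j)"
    "\<And>e. e \<in> edges Gh \<Longrightarrow> tail (graph G) e = \<sigma> (tail (graph Gh) e) \<and>
        head (graph G) e = \<sigma> (head (graph Gh) e) \<and> map_of_edge Gh e = map_of_edge G e"
    by (rule simplified_GIFS_relabelling[OF simp]) (rule that)
  have fd: "fin_digraph (graph Gh)" using gifs by (simp add: is_GIFS_def)
  interpret fin_digraph "graph Gh" by (rule fd)
  obtain p where p: "verts (graph Gh) = {1..p}" using gifs by (auto simp: is_GIFS_def)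
  have vp: "1 \<le> v" "v \<le> p" using v p by auto
  \<comment> \<open>\<open>\<pi>\<close> leads from the new numbers to the old ones, the number
    \<open>v\<close> now standing for the old vertex \<open>p\<close>; \<open>\<kappa>\<close> is
    the inverse renumbering. If \<open>v = p\<close>, both are identities.\<close>
  define \<pi> where "\<pi> j = (if j = v then p else j)" for j
  define \<kappa> where "\<kappa> i = (if i = p then v else i)" for i
  have \<pi>\<kappa>: "\<pi> (\<kappa> i) = i" "\<kappa> i \<in> {1..p - 1}" if "i \<in> {1..p}" "i \<noteq> v" for i
    using that vp by (auto simp: \<pi>_def \<kappa>_def)
  have \<kappa>\<pi>: "\<kappa> (\<pi> j) = j" "\<pi> j \<in> {1..p}" "\<pi> j \<noteq> v" if "j \<in> {1..p - 1}" for j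
    using that vp by (auto simp: \<pi>_def \<kappa>_def)
  define S where "S = {e \<in> edges Gh. tail (graph Gh) e \<noteq> v \<and> head (graph Gh) e \<noteq> v}"
  define D where "D = \<lparr>verts = {1..p - 1}, arcs = S, tail = \<lambda>e. \<kappa> (tail (graph Gh) e), head = \<lambda>e. \<kappa> (head (graph Gh) e)\<rparr>"
  define G' where "G' = \<lparr>graph = D, domain_of = \<lambda>j. domain_of Gh (\<pi> j), map_of_edge = map_of_edge Gh\<rparr>"
  define W' where "W' j = Wh (\<pi> j)" for j
  have G': "graph G' = D" "domain_of G' = (\<lambda>j. domain_of Gh (\<pi> j))" "map_of_edge G' = map_of_edge Gh"
    "verts D = {1..p - 1}" "arcs D = S" "tail D = (\<lambda>e. \<kappa> (tail (graph Gh) e))" "head D = (\<lambda>e. \<kappa> (head (graph Gh) e))"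
    by (simp_all add: G'_def D_def)
  have S_verts: "tail (graph Gh) e \<in> {1..p}" "head (graph Gh) e \<in> {1..p}" "tail (graph Gh) e \<noteq> v" "head (graph Gh) e \<noteq> v"
    "e \<in> edges Gh" if "e \<in> S" for e
    using that tail_in_verts[of e] head_in_verts[of e] p by (auto simp: S_def)
  have S_ends: "\<kappa> (tail (graph Gh) e) \<in> {1..p - 1}" "\<kappa> (head (graph Gh) e) \<in> {1..p - 1}"
    "\<pi> (\<kappa> (tail (graph Gh) e)) = tail (graph Gh) e" "\<pi> (\<kappa> (head (graph Gh) e)) = head (graph Gh) e" if "e \<in> S" for e
    using \<pi>\<kappa> S_verts[OF that] by blast+
  have fd': "fin_digraph (graph G')"
  proof
    show "finite (arcs (graph G'))" using finite_arcs by (simp add: G' S_def)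
  qed (use S_ends in \<open>auto simp: G'\<close>)
  have between: "edges_between G' i j \<subseteq> edges_between Gh (\<pi> i) (\<pi> j)" for i j
    using S_ends(3,4) S_verts(5) by (auto simp: edges_between_iff G')
  have gifs': "is_GIFS d G'"
    unfolding is_GIFS_def
  proof (intro conjI ballI)
    show "\<exists>p. verts (graph G') = {1..p}" by (auto simp: G')
    fix i j e assume ij: "i \<in> verts (graph G')" "j \<in> verts (graph G')" and e: "e \<in> edges_between G' i j"
    have *: "\<pi> i \<in> verts (graph Gh)" "\<pi> j \<in> verts (graph Gh)"
      using ij \<kappa>\<pi>(2) p by (auto simp: G')
    have "e \<in> edges_between Gh (\<pi> i) (\<pi> j)" using e between by blast
    note * = * this
    with gifs have "map_of_edge Gh e ` domain_of Gh (\<pi> j) \<subseteq> domain_of Gh (\<pi> i)"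
      "contraction_on d (domain_of Gh (\<pi> j)) (map_of_edge Gh e)" unfolding is_GIFS_def by blast+
    thus "map_of_edge G' e ` domain_of G' j \<subseteq> domain_of G' i"
      "contraction_on d (domain_of G' j) (map_of_edge G' e)" by (simp_all add: G')
  qed (fact fd')
  have inv': "invariant_family G' W'"
    unfolding invariant_family_def
  proof (intro conjI ballI)
    fix j assume "j \<in> verts (graph G')"
    thus "W' j \<subseteq> domain_of G' j" using inv \<kappa>\<pi>(2)[of j] p by (simp add: G' W'_def invariant_family_def)
  next
    fix i j assume "i \<in> verts (graph G')" "j \<in> verts (graph G')"
    hence "\<pi> i \<in> verts (graph Gh)" "\<pi> j \<in> verts (graph Gh)" using \<kappa>\<pi>(2) p by (auto simp: G')
    hence "(\<Union>e\<in>edges_between Gh (\<pi> i) (\<pi> j). map_of_edge Gh e ` Wh (\<pi> j)) \<subseteq> Wh (\<pi> i)"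
      using inv by (simp add: invariant_family_def)
    thus "(\<Union>e\<in>edges_between G' i j. map_of_edge G' e ` W' j) \<subseteq> W' i"
      using between[of i j] by (auto simp: G' W'_def)
  qed
  have pm: "path_map G' es = path_map Gh es" for es by (simp add: path_map_def G')
  have cas1: "pre_digraph.cas D (\<kappa> i) es (\<kappa> j)" if "pre_digraph.cas (graph Gh) i es j" for i es j
    using that by (induction es arbitrary: i) (auto simp: pre_digraph.cas.simps G')
  have cas2: "pre_digraph.cas (graph Gh) (\<pi> i) es (\<pi> j)"
    if "pre_digraph.cas D i es j" "set es \<subseteq> S" for i es j
    using that
  proof (induction es arbitrary: i)
    case (Cons e es)
    have e: "e \<in> S" using Cons.prems by simp
    have "pre_digraph.cas (graph Gh) (\<pi> (\<kappa> (head (graph Gh) e))) es (\<pi> j)"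
      using Cons.prems by (intro Cons.IH) (auto simp: pre_digraph.cas.simps G')
    thus ?case using Cons.prems(1) S_ends(3,4)[OF e] by (auto simp: pre_digraph.cas.simps G')
  qed (simp add: pre_digraph.cas.simps)
  \<comment> \<open>By invariance, the tails of a path ending at \<open>j\<close> carry points of
    \<open>Wh j\<close> into the sets of the vertices passed; a visit to \<open>v\<close> would put
    a point into \<open>Wh v\<close>.\<close>
  have avoid: "i \<noteq> v \<and> set es \<subseteq> S" if es: "es \<in> paths Gh q i j" and Wj: "Wh j \<noteq> {}" for i j q es
    using es
  proof (induction es arbitrary: i q)
    case Nil
    thus ?case using Wj empty by (auto simp: paths_iff)
  next
    case (Cons e es)
    have ne: "i \<noteq> v"
    proof
      assume "i = v"
      obtain x where "x \<in> Wh j" using Wj by blast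
      from path_map_invariant[OF fd inv Cons.prems this] show False using \<open>i = v\<close> empty by simp
    qed
    have e: "e \<in> edges Gh" "tail (graph Gh) e = i" "es \<in> paths Gh (q - 1) (head (graph Gh) e) j"
      using Cons.prems by (auto simp: paths_iff)
    thus ?case using Cons.IH[OF e(3)] ne by (auto simp: S_def)
  qed
  have levels: "gifs_level Gh Wh q = gifs_level G' W' q" for q
  proof (intro equalityI subsetI)
    fix x assume "x \<in> gifs_level Gh Wh q"
    then obtain i j es where x: "i \<in> verts (graph Gh)" "j \<in> verts (graph Gh)" "es \<in> paths Gh q i j" "x \<in> path_map Gh es ` Wh j"
      unfolding gifs_level_def by blast
    have ne: "Wh j \<noteq> {}" "j \<noteq> v" using x(4) empty by auto
    note av = avoid[OF x(3) ne(1)]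
    have "\<kappa> i \<in> {1..p - 1}" "\<kappa> j \<in> {1..p - 1}" "\<pi> (\<kappa> j) = j" using \<pi>\<kappa> x(1,2) p av ne by auto
    moreover have "es \<in> paths G' q (\<kappa> i) (\<kappa> j)"
      using x(3) av cas1[of i es j] \<open>\<kappa> i \<in> {1..p - 1}\<close> by (simp add: paths_iff G')
    ultimately show "x \<in> gifs_level G' W' q"
      unfolding gifs_level_def pm using x(4) by (intro UN_I[of "\<kappa> i"] UN_I[of "\<kappa> j"] UN_I[of es]) (simp_all add: G' W'_def)
  next
    fix x assume "x \<in> gifs_level G' W' q"
    then obtain i j es where x: "i \<in> {1..p - 1}" "j \<in> {1..p - 1}" "es \<in> paths G' q i j" "x \<in> path_map Gh es ` Wh (\<pi> j)"
      unfolding gifs_level_def pm by (auto simp: G' W'_def)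
    have S: "set es \<subseteq> S" using x(3) by (simp add: paths_iff G')
    have "es \<in> paths Gh q (\<pi> i) (\<pi> j)"
      using x(3) cas2[OF _ S, of i j] S S_verts(5) \<kappa>\<pi>(2)[OF x(1)] p by (auto simp: paths_iff G')
    thus "x \<in> gifs_level Gh Wh q"
      using x(4) \<kappa>\<pi>(2)[OF x(1)] \<kappa>\<pi>(2)[OF x(2)] p unfolding gifs_level_def by blast
  qed
  have order: "gifs_order G' < gifs_order Gh" using vp by (simp add: G' p)
  have "simplified_GIFS d G W G' W'"
    unfolding simplified_GIFS_def
  proof (intro conjI allI impI exI[of _ "\<lambda>j. \<sigma> (\<pi> j)"] ballI)
    have "inj_on \<pi> {1..p - 1}" using \<kappa>\<pi>(1) by (metis inj_on_inverseI)
    moreover have "\<pi> ` {1..p - 1} \<subseteq> verts (graph Gh)" using \<kappa>\<pi>(2) p by auto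
    ultimately show "inj_on (\<lambda>j. \<sigma> (\<pi> j)) (verts (graph G'))"
      using comp_inj_on[of \<pi> "{1..p - 1}" \<sigma>] inj_on_subset[OF \<sigma>(1)] by (simp add: G' o_def)
    show "(\<lambda>j. \<sigma> (\<pi> j)) ` verts (graph G') \<subseteq> verts (graph G)"
      using \<sigma>(2) \<open>\<pi> ` {1..p - 1} \<subseteq> verts (graph Gh)\<close> by (auto simp: G')
    fix j assume "j \<in> verts (graph G')"
    hence "\<pi> j \<in> verts (graph Gh)" using \<kappa>\<pi>(2) p by (simp add: G')
    from \<sigma>(3)[OF this] show "W' j = W (\<sigma> (\<pi> j))" "domain_of G' j = domain_of G (\<sigma> (\<pi> j))"
      by (simp_all add: G' W'_def)
  next
    fix e assume "e \<in> edges G'"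
    hence e: "e \<in> S" by (simp add: G')
    show "tail (graph G) e = \<sigma> (\<pi> (tail (graph G') e))" "head (graph G) e = \<sigma> (\<pi> (head (graph G') e))"
      "map_of_edge G' e = map_of_edge G e"
      using \<sigma>(4)[OF S_verts(5)[OF e]] S_ends(3,4)[OF e] by (simp_all add: G')
  next
    show "edges G' \<subseteq> edges G" using sub(1) by (auto simp: G' S_def)
    show "gifs_order G' \<le> gifs_order G" using order sub(2) by simp
    fix q :: nat assume "1 \<le> q"
    thus "gifs_level G W q = gifs_level G' W' q" using lev levels by simp
  qed (fact sub(3) gifs' inv')+
  hence "gifs_order Gh \<le> gifs_order G'" using min unfolding minimal_simplified_GIFS_def by blast
  thus False using order by simp
qed

text \<open>With one vertex a single set \<open>U\<close> serves, and the enumeration \<epsilon>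
  turns distinct edges into distinct indices.\<close>

lemma OSC_imp_GOSC:
  assumes fd: "fin_digraph (graph G)" and v: "verts (graph G) = {1}" and \<epsilon>: "bij_betw \<epsilon> {1..m} (edges G)"
    and osc: "OSC d (domain_of G 1) m (\<lambda>t. map_of_edge G (\<epsilon> t))"
  shows "GOSC d G"
proof -
  from osc obtain U where U: "U \<noteq> {}" "open U" "Metric_space.mbounded UNIV d U" "U \<subseteq> domain_of G 1"
    "(\<Union>t\<in>{1..m}. map_of_edge G (\<epsilon> t) ` U) \<subseteq> U"
    "\<forall>t1\<in>{1..m}. \<forall>t2\<in>{1..m}. t1 \<noteq> t2 \<longrightarrow> map_of_edge G (\<epsilon> t1) ` U \<inter> map_of_edge G (\<epsilon> t2) ` U = {}"
    unfolding OSC_def by (elim exE conjE)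
  have im: "\<epsilon> ` {1..m} = edges G" using \<epsilon> by (simp add: bij_betw_def)
  have sub: "map_of_edge G e ` U \<subseteq> U" if "e \<in> edges G" for e
    using that U(5) unfolding im[symmetric] by blast
  have disj: "map_of_edge G e ` U \<inter> map_of_edge G e' ` U = {}" if e: "e \<in> edges G" "e' \<in> edges G" "e \<noteq> e'" for e e'
  proof -
    obtain t t' where t: "t \<in> {1..m}" "t' \<in> {1..m}" "e = \<epsilon> t" "e' = \<epsilon> t'"
      using e unfolding im[symmetric] by blast
    moreover from this e have "t \<noteq> t'" by auto
    ultimately show ?thesis using U(6) by simp
  qed
  show ?thesis unfolding GOSC_def
  proof (intro exI[of _ "\<lambda>_. U"] conjI ballI impI)
    show "(\<Union>e\<in>edges_between G i j. map_of_edge G e ` U) \<subseteq> U" for i j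
      by (rule UN_least) (simp add: sub edges_between_iff)
    show "map_of_edge G e ` U \<inter> map_of_edge G e' ` U = {}"
      if "e \<in> edges_between G i j1" "e' \<in> edges_between G i j2" "e \<noteq> e'" for i j1 j2 e e'
      using disj[of e e'] that by (simp add: edges_between_iff)
  qed (use U v in auto)
qed

text \<open>The levels of \<open>Gh\<close> are those of the relation system from
  \<open>k0 + 1\<close> on. As these decrease, the attractor can be recovered from any unbounded
  selection of them.\<close>

lemma minimal_GIFS_similitude_gifs:
  fixes d :: "'a::t2_space \<Rightarrow> 'a \<Rightarrow> real" and G Gh :: "('a, 'e) gifs"
  assumes le: "locally_euclidean_space TYPE('v::euclidean_space) d"
    and irs: "is_IRS E0 N R" and K: "K = irs_attractor E0 N R"
    and assoc: "associated_GIFS E0 N R k0 G W"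
    and sims: "contractive_similitudes d G \<rho>"
    and min: "minimal_simplified_GIFS d G W Gh Wh"
  shows "similitude_gifs TYPE('v) d Gh (gifs_order Gh) \<rho> Wh K"
proof -
  have simp: "simplified_GIFS d G W Gh Wh" using min by (simp add: minimal_simplified_GIFS_def)
  have gifs: "is_GIFS d Gh" and inv: "invariant_family Gh Wh" and sub: "edges Gh \<subseteq> edges G"
    and lev: "\<And>q. q \<ge> 1 \<Longrightarrow> gifs_level G W q = gifs_level Gh Wh q"
    using simp by (auto simp: simplified_GIFS_def)
  obtain \<sigma> where \<sigma>: "\<sigma> ` verts (graph Gh) \<subseteq> verts (graph G)"
    "\<And>j. j \<in> verts (graph Gh) \<Longrightarrow> Wh j = W (\<sigma> j) \<and> domain_of Gh j = domain_of G (\<sigma> j)"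
    "\<And>e. e \<in> edges Gh \<Longrightarrow> tail (graph G) e = \<sigma> (tail (graph Gh) e) \<and>
        head (graph G) e = \<sigma> (head (graph Gh) e) \<and> map_of_edge Gh e = map_of_edge G e"
    by (rule simplified_GIFS_relabelling[OF simp]) (rule that)
  have fd: "fin_digraph (graph Gh)" using gifs by (simp add: is_GIFS_def)
  interpret fin_digraph "graph Gh" by (rule fd)
  have verts: "verts (graph Gh) = {1..gifs_order Gh}" using gifs by (auto simp: is_GIFS_def)
  have level: "gifs_level Gh Wh q = irs_level E0 N R (k0 + q)" if "1 \<le> q" for q
  proof -
    have "(\<Union>ts\<in>{ts. set ts \<subseteq> {1..N} \<and> length ts = q}. word_image R ts (irs_level E0 N R k0)) = gifs_level G W q"
      using assoc that unfolding associated_GIFS_def by (elim conjE) (erule allE[of _ q], simp)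
    thus ?thesis unfolding irs_level_words lev[OF that] by (rule sym)
  qed
  have ne: "gifs_level Gh Wh q \<noteq> {}" if "1 \<le> q" for q
    using level[OF that] irs_level_compact[OF irs] by simp
  show ?thesis
  proof (intro similitude_gifs.intro similitude_gifs_axioms.intro weighted_gifs.intro)
    show "0 < gifs_order Gh"
    proof (rule ccontr)
      assume "\<not> 0 < gifs_order Gh"
      hence "verts (graph Gh) = {}" using verts by simp
      thus False using ne[of 1] by (simp add: gifs_level_def)
    qed
    show "0 < \<rho> e \<and> \<rho> e < 1" if "e \<in> edges Gh" for e
      using that sub sims by (auto simp: contractive_similitudes_def)
    show "invariant_family Gh (domain_of Gh)"
      using gifs unfolding invariant_family_def is_GIFS_def by blast
    show "d (map_of_edge Gh e x) (map_of_edge Gh e y) = \<rho> e * d x y"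
      if e: "e \<in> edges Gh" and xy: "x \<in> domain_of Gh (head (graph Gh) e)" "y \<in> domain_of Gh (head (graph Gh) e)" for e x y
    proof -
      have "head (graph Gh) e \<in> verts (graph Gh)" using e by simp
      hence "x \<in> domain_of G (head (graph G) e)" "y \<in> domain_of G (head (graph G) e)"
        using xy \<sigma>(2) \<sigma>(3)[OF e] by simp_all
      thus ?thesis using sims e sub \<sigma>(3)[OF e] unfolding contractive_similitudes_def by auto
    qed
    show "compact (Wh j)" if "j \<in> verts (graph Gh)" for j
    proof -
      have "\<sigma> j \<in> verts (graph G)" using that \<sigma>(1) by blast
      thus ?thesis using assoc \<sigma>(2)[OF that] by (simp add: associated_GIFS_def)
    qed
    show "Wh j \<noteq> {}" if "j \<in> verts (graph Gh)" for j
      by (rule minimal_simplified_GIFS_nonempty[OF min that])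
    show "compact K"
    proof -
      have "closed K" unfolding K irs_attractor_def
        using irs_level_compact[OF irs] by (intro closed_INT ballI compact_imp_closed) blast
      moreover have "K \<subseteq> irs_level E0 N R 0" unfolding K irs_attractor_def by blast
      ultimately show ?thesis
        using closed_Int_compact[of K "irs_level E0 N R 0"] irs_level_compact[OF irs, of 0]
        by (simp add: Int_absorb2)
    qed
    show "K \<subseteq> gifs_level Gh Wh q" if "1 \<le> q" for q
      unfolding level[OF that] K irs_attractor_def by blast
    show "(\<Inter>m\<in>{1..}. gifs_level Gh Wh (q * m)) \<subseteq> K" if q: "1 \<le> q" for q
    proof
      fix x assume x: "x \<in> (\<Inter>m\<in>{1..}. gifs_level Gh Wh (q * m))"
      have "x \<in> irs_level E0 N R k" for k
      proof -
        \<comment> \<open>\<open>Suc k\<close> keeps the length positive for \<open>k = 0\<close>;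
          level \<open>k0 + q * Suc k\<close> comes no earlier than level \<open>k\<close>.\<close>
        have m: "1 \<le> q * Suc k" using q by simp
        have "x \<in> gifs_level Gh Wh (q * Suc k)" using x by (rule INT_D) simp
        hence "x \<in> irs_level E0 N R (k0 + q * Suc k)" unfolding level[OF m] .
        moreover have "k \<le> k0 + q * Suc k" using q mult_le_mono1[OF q, of "Suc k"] by simp
        ultimately show ?thesis using irs_level_decreasing[OF irs] by blast
      qed
      thus "x \<in> K" unfolding K irs_attractor_def by blast
    qed
  qed (fact le fd verts inv ne)+
qed

text \<open>On a single index, subinvariance with constant \<open>c\<close> just means
  \<open>c \<le> w\<close>, so both inequalities follow from the two bounds on the spectral
  radius.\<close>

lemma spectral_radius_singleton:
  assumes "0 \<le> w" "spectral_radius (complex_mat 1 (\<lambda>i j. w)) = 1"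
  shows "w = 1"
proof (rule antisym)
  have "subinvariant 1 (\<lambda>i j. w) 1"
    using subinvariant_spectral_radius[of "\<lambda>i j. w" 1] assms by simp
  thus "1 \<le> w" by (auto simp: subinvariant_def)
  hence "subinvariant 1 (\<lambda>i j. w) w" by (auto simp: subinvariant_def intro!: exI[of _ "\<lambda>_. 1"])
  thus "w \<le> 1" using spectral_radius_ge[of "\<lambda>i j. w" 1 w] assms \<open>1 \<le> w\<close> by simp
qed

text \<open>Each term is strictly decreasing in the exponent. Negative exponents are covered too,
  beyond the range of uniqueness in \<open>critical_exponent\<close>.\<close>

lemma powr_sum_eq_1_unique:
  fixes r :: "'t \<Rightarrow> real"
  assumes T: "finite T" and r: "\<And>t. t \<in> T \<Longrightarrow> 0 < r t \<and> r t < 1"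
    and "(\<Sum>t\<in>T. r t powr \<alpha>) = 1" "(\<Sum>t\<in>T. r t powr \<beta>) = 1"
  shows "\<beta> = \<alpha>"
proof -
  have "T \<noteq> {}" using assms(3) by auto
  have less: "(\<Sum>t\<in>T. r t powr y) < (\<Sum>t\<in>T. r t powr x)" if "x < y" for x y
    using T \<open>T \<noteq> {}\<close> r that by (intro sum_strict_mono powr_less_mono') auto
  show ?thesis using less[of \<alpha> \<beta>] less[of \<beta> \<alpha>] assms(3,4) by (cases \<alpha> \<beta> rule: linorder_cases) auto
qed

theorem theorem1p3:
  fixes A :: "('a::{t2_space, second_countable_topology}, 'n::finite) chart set"
    and g :: "('a, 'n) chart \<Rightarrow> 'a \<Rightarrow> real ^ 'n ^ 'n"
    and d :: "'a \<Rightarrow> 'a \<Rightarrow> real"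
    and E0 K :: "'a set"
    and N k0 :: nat
    and R :: "nat \<Rightarrow> 'a \<Rightarrow> 'a set"
    and G :: "('a, 'e) gifs"
    and W :: "nat \<Rightarrow> 'a set"
    and \<rho> :: "'e \<Rightarrow> real"
  assumes "complete_flat_orientable_manifold A g"
    and "d = riem_dist A g"
    and "is_IRS E0 N R"
    and "K = irs_attractor E0 N R"
    and "is_GIFS d G"
    and "associated_GIFS E0 N R k0 G W"
    and "contractive_similitudes d G \<rho>"
  shows "(\<forall>Gh Wh. minimal_simplified_GIFS d G W Gh Wh \<and> GOSC d Gh \<longrightarrow>
            (\<exists>\<alpha>\<ge>0. spectral_radius (incidence_matrix Gh \<rho> \<alpha>) = 1 \<and>
                   (\<forall>\<beta>\<ge>0. spectral_radius (incidence_matrix Gh \<rho> \<beta>) = 1 \<longrightarrow> \<beta> = \<alpha>) \<and>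
                   hausdorff_dim d K = ereal \<alpha>)) \<and>
         (\<forall>Gh Wh m \<epsilon>. minimal_simplified_GIFS d G W Gh Wh \<and>
              gifs_order Gh = 1 \<and> bij_betw \<epsilon> {1..m} (edges Gh) \<and>
              OSC d (domain_of Gh 1) m (\<lambda>t. map_of_edge Gh (\<epsilon> t)) \<longrightarrow>
            (\<exists>\<alpha>. (\<Sum>t=1..m. \<rho> (\<epsilon> t) powr \<alpha>) = 1 \<and>
                 (\<forall>\<beta>. (\<Sum>t=1..m. \<rho> (\<epsilon> t) powr \<beta>) = 1 \<longrightarrow> \<beta> = \<alpha>) \<and>
                 hausdorff_dim d K = ereal \<alpha>))"
proof -
  interpret flat_manifold A g
    using assms(1) unfolding complete_flat_orientable_manifold_def by (unfold_locales) auto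
  have le: "locally_euclidean_space TYPE(real ^ 'n) d"
    unfolding assms(2) by (rule riem_dist_locally_euclidean)
  have sg: "similitude_gifs TYPE(real ^ 'n) d Gh (gifs_order Gh) \<rho> Wh K"
    if "minimal_simplified_GIFS d G W Gh Wh" for Gh Wh
    by (rule minimal_GIFS_similitude_gifs[OF le assms(3,4,6,7) that])
  have main: "\<exists>\<alpha>\<ge>0. spectral_radius (incidence_matrix Gh \<rho> \<alpha>) = 1 \<and>
      (\<forall>\<beta>\<ge>0. spectral_radius (incidence_matrix Gh \<rho> \<beta>) = 1 \<longrightarrow> \<beta> = \<alpha>) \<and> hausdorff_dim d K = ereal \<alpha>"
    if min: "minimal_simplified_GIFS d G W Gh Wh" and gosc: "GOSC d Gh" for Gh Wh
  proof -
    interpret weighted_gifs Gh "gifs_order Gh" \<rho> using sg[OF min] by (simp add: similitude_gifs_def)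
    have im: "incidence_matrix Gh \<rho> s = complex_mat (gifs_order Gh) (weight s)" for s
      by (simp add: incidence_matrix_def weight_def)
    show ?thesis
      unfolding im by (rule similitude_gifs.gifs_hausdorff_dim[OF sg[OF min] gosc]) blast
  qed
  moreover have "\<exists>\<alpha>. (\<Sum>t=1..m. \<rho> (\<epsilon> t) powr \<alpha>) = 1 \<and>
      (\<forall>\<beta>. (\<Sum>t=1..m. \<rho> (\<epsilon> t) powr \<beta>) = 1 \<longrightarrow> \<beta> = \<alpha>) \<and> hausdorff_dim d K = ereal \<alpha>"
    if min: "minimal_simplified_GIFS d G W Gh Wh" and one: "gifs_order Gh = 1"
      and \<epsilon>: "bij_betw \<epsilon> {1..m} (edges Gh)" and osc: "OSC d (domain_of Gh 1) m (\<lambda>t. map_of_edge Gh (\<epsilon> t))"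
    for Gh Wh m \<epsilon>
  proof -
    interpret weighted_gifs Gh "gifs_order Gh" \<rho> using sg[OF min] by (simp add: similitude_gifs_def)
    have v: "verts (graph Gh) = {1}" using verts one by simp
    obtain \<alpha> where \<alpha>: "spectral_radius (incidence_matrix Gh \<rho> \<alpha>) = 1" "hausdorff_dim d K = ereal \<alpha>"
      using main[OF min OSC_imp_GOSC[OF fin_digraph v \<epsilon> osc]] by blast
    interpret fin_digraph "graph Gh" by (rule fin_digraph)
    have "edges_between Gh 1 1 = edges Gh"
      using v tail_in_verts head_in_verts by (auto simp: edges_between_iff)
    hence S: "(\<Sum>e\<in>edges_between Gh (Suc 0) (Suc 0). \<rho> e powr s) = (\<Sum>t=1..m. \<rho> (\<epsilon> t) powr s)" for s
      using sum.reindex_bij_betw[OF \<epsilon>, of "\<lambda>e. \<rho> e powr s"] by simp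
    have "incidence_matrix Gh \<rho> \<alpha> = complex_mat 1 (\<lambda>i j. \<Sum>t=1..m. \<rho> (\<epsilon> t) powr \<alpha>)"
      unfolding incidence_matrix_def one by (intro eq_matI) (simp_all add: S del: of_real_sum)
    with \<alpha>(1) have "spectral_radius (complex_mat 1 (\<lambda>i j. \<Sum>t=1..m. \<rho> (\<epsilon> t) powr \<alpha>)) = 1"
      by (simp only:)
    hence 1: "(\<Sum>t=1..m. \<rho> (\<epsilon> t) powr \<alpha>) = 1"
      by (rule spectral_radius_singleton[rotated]) (simp add: sum_nonneg)
    have "0 < \<rho> (\<epsilon> t) \<and> \<rho> (\<epsilon> t) < 1" if "t \<in> {1..m}" for t
      using ratio bij_betwE[OF \<epsilon>] that by blast
    from powr_sum_eq_1_unique[OF _ this 1] have "\<beta> = \<alpha>" if "(\<Sum>t=1..m. \<rho> (\<epsilon> t) powr \<beta>) = 1" for \<beta>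
      using that by blast
    with 1 \<alpha>(2) show ?thesis by blast
  qed
  ultimately show ?thesis by blast
qed

end
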